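(* Let $n,N,L\ge1$ be integers and let $\beta$ be a multi-index with $L\ge N+|\beta|$. Let $a_\gamma\in\mathbb{R}$ ($0\le|\gamma|\le N-1$) be given with $a_0=1$, and let $n_0$ be the smallest integer with $n_0>n/2$. Suppose that $\mathcal{H}:\mathbb{R}^n\to\mathbb{R}$ is differentiable up to order $n_0$ and satisfies: there exist $K>N+n$ and constants $C_\kappa>0$ such that $$|\partial^\kappa\mathcal{H}(x)|\le C_\kappa(1+|x|)^{-K},\qquad x\in\mathbb{R}^n,\ 0\le|\kappa|\le n_0,$$ and $$\int_{\mathbb{R}^n}\mathcal{H}(x)\,dx=1,\qquad \sum_{\alpha\le\kappa}\frac{a_{\kappa-\alpha}}{\alpha!}\int_{\mathbb{R}^n}x^\alpha\mathcal{H}(x)\,dx=0\quad\text{for all }\kappa\text{ with }1\le|\kappa|\le N-1 .$$ Moreover, suppose that the derivative $\partial^\beta\mathcal{H}$ exists, is differentiable up to order $n_0$, and that there exist $K'>L+n$ and constants $C'_\kappa>0$ such that $$|\partial^\kappa(\partial^\beta\mathcal{H})(x)|\le C'_\kappa(1+|x|)^{-K'},\qquad x\in\mathbb{R}^n,\ 0\le|\kappa|\le n_0 .$$ Then there are constants $c_1,c_2$, independent of $u$, $h$ and $\mathcal{D}$, such that for any $\varepsilon>0$ there exists $\mathcal{D}>0$ such that for any $h>0$, any $u\in W^L_\infty(\mathbb{R}^n)$ and any $x\in\mathbb{R}^n$, $$|\partial^\beta Mu(x)-\partial^\beta u(x)|\le\varepsilon\sum_{|\gamma|=0}^{L-1}(h\sqrt{\mathcal{D}})^{|\gamma|-|\beta|}|\partial^\gamma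 u(x)|+c_1(h\sqrt{\mathcal{D}})^{L-|\beta|}\sum_{|\gamma|=L}\|\partial^\gamma u\|_{L_\infty}+c_2(h\sqrt{\mathcal{D}})^N\sum_{|\alpha|=N}\|\partial^{\alpha+\beta}u\|_{L_\infty},$$ where $Mu$ is the Hermite quasi-interpolant defined in the context.
   Context: Greek letters $\alpha,\beta,\gamma,\kappa$ denote multi-indices in $\mathbb{Z}_{\ge0}^n$; $\alpha\le\kappa$ is meant componentwise. For $h>0$, $\mathcal{D}>0$ the Hermite quasi-interpolant is $$Mu(x)=\mathcal{D}^{-n/2}\sum_{m\in\mathbb{Z}^n}\Big(\sum_{|\gamma|=0}^{N-1}(-h\sqrt{\mathcal{D}})^{|\gamma|}a_\gamma\,\partial^\gamma u(hm)\Big)\mathcal{H}\Big(\frac{x-hm}{h\sqrt{\mathcal{D}}}\Big).$$ $W^L_\infty(\mathbb{R}^n)$ is the Sobolev space of functions whose derivatives up to order $L$ are in $L_\infty(\mathbb{R}^n)$; derivatives of order at most $L-1$ are evaluated pointwise via their continuous representatives. *)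

theory Defs
  imports "HOL-Probability.Essential_Supremum" "HOL-Analysis.Analysis"
begin

text \<open>Multi-indices are vectors of type \<^typ>\<open>nat^'n\<close>; their order, sum and difference are
  the componentwise ones of the library.\<close>

definition mi_abs :: "nat^'n \<Rightarrow> nat" where
  "mi_abs \<alpha> = (\<Sum>i\<in>UNIV. \<alpha> $ i)"

definition mi_fact :: "nat^'n \<Rightarrow> real" where
  "mi_fact \<alpha> = (\<Prod>i\<in>UNIV. fact (\<alpha> $ i))"

definition mi_monom :: "real^'n \<Rightarrow> nat^'n \<Rightarrow> real" where
  "mi_monom x \<alpha> = (\<Prod>i\<in>UNIV. (x $ i) ^ (\<alpha> $ i))"

primrec iterated_partial ::
  "'n list \<Rightarrow> (real^'n \<Rightarrow> real) \<Rightarrow> (real^'n \<Rightarrow> real) \<Rightarrow> bool" where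
  "iterated_partial [] f g \<longleftrightarrow> g = f"
| "iterated_partial (i # is) f g \<longleftrightarrow>
     (\<exists>f'. (\<forall>x. ((\<lambda>t. f (x + t *\<^sub>R axis i 1)) has_real_derivative f' x) (at 0)) \<and>
           iterated_partial is f' g)"

text \<open>The multi-index notation presupposes that the order of the differentiations is immaterial:
  the iterated partial derivatives have to exist for every order in which \<open>\<alpha> $ i\<close>
  differentiations in each direction \<open>i\<close> can be arranged, and all of them have to agree.\<close>

definition has_multi_deriv ::
  "nat^'n \<Rightarrow> (real^'n \<Rightarrow> real) \<Rightarrow> (real^'n \<Rightarrow> real) \<Rightarrow> bool" where
  "has_multi_deriv \<alpha> f g \<longleftrightarrow>
     (\<forall>is. (\<forall>i. count_list is i = \<alpha> $ i) \<longrightarrow> iterated_partial is f g)"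

definition multi_deriv :: "nat^'n \<Rightarrow> (real^'n \<Rightarrow> real) \<Rightarrow> real^'n \<Rightarrow> real" where
  "multi_deriv \<alpha> f = (THE g. has_multi_deriv \<alpha> f g)"

text \<open>A function is \<open>k + 1\<close> times differentiable iff it is (Frechet) differentiable and all
  components of its derivative are \<open>k\<close> times differentiable.\<close>

primrec differentiable_upto :: "nat \<Rightarrow> (real^'n \<Rightarrow> real) \<Rightarrow> bool" where
  "differentiable_upto 0 f \<longleftrightarrow> True"
| "differentiable_upto (Suc k) f \<longleftrightarrow>
     (\<forall>x. f differentiable (at x)) \<and>
     (\<forall>i. differentiable_upto k (\<lambda>x. frechet_derivative f (at x) (axis i 1)))"

definition test_function :: "(real^'n \<Rightarrow> real) \<Rightarrow> bool" where
  "test_function \<phi> \<longleftrightarrow>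
     (\<forall>k. differentiable_upto k \<phi>) \<and> compact (closure {x. \<phi> x \<noteq> 0})"

definition locally_integrable :: "(real^'n \<Rightarrow> real) \<Rightarrow> bool" where
  "locally_integrable f \<longleftrightarrow> (\<forall>S. compact S \<longrightarrow> f absolutely_integrable_on S)"

definition has_weak_deriv ::
  "nat^'n \<Rightarrow> (real^'n \<Rightarrow> real) \<Rightarrow> (real^'n \<Rightarrow> real) \<Rightarrow> bool" where
  "has_weak_deriv \<alpha> u v \<longleftrightarrow>
     locally_integrable u \<and> locally_integrable v \<and>
     (\<forall>\<phi>. test_function \<phi> \<longrightarrow>
        (\<integral>x. u x * multi_deriv \<alpha> \<phi> x \<partial>lebesgue) =
        (-1) ^ mi_abs \<alpha> * (\<integral>x. v x * \<phi> x \<partial>lebesgue))"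

text \<open>The weak derivative is determined up to null sets. The continuous representative, which is
  unique, is taken whenever there is one, and an arbitrary representative otherwise. In
  particular, \<open>weak_deriv 0 u\<close> is the continuous representative of \<open>u\<close> itself if there is one.\<close>

definition weak_deriv :: "nat^'n \<Rightarrow> (real^'n \<Rightarrow> real) \<Rightarrow> real^'n \<Rightarrow> real" where
  "weak_deriv \<alpha> u =
     (if \<exists>v. has_weak_deriv \<alpha> u v \<and> continuous_on UNIV v
      then (SOME v. has_weak_deriv \<alpha> u v \<and> continuous_on UNIV v)
      else (SOME v. has_weak_deriv \<alpha> u v))"

definition in_Linf :: "(real^'n \<Rightarrow> real) \<Rightarrow> bool" where
  "in_Linf f \<longleftrightarrow>
     f \<in> borel_measurable lebesgue \<and> esssup lebesgue (\<lambda>x. ereal \<bar>f x\<bar>) < \<infinity>"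

definition Linf_norm :: "(real^'n \<Rightarrow> real) \<Rightarrow> real" where
  "Linf_norm f = real_of_ereal (esssup lebesgue (\<lambda>x. ereal \<bar>f x\<bar>))"

definition sobolev_Linf :: "nat \<Rightarrow> (real^'n \<Rightarrow> real) set" where
  "sobolev_Linf L =
     {u. in_Linf u \<and> (\<forall>\<gamma>. mi_abs \<gamma> \<le> L \<longrightarrow> (\<exists>v. has_weak_deriv \<gamma> u v \<and> in_Linf v))}"

definition lattice_pt :: "int^'n \<Rightarrow> real^'n" where
  "lattice_pt m = (\<chi> i. of_int (m $ i))"

definition hermite_qi_term ::
  "nat \<Rightarrow> (nat^'n \<Rightarrow> real) \<Rightarrow> (real^'n \<Rightarrow> real) \<Rightarrow> real \<Rightarrow> real \<Rightarrow> (real^'n \<Rightarrow> real)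
    \<Rightarrow> real^'n \<Rightarrow> int^'n \<Rightarrow> real" where
  "hermite_qi_term N a H \<D> h u x m =
     (\<Sum>\<gamma> | mi_abs \<gamma> \<le> N - 1.
        (- (h * sqrt \<D>)) ^ mi_abs \<gamma> * a \<gamma> * weak_deriv \<gamma> u (h *\<^sub>R lattice_pt m)) *
     H ((x - h *\<^sub>R lattice_pt m) /\<^sub>R (h * sqrt \<D>))"

definition hermite_qi ::
  "nat \<Rightarrow> (nat^'n \<Rightarrow> real) \<Rightarrow> (real^'n \<Rightarrow> real) \<Rightarrow> real \<Rightarrow> real \<Rightarrow> (real^'n \<Rightarrow> real)
    \<Rightarrow> real^'n \<Rightarrow> real" where
  "hermite_qi N a H \<D> h u x =
     \<D> powr (- real CARD('n) / 2) * (\<Sum>\<^sub>\<infinity>m\<in>UNIV. hermite_qi_term N a H \<D> h u x m)"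

end

theory Submission
  imports Defs
begin

text \<open>
  Put \<open>\<delta> = h * sqrt \<D>\<close>, \<open>\<eta> = 1 / sqrt \<D>\<close>, \<open>G = \<partial>\<^sup>\<beta> H\<close> and, for a fixed point \<open>x\<close>, \<open>z\<^sub>m = x / \<delta> - \<eta> m\<close>. The nodes
  are \<open>h m = x - \<delta> z\<^sub>m\<close>, so that termwise differentiation gives
  \<open>\<delta>\<^bsup>|\<beta>|\<^esup> \<partial>\<^sup>\<beta> Mu(x) = \<eta>\<^sup>n \<Sum>\<^sub>m (\<Sum>\<^sub>\<gamma> (-\<delta>)\<^bsup>|\<gamma>|\<^esup> a\<^sub>\<gamma> \<partial>\<^sup>\<gamma>u(x - \<delta> z\<^sub>m)) G(z\<^sub>m)\<close>.
  Taylor expansion of \<open>\<partial>\<^sup>\<gamma>u\<close> at \<open>x\<close> up to total order \<open>L - 1\<close> leaves a remainder of size \<open>\<delta>\<^sup>L\<close>, which enters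
  the \<open>c\<^sub>1\<close> term, and replaces the sum over the nodes by the discrete moments
  \<open>\<eta>\<^sup>n \<Sum>\<^sub>m z\<^sub>m\<^sup>\<alpha> G(z\<^sub>m)\<close> (\<open>lattice_mean_taylor\<close>). These are Riemann sums of the integrals \<open>\<integral> z\<^sup>\<alpha> G(z) dz\<close>,
  and they converge uniformly in \<open>x\<close> as \<open>\<eta> \<rightarrow> 0\<close> (\<open>riemann_sum_uniform\<close>): a large \<open>\<D>\<close> makes the error
  small, which is the \<open>\<epsilon>\<close> term. Integration by parts turns the moments of \<open>G\<close> into those of \<open>H\<close>
  (\<open>moments_of_derivative\<close>), and then the conditions on the \<open>a\<^sub>\<gamma>\<close> cancel everything of order below
  \<open>N + |\<beta>|\<close> except \<open>\<partial>\<^sup>\<beta>u(x)\<close> itself (\<open>moment_cancellation\<close>). The surviving terms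
  \<open>\<delta>\<^bsup>|\<kappa>|\<^esup> \<partial>\<^bsup>\<beta>+\<kappa>\<^esup>u(x)\<close> with \<open>N \<le> |\<kappa>|\<close> and \<open>|\<beta>| + |\<kappa>| < L\<close> lie between the orders \<open>N\<close> and \<open>L - |\<beta>|\<close> of the
  two norms on the right, and an inequality of Landau-Kolmogorov type (\<open>intermediate_deriv_bound\<close>)
  bounds them by these norms.

  Two facts prepare this. First, the hypotheses bound \<open>H\<close> and \<open>\<partial>\<^sup>\<beta>H\<close>, whereas termwise differentiation and
  integration by parts need decay of all derivatives in between. Integrating \<open>G\<close> repeatedly from infinity
  produces a function with decaying derivatives whose \<open>\<beta>\<close>-th derivative is \<open>G\<close>. Its difference to \<open>H\<close> decays
  and has vanishing \<open>\<beta>\<close>-th derivative, hence vanishes: its iterated differences are zero, and with growing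
  step width all but one of their terms disappear (\<open>intermediate_partials_decay\<close>). Second, for
  \<open>u \<in> W\<^sup>L\<^sub>\<infinity>\<close> the weak derivatives of order below \<open>L\<close> have continuous representatives that are
  derivatives of each other in the classical sense, those of order \<open>L - 1\<close> being Lipschitz
  (\<open>sobolev_deriv_family\<close>). This comes from averages over boxes: testing with smooth functions that tend
  to the indicator of a box bounds the increments of the averages by the norm of the weak derivative,
  uniformly in the size of the box.
\<close>

section \<open>Multi-indices\<close>

lemma mi_abs_add: "mi_abs (\<alpha> + \<beta>) = mi_abs \<alpha> + mi_abs \<beta>"
  by (simp add: mi_abs_def sum.distrib)

text \<open>A constant of its own, since the unit in \<open>axis i 1\<close> would be rewritten to a successor.\<close>

definition mi_unit :: "'n \<Rightarrow> nat^'n" where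
  "mi_unit i = axis i 1"

lemma mi_unit_nth [simp]: "mi_unit i $ j = (if j = i then 1 else 0)"
  by (simp add: mi_unit_def axis_def)

lemma mi_abs_unit: "mi_abs (mi_unit i) = 1"
  by (simp add: mi_abs_def)

lemma mi_abs_0: "mi_abs 0 = 0"
  by (simp add: mi_abs_def)

lemma mi_abs_eq_0_iff: "mi_abs \<alpha> = 0 \<longleftrightarrow> \<alpha> = 0"
  by (simp add: mi_abs_def vec_eq_iff)

lemma component_le_mi_abs: "\<alpha> $ i \<le> mi_abs \<alpha>"
  unfolding mi_abs_def by (rule member_le_sum) auto

lemma mi_abs_mono: "\<alpha> \<le> \<beta> \<Longrightarrow> mi_abs \<alpha> \<le> mi_abs \<beta>"
  unfolding mi_abs_def by (rule sum_mono) (simp add: less_eq_vec_def)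

lemma finite_mi_abs_le: "finite {\<alpha>::nat^'n. mi_abs \<alpha> \<le> k}"
proof (rule finite_subset)
  show "{\<alpha>::nat^'n. mi_abs \<alpha> \<le> k} \<subseteq> vec_lambda ` (UNIV \<rightarrow>\<^sub>E {..k})"
  proof
    fix \<alpha> :: "nat^'n" assume "\<alpha> \<in> {\<alpha>. mi_abs \<alpha> \<le> k}"
    then have "($) \<alpha> \<in> UNIV \<rightarrow>\<^sub>E {..k}"
      using component_le_mi_abs[of \<alpha>] by (auto intro: order_trans)
    then show "\<alpha> \<in> vec_lambda ` (UNIV \<rightarrow>\<^sub>E {..k})"
      by (metis imageI vec_nth_inverse)
  qed
qed (simp add: finite_PiE)

lemma finite_mi_abs_eq: "finite {\<alpha>::nat^'n. mi_abs \<alpha> = k}"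
  by (rule finite_subset[OF _ finite_mi_abs_le[of k]]) auto

lemma mi_add_diff_inverse: "\<alpha> \<le> \<kappa> \<Longrightarrow> \<alpha> + (\<kappa> - \<alpha>) = (\<kappa> :: nat^'n)"
  by (simp add: vec_eq_iff less_eq_vec_def)

lemma mi_le_add: "\<alpha> \<le> \<alpha> + (\<beta> :: nat^'n)"
  by (simp add: less_eq_vec_def)

lemma mi_abs_SucE:
  assumes "mi_abs (\<alpha>::nat^'n) = Suc k"
  obtains i \<alpha>' where "\<alpha> = \<alpha>' + mi_unit i" "mi_abs \<alpha>' = k"
proof -
  have "\<alpha> \<noteq> 0" using assms by (auto simp: mi_abs_0)
  then obtain i where i: "\<alpha> $ i \<noteq> 0" by (auto simp: vec_eq_iff)
  have le: "mi_unit i \<le> \<alpha>" using i by (auto simp: less_eq_vec_def)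
  have eq: "\<alpha> = (\<alpha> - mi_unit i) + mi_unit i"
    using mi_add_diff_inverse[OF le] by (simp add: add.commute)
  have "mi_abs (\<alpha> - mi_unit i) = k"
    using assms mi_abs_add[of "\<alpha> - mi_unit i" "mi_unit i"] eq by (simp add: mi_abs_unit)
  then show thesis using that eq by blast
qed

lemma exists_mi_below:
  assumes "k \<le> mi_abs (\<kappa>::nat^'n)"
  shows "\<exists>\<alpha>\<le>\<kappa>. mi_abs \<alpha> = k"
  using assms
proof (induction "mi_abs \<kappa> - k" arbitrary: \<kappa>)
  case 0
  then show ?case by (intro exI[of _ \<kappa>]) simp
next
  case (Suc d)
  then obtain m where "mi_abs \<kappa> = Suc m" by (cases "mi_abs \<kappa>") auto
  then obtain i \<kappa>' where k: "\<kappa> = \<kappa>' + mi_unit i" "mi_abs \<kappa>' = m" by (rule mi_abs_SucE)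
  have "\<exists>\<alpha>\<le>\<kappa>'. mi_abs \<alpha> = k"
    using Suc k by (intro Suc.hyps(1)) (auto simp: mi_abs_add mi_abs_unit)
  then show ?case using k mi_le_add by (metis order_trans)
qed

text \<open>The orders in which the differentiations of a multi-index can be carried out one after the
  other. Inductions over derivatives are inductions over such lists.\<close>

definition mi_list :: "nat^'n \<Rightarrow> 'n list \<Rightarrow> bool" where
  "mi_list \<alpha> is \<longleftrightarrow> (\<forall>i. count_list is i = \<alpha> $ i)"

lemma mi_list_length: "mi_list \<alpha> is \<Longrightarrow> length is = mi_abs (\<alpha>::nat^'n)"
  using sum_count_set[of "is" UNIV] by (simp add: mi_list_def mi_abs_def)

lemma mi_list_Nil: "mi_list 0 []"
  by (simp add: mi_list_def)

lemma mi_list_Cons: "mi_list \<alpha> is \<Longrightarrow> mi_list (\<alpha> + mi_unit i) (i # is)"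
  by (auto simp: mi_list_def)

lemma mi_list_ConsE:
  assumes "mi_list (\<alpha>::nat^'n) (i # is)"
  obtains \<alpha>' where "\<alpha> = \<alpha>' + mi_unit i" "mi_list \<alpha>' is"
proof -
  have le: "mi_unit i \<le> \<alpha>" using assms
    by (simp add: less_eq_vec_def mi_list_def) (metis One_nat_def Suc_eq_plus1 Suc_leI zero_less_Suc)
  have eq: "\<alpha> = (\<alpha> - mi_unit i) + mi_unit i"
    using mi_add_diff_inverse[OF le] by (simp add: add.commute)
  have "mi_list (\<alpha> - mi_unit i) is"
    unfolding mi_list_def
  proof
    fix j
    have "count_list (i # is) j = \<alpha> $ j" using assms unfolding mi_list_def by blast
    then show "count_list is j = (\<alpha> - mi_unit i) $ j"
      by (simp split: if_splits)
  qed
  then show thesis using that eq by blast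
qed

lemma exists_mi_list: "\<exists>is. mi_list (\<alpha>::nat^'n) is"
proof (induction "mi_abs \<alpha>" arbitrary: \<alpha>)
  case 0
  then show ?case using mi_list_Nil by (metis mi_abs_eq_0_iff)
next
  case (Suc k)
  obtain i \<alpha>' where "\<alpha> = \<alpha>' + mi_unit i" "mi_abs \<alpha>' = k"
    using mi_abs_SucE[OF Suc.hyps(2)[symmetric]] by blast
  then show ?case using Suc.hyps(1) mi_list_Cons by blast
qed

lemma has_multi_deriv_iff: "has_multi_deriv \<alpha> f g \<longleftrightarrow> (\<forall>is. mi_list \<alpha> is \<longrightarrow> iterated_partial is f g)"
  by (simp add: has_multi_deriv_def mi_list_def)

section \<open>Iterated partial derivatives and iterated differences\<close>

definition has_partial :: "'n \<Rightarrow> (real^'n \<Rightarrow> real) \<Rightarrow> (real^'n \<Rightarrow> real) \<Rightarrow> bool" where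
  "has_partial i f f' \<longleftrightarrow>
     (\<forall>x. ((\<lambda>t. f (x + t *\<^sub>R axis i 1)) has_real_derivative f' x) (at 0))"

lemma iterated_partial_Cons:
  "iterated_partial (i # is) f g \<longleftrightarrow> (\<exists>f'. has_partial i f f' \<and> iterated_partial is f' g)"
  by (simp add: has_partial_def)

lemma has_partial_unique: "has_partial i f f' \<Longrightarrow> has_partial i f f'' \<Longrightarrow> f' = f''"
  unfolding has_partial_def by (rule ext) (blast intro: DERIV_unique)

lemma iterated_partial_unique:
  "iterated_partial is f g \<Longrightarrow> iterated_partial is f g' \<Longrightarrow> g = g'"
proof (induction "is" arbitrary: f)
  case (Cons i "is")
  then show ?case unfolding iterated_partial_Cons using has_partial_unique by blast
qed simp

lemma multi_deriv_eq:
  assumes "has_multi_deriv \<alpha> f g"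
  shows "multi_deriv \<alpha> f = g"
proof -
  obtain js where js: "mi_list \<alpha> js" using exists_mi_list by blast
  have "g' = g" if "has_multi_deriv \<alpha> f g'" for g'
    using that assms js unfolding has_multi_deriv_iff by (blast intro: iterated_partial_unique)
  with assms show ?thesis unfolding multi_deriv_def by (rule the_equality)
qed

lemma has_multi_deriv_0_iff: "has_multi_deriv (0::nat^'n) f g \<longleftrightarrow> g = f"
proof -
  have "mi_list (0::nat^'n) is \<longleftrightarrow> is = []" for "is"
    using mi_list_length[of "0::nat^'n" "is"] by (auto simp: mi_abs_0 mi_list_Nil)
  then show ?thesis by (simp add: has_multi_deriv_iff)
qed

lemma multi_deriv_0: "multi_deriv (0::nat^'n) f = f"
  by (rule multi_deriv_eq) (simp add: has_multi_deriv_0_iff)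

lemma has_partialD:
  assumes "has_partial i f f'"
  shows "((\<lambda>t. f (x + t *\<^sub>R axis i 1)) has_real_derivative f' (x + s *\<^sub>R axis i 1)) (at s)"
proof -
  have "((\<lambda>t. f ((x + s *\<^sub>R axis i 1) + t *\<^sub>R axis i 1)) has_real_derivative
          f' (x + s *\<^sub>R axis i 1)) (at 0)"
    using assms unfolding has_partial_def by blast
  then have "((\<lambda>t. f (x + (s + t) *\<^sub>R axis i 1)) has_real_derivative f' (x + s *\<^sub>R axis i 1)) (at 0)"
    by (simp add: algebra_simps)
  then show ?thesis using DERIV_shift[of "\<lambda>t. f (x + t *\<^sub>R axis i 1)" _ 0 s] by (simp add: add.commute)
qed

lemma has_partial_diff:
  "has_partial i f f' \<Longrightarrow> has_partial i g g' \<Longrightarrow> has_partial i (\<lambda>x. f x - g x) (\<lambda>x. f' x - g' x)"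
  unfolding has_partial_def by (auto intro: DERIV_diff)

lemma has_partial_shift:
  assumes "has_partial i f f'"
  shows "has_partial i (\<lambda>x. f (x + v)) (\<lambda>x. f' (x + v))"
  unfolding has_partial_def
proof
  fix x
  have "((\<lambda>t. f ((x + v) + t *\<^sub>R axis i 1)) has_real_derivative f' (x + v)) (at 0)"
    using assms unfolding has_partial_def by blast
  moreover have "x + t *\<^sub>R axis i 1 + v = (x + v) + t *\<^sub>R axis i 1" for t
    by (simp add: algebra_simps)
  ultimately show "((\<lambda>t. f (x + t *\<^sub>R axis i 1 + v)) has_real_derivative f' (x + v)) (at 0)"
    by presburger
qed

lemma has_partial_mvt:
  assumes "has_partial i f f'"
  shows "\<exists>\<theta>\<in>{0..1}. f (x + t *\<^sub>R axis i 1) - f x = t * f' (x + (\<theta> * t) *\<^sub>R axis i 1)"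
proof -
  define \<phi> where "\<phi> = (\<lambda>s. f (x + (s * t) *\<^sub>R axis i 1))"
  have d: "(\<phi> has_real_derivative (f' (x + (s * t) *\<^sub>R axis i 1) * t)) (at s)" for s
    unfolding \<phi>_def
    by (rule DERIV_chain2[OF has_partialD[OF assms]]) (auto intro!: derivative_eq_intros)
  have "\<exists>z::real. 0 < z \<and> z < 1 \<and> \<phi> 1 - \<phi> 0 = (1 - 0) * (f' (x + (z * t) *\<^sub>R axis i 1) * t)"
    by (rule MVT2) (use d in auto)
  then obtain z where "0 < z" "z < 1" "\<phi> 1 - \<phi> 0 = f' (x + (z * t) *\<^sub>R axis i 1) * t" by auto
  then show ?thesis by (intro bexI[of _ z]) (auto simp: \<phi>_def mult.commute)
qed

primrec iterated_diff :: "('n \<Rightarrow> real) \<Rightarrow> 'n list \<Rightarrow> (real^'n \<Rightarrow> real) \<Rightarrow> real^'n \<Rightarrow> real" where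
  "iterated_diff \<tau> [] f = f"
| "iterated_diff \<tau> (i # is) f =
     (\<lambda>x. iterated_diff \<tau> is f (x + \<tau> i *\<^sub>R axis i 1) - iterated_diff \<tau> is f x)"

lemma has_partial_iterated_diff:
  "has_partial j f f' \<Longrightarrow> has_partial j (iterated_diff \<tau> is f) (iterated_diff \<tau> is f')"
  by (induction "is") (auto intro: has_partial_diff has_partial_shift)

text \<open>Differences commute with partial derivatives, so the mean value theorem can be applied once per
  direction. In this way the highest derivative controls the function without any information on the
  derivatives in between: symmetry of mixed derivatives, the decay of intermediate derivatives and the
  interpolation inequality all rest on it.\<close>

lemma iterated_diff_mvt:
  fixes f :: "real^'n \<Rightarrow> real"
  assumes "iterated_partial is f g"
  shows "\<exists>\<xi>. norm (\<xi> - x) \<le> (\<Sum>i\<leftarrow>is. \<bar>\<tau> i\<bar>) \<and> iterated_diff \<tau> is f x = (\<Prod>i\<leftarrow>is. \<tau> i) * g \<xi>"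
  using assms
proof (induction "is" arbitrary: f x)
  case (Cons i "is")
  then obtain f' where f': "has_partial i f f'" "iterated_partial is f' g"
    unfolding iterated_partial_Cons by blast
  obtain \<theta> where \<theta>: "\<theta> \<in> {0..1}" "iterated_diff \<tau> (i # is) f x =
      \<tau> i * iterated_diff \<tau> is f' (x + (\<theta> * \<tau> i) *\<^sub>R axis i 1)"
    using has_partial_mvt[OF has_partial_iterated_diff[OF f'(1), of \<tau> "is"], of x "\<tau> i"] by auto
  obtain \<xi> where \<xi>: "norm (\<xi> - (x + (\<theta> * \<tau> i) *\<^sub>R axis i 1)) \<le> (\<Sum>i\<leftarrow>is. \<bar>\<tau> i\<bar>)"
      "iterated_diff \<tau> is f' (x + (\<theta> * \<tau> i) *\<^sub>R axis i 1) = (\<Prod>i\<leftarrow>is. \<tau> i) * g \<xi>"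
    using Cons.IH[OF f'(2)] by blast
  have "norm (\<xi> - x) \<le> norm (\<xi> - (x + (\<theta> * \<tau> i) *\<^sub>R axis i 1)) + norm ((\<theta> * \<tau> i) *\<^sub>R axis i (1::real) :: real^'n)"
    by (rule order_trans[OF _ norm_triangle_ineq]) (simp add: algebra_simps)
  also have "norm ((\<theta> * \<tau> i) *\<^sub>R axis i (1::real) :: real^'n) \<le> \<bar>\<tau> i\<bar>"
    using \<theta>(1) by (auto simp: abs_mult intro: mult_left_le_one_le)
  finally have "norm (\<xi> - x) \<le> (\<Sum>i\<leftarrow>i # is. \<bar>\<tau> i\<bar>)" using \<xi>(1) by simp
  then show ?case using \<theta>(2) \<xi>(2) by (intro exI[of _ \<xi>]) simp
qed simp

text \<open>Both mixed derivatives are limits of one second difference quotient, which is symmetric in the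
  two directions.\<close>

lemma mixed_partials_commute:
  assumes "has_partial i f fi" "has_partial j fi fij" "has_partial j f fj" "has_partial i fj fji"
    and "continuous_on UNIV fij" "continuous_on UNIV fji"
  shows "fij = fji"
proof
  fix x
  define s where "s = (\<lambda>k. 1 / real (Suc k))"
  have s: "s k > 0" for k by (simp add: s_def)
  have 1: "iterated_partial [i, j] f fij" "iterated_partial [j, i] f fji"
    using assms(1-4) unfolding iterated_partial_Cons by auto
  have "\<exists>a b. norm (a - x) \<le> 2 * s k \<and> norm (b - x) \<le> 2 * s k \<and> fij a = fji b" for k
  proof -
    obtain a where a: "norm (a - x) \<le> 2 * s k" "iterated_diff (\<lambda>_. s k) [i, j] f x = s k * s k * fij a"
      using iterated_diff_mvt[OF 1(1), of x "\<lambda>_. s k"] s[of k] by auto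
    obtain b where b: "norm (b - x) \<le> 2 * s k" "iterated_diff (\<lambda>_. s k) [j, i] f x = s k * s k * fji b"
      using iterated_diff_mvt[OF 1(2), of x "\<lambda>_. s k"] s[of k] by auto
    have "iterated_diff (\<lambda>_. s k) [i, j] f x = iterated_diff (\<lambda>_. s k) [j, i] f x"
      by (simp add: algebra_simps)
    then have "s k * s k * fij a = s k * s k * fji b" using a(2) b(2) by metis
    then have "fij a = fji b" using s[of k] by simp
    then show ?thesis using a b by blast
  qed
  then obtain a b where ab: "\<And>k. norm (a k - x) \<le> 2 * s k" "\<And>k. norm (b k - x) \<le> 2 * s k"
      "\<And>k. fij (a k) = fji (b k)" by metis
  have s0: "(\<lambda>k. 2 * s k) \<longlonglongrightarrow> 0"
    unfolding s_def using tendsto_mult_right_zero[OF LIMSEQ_inverse_real_of_nat, of 2]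
    by (simp add: divide_inverse)
  have "a \<longlonglongrightarrow> x" "b \<longlonglongrightarrow> x"
    using ab(1,2) by (auto intro!: Lim_null_comparison[OF _ s0] simp: LIM_zero_iff[symmetric, of _ x])
  then have "(\<lambda>k. fij (a k)) \<longlonglongrightarrow> fij x" "(\<lambda>k. fji (b k)) \<longlonglongrightarrow> fji x"
    using assms(5,6) by (auto simp: continuous_on_eq_continuous_at intro: isCont_tendsto_compose)
  then show "fij x = fji x" using ab(3) LIMSEQ_unique by simp
qed

text \<open>Passing from \<open>x\<close> to \<open>y\<close> by exchanging one coordinate after the other reduces increments of a
  function of several variables to increments in the directions of the axes.\<close>

lemma coordinate_path_bound:
  fixes P :: "real^'n \<Rightarrow> real"
  assumes "\<And>S i. i \<notin> S \<Longrightarrow>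
      \<bar>P (\<chi> j. if j \<in> insert i S then y $ j else x $ j) - P (\<chi> j. if j \<in> S then y $ j else x $ j)\<bar> \<le> B i"
  shows "\<bar>P y - P x\<bar> \<le> (\<Sum>i\<in>UNIV. B i)"
proof -
  have "\<bar>P (\<chi> j. if j \<in> S then y $ j else x $ j) - P x\<bar> \<le> (\<Sum>i\<in>S. B i)" if "finite S" for S
    using that
  proof (induction S rule: finite_induct)
    case (insert i S)
    then show ?case using assms[OF insert.hyps(2)] by auto
  qed simp
  from this[of UNIV] show ?thesis by simp
qed

section \<open>Smooth functions and test functions\<close>

definition pd :: "'n \<Rightarrow> (real^'n \<Rightarrow> real) \<Rightarrow> real^'n \<Rightarrow> real" where
  "pd i f = (\<lambda>x. frechet_derivative f (at x) (axis i 1))"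

definition smooth :: "(real^'n \<Rightarrow> real) \<Rightarrow> bool" where
  "smooth f \<longleftrightarrow> (\<forall>k. differentiable_upto k f)"

lemma differentiable_upto_SucI:
  assumes "\<And>x. (f has_derivative D x) (at x)" and "\<And>i. differentiable_upto k (\<lambda>x. D x (axis i 1))"
  shows "differentiable_upto (Suc k) f"
proof -
  have "frechet_derivative f (at x) = D x" for x
    using frechet_derivative_at[OF assms(1)] by simp
  then show ?thesis using assms by (auto simp: differentiable_def)
qed

lemma has_derivative_frechet:
  assumes "differentiable_upto (Suc k) f"
  shows "(f has_derivative frechet_derivative f (at x)) (at x)"
  using assms by (simp add: frechet_derivative_works)

lemma differentiable_upto_pd: "differentiable_upto (Suc k) f \<Longrightarrow> differentiable_upto k (pd i f)"
  by (simp add: pd_def)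

lemma differentiable_upto_Suc: "differentiable_upto (Suc k) f \<Longrightarrow> differentiable_upto k f"
proof (induction k arbitrary: f)
  case (Suc k)
  have "differentiable_upto k (pd i f)" for i
    using Suc.IH[OF differentiable_upto_pd[OF Suc.prems]] .
  then show ?case using Suc.prems by (simp add: pd_def)
qed simp

lemma differentiable_upto_const: "differentiable_upto k (\<lambda>_. c)"
proof (induction k arbitrary: c)
  case (Suc k)
  show ?case by (rule differentiable_upto_SucI[where D = "\<lambda>_ _. 0"]) (auto intro: Suc)
qed simp

lemma differentiable_upto_add:
  "differentiable_upto k f \<Longrightarrow> differentiable_upto k g \<Longrightarrow> differentiable_upto k (\<lambda>x. f x + g x)"
proof (induction k arbitrary: f g)
  case (Suc k)
  show ?case
    by (rule differentiable_upto_SucI[OF has_derivative_add[OF has_derivative_frechet has_derivative_frechet]])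
      (use Suc in auto)
qed simp

lemma differentiable_upto_mult:
  "differentiable_upto k f \<Longrightarrow> differentiable_upto k g \<Longrightarrow> differentiable_upto k (\<lambda>x. f x * g x)"
proof (induction k arbitrary: f g)
  case (Suc k)
  show ?case
    by (rule differentiable_upto_SucI[OF has_derivative_mult[OF has_derivative_frechet has_derivative_frechet]])
      (use Suc differentiable_upto_Suc[OF Suc.prems(1)] differentiable_upto_Suc[OF Suc.prems(2)]
        in \<open>auto intro!: differentiable_upto_add\<close>)
qed simp

lemma differentiable_upto_prod:
  "finite A \<Longrightarrow> (\<And>i. i \<in> A \<Longrightarrow> differentiable_upto k (f i)) \<Longrightarrow>
    differentiable_upto k (\<lambda>x. \<Prod>i\<in>A. f i x)"
  by (induction A rule: finite_induct) (auto intro: differentiable_upto_const differentiable_upto_mult)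

lemma smooth_differentiable: "smooth f \<Longrightarrow> f differentiable (at x)"
  unfolding smooth_def by (metis differentiable_upto.simps(2))

lemma smooth_pd: "smooth f \<Longrightarrow> smooth (pd i f)"
  unfolding smooth_def using differentiable_upto_pd by blast

lemma smooth_continuous: "smooth f \<Longrightarrow> continuous_on UNIV f"
  using smooth_differentiable differentiable_imp_continuous_within
  by (metis continuous_at_imp_continuous_on)

lemma has_partial_pd:
  fixes f :: "real^'n \<Rightarrow> real"
  assumes "\<And>x. f differentiable (at x)"
  shows "has_partial i f (pd i f)"
  unfolding has_partial_def
proof
  fix x :: "real^'n"
  have 1: "((\<lambda>t. x + t *\<^sub>R axis i 1) has_derivative (\<lambda>t. t *\<^sub>R axis i 1)) (at (0::real))"
    by (auto intro!: derivative_eq_intros)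
  have 2: "(f has_derivative frechet_derivative f (at x)) (at (x + 0 *\<^sub>R axis i 1))"
    using assms[of x] by (simp add: frechet_derivative_works)
  have "((\<lambda>t. f (x + t *\<^sub>R axis i 1)) has_derivative
          (\<lambda>t. frechet_derivative f (at x) (t *\<^sub>R axis i 1))) (at 0)"
    using has_derivative_compose[OF 1 2] .
  moreover have "frechet_derivative f (at x) (t *\<^sub>R axis i 1) = pd i f x * t" for t
    using linear_frechet_derivative[OF assms[of x]] by (simp add: linear_scale pd_def mult.commute)
  ultimately show "((\<lambda>t. f (x + t *\<^sub>R axis i 1)) has_real_derivative pd i f x) (at 0)"
    by (simp add: has_field_derivative_def)
qed

lemma smooth_has_partial: "smooth f \<Longrightarrow> has_partial i f (pd i f)"
  using has_partial_pd smooth_differentiable by blast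

lemma smooth_pd_commute:
  assumes "smooth f"
  shows "pd i (pd j f) = pd j (pd i f)"
  using assms by (intro mixed_partials_commute[of j f _ i])
    (auto intro: smooth_has_partial smooth_pd smooth_continuous)

text \<open>Extended to all functions in such a way that the operators commute everywhere; then the result
  of applying them along a list depends only on the multiset of its entries.\<close>

definition smooth_pd_op :: "'n \<Rightarrow> (real^'n \<Rightarrow> real) \<Rightarrow> real^'n \<Rightarrow> real" where
  "smooth_pd_op i f = (if smooth f then pd i f else f)"

lemma smooth_pd_op_commute: "smooth_pd_op i \<circ> smooth_pd_op j = smooth_pd_op j \<circ> smooth_pd_op i"
  by (rule ext) (simp add: smooth_pd_op_def smooth_pd smooth_pd_commute[of _ i j])

lemma iterated_partial_smooth:
  "smooth f \<Longrightarrow> iterated_partial is f (fold smooth_pd_op is f)"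
proof (induction "is" arbitrary: f)
  case (Cons i "is")
  then show ?case unfolding iterated_partial_Cons
    using Cons.IH[OF smooth_pd[OF Cons.prems]]
    by (intro exI[of _ "pd i f"]) (simp add: smooth_pd_op_def[of i] smooth_has_partial)
qed simp

lemma smooth_has_multi_deriv:
  assumes "smooth f" "mi_list \<alpha> is"
  shows "has_multi_deriv \<alpha> f (fold smooth_pd_op is f)"
  unfolding has_multi_deriv_iff
proof (intro allI impI)
  fix js assume "mi_list \<alpha> js"
  then have "mset js = mset is"
    using assms(2) by (intro multiset_eqI) (simp add: mi_list_def count_mset)
  then have "fold smooth_pd_op js = fold smooth_pd_op is"
    by (intro fold_multiset_equiv smooth_pd_op_commute)
  then show "iterated_partial js f (fold smooth_pd_op is f)"
    using iterated_partial_smooth[OF assms(1), of js] by simp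
qed

text \<open>This peels one derivative off a test function, so that weak derivatives can be treated one
  direction at a time.\<close>

lemma multi_deriv_pd:
  assumes "smooth f"
  shows "multi_deriv (\<alpha> + mi_unit i) f = multi_deriv \<alpha> (pd i f)"
proof -
  obtain js where js: "mi_list \<alpha> js" using exists_mi_list by blast
  have "multi_deriv (\<alpha> + mi_unit i) f = fold smooth_pd_op (i # js) f"
    using assms mi_list_Cons[OF js] by (intro multi_deriv_eq smooth_has_multi_deriv)
  also have "\<dots> = fold smooth_pd_op js (pd i f)" using assms by (simp add: smooth_pd_op_def)
  also have "\<dots> = multi_deriv \<alpha> (pd i f)"
    using smooth_has_multi_deriv[OF smooth_pd[OF assms] js] by (rule multi_deriv_eq[symmetric])
  finally show ?thesis .
qed

lemma test_function_smooth: "test_function \<phi> \<Longrightarrow> smooth \<phi>"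
  by (simp add: test_function_def smooth_def)

lemma test_function_pd:
  assumes "test_function \<phi>"
  shows "test_function (pd i \<phi>)"
proof -
  let ?K = "closure {x. \<phi> x \<noteq> 0}"
  have "pd i \<phi> x = 0" if "x \<notin> ?K" for x
  proof -
    have "(\<phi> has_derivative (\<lambda>_. 0)) (at x)"
    proof (rule has_derivative_transform_within_open[where f = "\<lambda>_. 0"])
      show "open (- ?K)" "x \<in> - ?K" using that by auto
      show "0 = \<phi> y" if "y \<in> - ?K" for y
        using that closure_subset[of "{x. \<phi> x \<noteq> 0}"] by auto
    qed auto
    then show ?thesis by (simp add: pd_def frechet_derivative_at[symmetric])
  qed
  then have "{x. pd i \<phi> x \<noteq> 0} \<subseteq> ?K" by blast
  then have "closure {x. pd i \<phi> x \<noteq> 0} \<subseteq> ?K" by (intro closure_minimal) auto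
  moreover have "compact ?K" using assms by (simp add: test_function_def)
  ultimately have "compact (closure {x. pd i \<phi> x \<noteq> 0})"
    using compact_Int_closed[of ?K "closure {x. pd i \<phi> x \<noteq> 0}"] by (simp add: Int_absorb1)
  then show ?thesis
    using smooth_pd[OF test_function_smooth[OF assms]] by (simp add: test_function_def smooth_def)
qed

lemma test_function_bound:
  assumes "test_function \<phi>"
  obtains B R where "B > 0" "R > 0" "\<And>x. \<bar>\<phi> x\<bar> \<le> B" "\<And>x. norm x > R \<Longrightarrow> \<phi> x = 0"
proof -
  let ?K = "closure {x. \<phi> x \<noteq> 0}"
  have K: "compact ?K" using assms by (simp add: test_function_def)
  have out: "\<phi> x = 0" if "x \<notin> ?K" for x using that closure_subset[of "{x. \<phi> x \<noteq> 0}"] by auto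
  have "compact (\<phi> ` ?K)"
    using K smooth_continuous[OF test_function_smooth[OF assms]] by (intro compact_continuous_image) (auto intro: continuous_on_subset)
  then obtain B where B: "B > 0" "\<And>x. x \<in> ?K \<Longrightarrow> \<bar>\<phi> x\<bar> \<le> B"
    using compact_imp_bounded bounded_pos by (metis imageI real_norm_def)
  obtain R where R: "R > 0" "\<And>x. x \<in> ?K \<Longrightarrow> norm x \<le> R"
    using K compact_imp_bounded bounded_pos by metis
  have "\<bar>\<phi> x\<bar> \<le> B" for x using B(1) B(2)[of x] out[of x] by (cases "x \<in> ?K") auto
  moreover have "\<phi> x = 0" if "norm x > R" for x using out[of x] R(2)[of x] that by (cases "x \<in> ?K") auto
  ultimately show thesis using that B R by blast
qed

section \<open>Smooth approximations of indicators of boxes\<close>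

text \<open>For \<open>j = 0\<close> this is the classical smooth function that is flat at \<open>0\<close>; the powers of \<open>1 / s\<close> make
  the family closed under differentiation.\<close>

definition flat_exp :: "real \<Rightarrow> nat \<Rightarrow> real \<Rightarrow> real" where
  "flat_exp c j s = (if s > 0 then exp (- c / s) / s ^ j else 0)"

text \<open>In terms of \<open>c / s\<close>, which tends to infinity, a power is divided by an exponential.\<close>

lemma flat_exp_tendsto_0:
  assumes "c > 0"
  shows "((\<lambda>s. flat_exp c j s) \<longlongrightarrow> 0) (at 0)"
proof -
  have "((\<lambda>x::real. x ^ j / exp x) \<longlongrightarrow> 0) at_top" by (rule tendsto_power_div_exp_0)
  moreover have "filterlim (\<lambda>s. c * inverse s) at_top (at_right (0::real))"
    using assms by (intro filterlim_tendsto_pos_mult_at_top[OF tendsto_const] filterlim_inverse_at_top_right)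
  ultimately have "((\<lambda>s. (c * inverse s) ^ j / exp (c * inverse s)) \<longlongrightarrow> 0) (at_right 0)"
    by (rule filterlim_compose)
  then have "((\<lambda>s. (c * inverse s) ^ j / exp (c * inverse s) / c ^ j) \<longlongrightarrow> 0) (at_right 0)"
    using tendsto_divide_zero by blast
  then have 1: "((\<lambda>s. flat_exp c j s) \<longlongrightarrow> 0) (at_right 0)"
    by (rule Lim_transform_eventually)
      (use assms in \<open>auto simp: flat_exp_def eventually_at_filter exp_minus field_simps\<close>)
  have 2: "((\<lambda>s. flat_exp c j s) \<longlongrightarrow> 0) (at_left 0)"
    by (rule Lim_transform_eventually[OF tendsto_const])
      (auto simp: flat_exp_def eventually_at_filter)
  show ?thesis using 1 2 by (simp add: filterlim_split_at)
qed

lemma flat_exp_deriv: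
  assumes "c > 0"
  shows "(flat_exp c j has_real_derivative
           (c * flat_exp c (j + 2) s - real j * flat_exp c (j + 1) s)) (at s)"
proof -
  consider "s > 0" | "s < 0" | "s = 0" by linarith
  then show ?thesis
  proof cases
    case 1
    have p: "real j * s ^ (j - Suc 0) = real j * s ^ j / s" using 1 by (cases j) auto
    have "((\<lambda>s. exp (- c / s) / s ^ j) has_real_derivative
        (c * flat_exp c (j + 2) s - real j * flat_exp c (j + 1) s)) (at s)"
      using 1 p by (auto intro!: derivative_eq_intros simp: flat_exp_def field_simps power2_eq_square)
    then show ?thesis
      by (rule has_field_derivative_transform_within_open[where S = "{0<..}"])
        (use 1 in \<open>auto simp: flat_exp_def\<close>)
  next
    case 2
    have "((\<lambda>s. 0) has_real_derivative (c * flat_exp c (j + 2) s - real j * flat_exp c (j + 1) s)) (at s)"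
      using 2 by (auto simp: flat_exp_def)
    then show ?thesis
      by (rule has_field_derivative_transform_within_open[where S = "{..<0}"])
        (use 2 in \<open>auto simp: flat_exp_def\<close>)
  next
    case 3
    have "((\<lambda>y. (flat_exp c j y - flat_exp c j 0) / (y - 0)) \<longlongrightarrow> 0) (at 0)"
      by (rule Lim_transform_eventually[OF flat_exp_tendsto_0[OF assms, of "j + 1"]])
        (auto simp: flat_exp_def eventually_at_filter)
    then show ?thesis using 3 by (simp add: has_field_derivative_iff flat_exp_def)
  qed
qed

lemma differentiable_upto_flat_exp:
  assumes "c > 0"
  shows "differentiable_upto k (\<lambda>x::real^'n. flat_exp c j (s * x $ i + t))"
proof (induction k arbitrary: j)
  case (Suc k)
  let ?D = "\<lambda>x::real^'n. c * flat_exp c (j + 2) (s * x $ i + t) - real j * flat_exp c (j + 1) (s * x $ i + t)"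
  have D: "((\<lambda>x::real^'n. flat_exp c j (s * x $ i + t)) has_derivative (\<lambda>h. (s * h $ i) * ?D x)) (at x)" for x
  proof -
    have "((\<lambda>x::real^'n. s * x $ i + t) has_derivative (\<lambda>h. s * h $ i)) (at x)"
      by (auto intro!: derivative_eq_intros bounded_linear_imp_has_derivative)
    from has_derivative_compose[OF this, OF flat_exp_deriv[OF assms, unfolded has_field_derivative_def]]
    show ?thesis by (simp add: mult.commute)
  qed
  show ?case
  proof (rule differentiable_upto_SucI[OF D])
    fix m
    have "differentiable_upto k (\<lambda>x::real^'n. (s * axis m 1 $ i) * (c * flat_exp c (j + 2) (s * x $ i + t)
             + (- real j) * flat_exp c (j + 1) (s * x $ i + t)))"
      by (intro differentiable_upto_mult differentiable_upto_add differentiable_upto_const Suc)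
    then show "differentiable_upto k (\<lambda>x::real^'n. (s * axis m 1 $ i) * ?D x)"
      by simp
  qed
qed simp

text \<open>For \<open>c \<rightarrow> 0\<close> these functions increase to the indicator of the open box with corners \<open>a\<close> and \<open>b\<close>.\<close>

definition bump :: "real \<Rightarrow> real^'n \<Rightarrow> real^'n \<Rightarrow> real^'n \<Rightarrow> real" where
  "bump c a b x = (\<Prod>i\<in>UNIV. flat_exp c 0 (x $ i - a $ i) * flat_exp c 0 (b $ i - x $ i))"

lemma flat_exp_range: "c > 0 \<Longrightarrow> flat_exp c 0 s \<in> {0..1}"
  by (simp add: flat_exp_def)

lemma bump_nonneg: "c > 0 \<Longrightarrow> bump c a b x \<ge> 0"
  unfolding bump_def using flat_exp_range[of c] by (intro prod_nonneg) simp

lemma bump_le_1: "c > 0 \<Longrightarrow> bump c a b x \<le> 1"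
  unfolding bump_def using flat_exp_range[of c]
  by (intro prod_le_1) (auto intro!: mult_le_one)

lemma bump_eq_0:
  assumes "x \<notin> box a b"
  shows "bump c a b x = 0"
proof -
  obtain i where "x $ i \<le> a $ i \<or> b $ i \<le> x $ i"
    using assms by (auto simp: mem_box_cart not_less)
  then have "flat_exp c 0 (x $ i - a $ i) * flat_exp c 0 (b $ i - x $ i) = 0"
    by (auto simp: flat_exp_def)
  then show ?thesis unfolding bump_def by (intro prod_zero) auto
qed

lemma bump_translate: "bump c (a + v) (b + v) x = bump c a b (x - v)"
  by (simp add: bump_def algebra_simps)

lemma test_function_bump:
  assumes "c > 0"
  shows "test_function (bump c a (b::real^'n))"
proof -
  have "differentiable_upto k (bump c a b)" for k
  proof -
    have "differentiable_upto k (\<lambda>x::real^'n. \<Prod>i\<in>UNIV.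
        flat_exp c 0 (1 * x $ i + (- a $ i)) * flat_exp c 0 ((- 1) * x $ i + b $ i))"
      by (intro differentiable_upto_prod differentiable_upto_mult differentiable_upto_flat_exp assms) auto
    then show ?thesis unfolding bump_def by simp
  qed
  moreover have "closure {x. bump c a b x \<noteq> 0} \<subseteq> cbox a b"
    using bump_eq_0[of _ a b c] box_subset_cbox[of a b]
    by (intro closure_minimal closed_cbox) blast
  then have "compact (closure {x. bump c a b x \<noteq> 0})"
    using compact_Int_closed[OF compact_cbox closed_closure, of a b "{x. bump c a b x \<noteq> 0}"] by (simp add: Int_absorb1)
  ultimately show ?thesis by (simp add: test_function_def)
qed

lemma bump_tendsto_indicator:
  "(\<lambda>k. bump (1 / real (Suc k)) a b x) \<longlonglongrightarrow> indicator (box a b) (x::real^'n)"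
proof (cases "x \<in> box a b")
  case True
  have flat: "(\<lambda>k. flat_exp (1 / real (Suc k)) 0 s) \<longlonglongrightarrow> 1" if "s > 0" for s
  proof -
    have "(\<lambda>k. - (1 / real (Suc k)) / s) \<longlonglongrightarrow> 0"
      using tendsto_mult_left_zero[OF LIMSEQ_inverse_real_of_nat, of "- inverse s"] by (simp add: divide_inverse)
    then have "(\<lambda>k. exp (- (1 / real (Suc k)) / s)) \<longlonglongrightarrow> exp 0" by (rule tendsto_exp)
    then show ?thesis using that by (simp add: flat_exp_def)
  qed
  have "(\<lambda>k. bump (1 / real (Suc k)) a b x) \<longlonglongrightarrow> (\<Prod>i\<in>(UNIV::'n set). 1 * 1)"
    unfolding bump_def using True by (intro tendsto_prod tendsto_mult flat) (auto simp: mem_box_cart)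
  then show ?thesis using True by simp
qed (simp add: bump_eq_0)

section \<open>Differentiation under the integral sign\<close>

text \<open>Dominated convergence for the difference quotients, which the mean value inequality bounds by
  \<open>w\<close>. Besides Lebesgue measure, the measure will be the counting measure on the lattice, for which this is
  termwise differentiation of a series.\<close>

lemma has_real_derivative_integral:
  fixes f f' :: "real \<Rightarrow> 'a \<Rightarrow> real"
  assumes r: "r > 0"
    and int: "\<And>t. \<bar>t\<bar> < r \<Longrightarrow> integrable M (f t)"
    and der: "\<And>t x. \<bar>t\<bar> < r \<Longrightarrow> x \<in> space M \<Longrightarrow> ((\<lambda>s. f s x) has_real_derivative f' t x) (at t)"
    and bd: "\<And>t x. \<bar>t\<bar> < r \<Longrightarrow> x \<in> space M \<Longrightarrow> \<bar>f' t x\<bar> \<le> w x"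
    and w: "integrable M w"
  shows "((\<lambda>t. \<integral>x. f t x \<partial>M) has_real_derivative (\<integral>x. f' 0 x \<partial>M)) (at 0)"
proof -
  have main: "(\<lambda>n. ((\<integral>x. f (h n) x \<partial>M) - (\<integral>x. f 0 x \<partial>M)) / h n) \<longlonglongrightarrow> (\<integral>x. f' 0 x \<partial>M)"
    if h: "h \<longlonglongrightarrow> 0" "\<And>n. h n \<noteq> 0" "\<And>n. \<bar>h n\<bar> < r" for h :: "nat \<Rightarrow> real"
  proof -
    let ?q = "\<lambda>n x. (f (h n) x - f 0 x) / h n"
    have q_int: "integrable M (?q n)" for n using int[OF h(3)[of n]] int[of 0] r by auto
    have q_lim: "(\<lambda>n. ?q n x) \<longlonglongrightarrow> f' 0 x" if "x \<in> space M" for x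
    proof -
      have "((\<lambda>y. (f y x - f 0 x) / y) \<longlongrightarrow> f' 0 x) (at 0)"
        using der[of 0 x] that r by (simp add: has_field_derivative_iff)
      then show ?thesis using h(1,2)
        by (auto simp: tendsto_at_iff_sequentially comp_def)
    qed
    have q_bd: "norm (?q n x) \<le> w x" if "x \<in> space M" for n x
    proof -
      have small: "\<bar>t\<bar> < r" if "t \<in> {- \<bar>h n\<bar>..\<bar>h n\<bar>}" for t
        using that h(3)[of n] by auto
      have "norm (f (h n) x - f 0 x) \<le> w x * norm (h n - 0)"
      proof (rule field_differentiable_bound[where S = "{- \<bar>h n\<bar>..\<bar>h n\<bar>}" and f' = "\<lambda>t. f' t x"])
        fix t assume t: "t \<in> {- \<bar>h n\<bar>..\<bar>h n\<bar>}"
        show "((\<lambda>s. f s x) has_real_derivative f' t x) (at t within {- \<bar>h n\<bar>..\<bar>h n\<bar>})"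
          using der[OF small[OF t] that] by (rule has_field_derivative_at_within)
        show "norm (f' t x) \<le> w x" using bd[OF small[OF t] that] by simp
      qed auto
      then show ?thesis using h(2)[of n] by (simp add: divide_le_eq abs_mult)
    qed
    have meas: "f' 0 \<in> borel_measurable M"
      by (rule borel_measurable_LIMSEQ_real[OF q_lim]) (use q_int in auto)
    have "(\<lambda>n. \<integral>x. ?q n x \<partial>M) \<longlonglongrightarrow> (\<integral>x. f' 0 x \<partial>M)"
      by (rule integral_dominated_convergence[OF meas _ w]) (use q_int q_lim q_bd in \<open>auto intro!: AE_I2\<close>)
    moreover have "(\<integral>x. ?q n x \<partial>M) = ((\<integral>x. f (h n) x \<partial>M) - (\<integral>x. f 0 x \<partial>M)) / h n" for n
      using int[OF h(3)[of n]] int[of 0] r by simp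
    ultimately show ?thesis by (simp only:)
  qed
  have "((\<lambda>y. ((\<integral>x. f y x \<partial>M) - (\<integral>x. f 0 x \<partial>M)) / y) \<longlongrightarrow> (\<integral>x. f' 0 x \<partial>M)) (at 0)"
    unfolding tendsto_at_iff_sequentially comp_def
  proof (intro allI impI)
    fix X :: "nat \<Rightarrow> real" assume X: "\<forall>i. X i \<in> UNIV - {0}" "X \<longlonglongrightarrow> 0"
    define h where "h = (\<lambda>n. if \<bar>X n\<bar> < r then X n else r / 2)"
    have ev: "eventually (\<lambda>n. h n = X n) sequentially"
      using tendstoD[OF X(2) r] by eventually_elim (simp add: h_def)
    have "h \<longlonglongrightarrow> 0" using X(2) by (rule Lim_transform_eventually) (use ev in \<open>eventually_elim, simp\<close>)
    then have "(\<lambda>n. ((\<integral>x. f (h n) x \<partial>M) - (\<integral>x. f 0 x \<partial>M)) / h n) \<longlonglongrightarrow> (\<integral>x. f' 0 x \<partial>M)"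
      by (rule main) (use X(1) r in \<open>auto simp: h_def\<close>)
    then show "(\<lambda>n. ((\<integral>x. f (X n) x \<partial>M) - (\<integral>x. f 0 x \<partial>M)) / X n) \<longlonglongrightarrow> (\<integral>x. f' 0 x \<partial>M)"
      by (rule Lim_transform_eventually) (use ev in \<open>eventually_elim, simp\<close>)
  qed
  then show ?thesis by (simp add: has_field_derivative_iff)
qed

section \<open>Weak derivatives\<close>

lemma integrable_lebesgue_mult:
  fixes g \<phi> :: "real^'n \<Rightarrow> real"
  assumes g: "locally_integrable g" and \<phi>: "continuous_on UNIV \<phi>"
    and B: "\<And>x. \<bar>\<phi> x\<bar> \<le> B" and R: "\<And>x. norm x > R \<Longrightarrow> \<phi> x = 0"
  shows "integrable lebesgue (\<lambda>x. g x * \<phi> x)"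
    and "\<bar>g x * \<phi> x\<bar> \<le> B * \<bar>indicator (cball 0 R) x * g x\<bar>"
    and "integrable lebesgue (\<lambda>x. B * \<bar>indicator (cball 0 R) x * g x\<bar>)"
proof -
  have I: "integrable lebesgue (\<lambda>x. indicator (cball 0 R) x * g x)"
    using g by (auto simp: locally_integrable_def set_integrable_def)
  show bd: "\<bar>g x * \<phi> x\<bar> \<le> B * \<bar>indicator (cball 0 R) x * g x\<bar>" for x
    using mult_right_mono[OF B[of x], of "\<bar>g x\<bar>"] R[of x]
    by (auto simp: abs_mult indicator_def mult.commute not_le)
  show I2: "integrable lebesgue (\<lambda>x. B * \<bar>indicator (cball 0 R) x * g x\<bar>)"
    using I by (intro integrable_mult_right integrable_abs)
  have "\<phi> \<in> borel_measurable lebesgue"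
    using borel_measurable_continuous_onI[OF \<phi>] by (simp add: measurable_completion)
  then have "(\<lambda>x. (indicator (cball 0 R) x * g x) * \<phi> x) \<in> borel_measurable lebesgue"
    using borel_measurable_integrable[OF I] by simp
  moreover have "(indicator (cball 0 R) x * g x) * \<phi> x = g x * \<phi> x" for x
    using R[of x] by (auto simp: indicator_def)
  ultimately have "(\<lambda>x. g x * \<phi> x) \<in> borel_measurable lebesgue" by simp
  then show "integrable lebesgue (\<lambda>x. g x * \<phi> x)"
    by (rule Bochner_Integration.integrable_bound[OF I2]) (use bd in \<open>auto intro!: AE_I2 order_trans[OF bd abs_ge_self]\<close>)
qed

lemma integrable_mult_test:
  assumes "locally_integrable g" "test_function \<phi>"
  shows "integrable lebesgue (\<lambda>x. g x * \<phi> x)"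
proof -
  obtain B R where "B > 0" "R > 0" "\<And>x. \<bar>\<phi> x\<bar> \<le> B" "\<And>x. norm x > R \<Longrightarrow> \<phi> x = 0"
    using test_function_bound[OF assms(2)] by blast
  then show ?thesis
    using integrable_lebesgue_mult(1)[OF assms(1) smooth_continuous[OF test_function_smooth[OF assms(2)]]]
    by blast
qed

lemma locally_integrable_continuous:
  assumes "continuous_on UNIV (f :: real^'n \<Rightarrow> real)"
  shows "locally_integrable f"
  unfolding locally_integrable_def set_integrable_def
proof (intro allI impI)
  fix S :: "(real^'n) set" assume "compact S"
  then have "integrable lborel (\<lambda>x. indicator S x *\<^sub>R f x)"
    using assms continuous_on_subset by (intro borel_integrable_compact) auto
  then show "integrable lebesgue (\<lambda>x. indicator S x *\<^sub>R f x)"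
    by (simp add: integrable_completion)
qed

lemma locally_integrable_integrable_on:
  assumes "locally_integrable (g :: real^'n \<Rightarrow> real)"
  shows "g integrable_on cbox a b" "integrable lebesgue (\<lambda>x. g x * indicator (box a b) x)"
    "(\<integral>x. g x * indicator (box a b) x \<partial>lebesgue) = integral (cbox a b) g"
proof -
  have "set_integrable lebesgue (cbox a b) g" using assms by (auto simp: locally_integrable_def)
  then have b: "set_integrable lebesgue (box a b) g"
    by (rule set_integrable_subset) (auto simp: box_subset_cbox)
  show "g integrable_on cbox a b" using \<open>set_integrable lebesgue (cbox a b) g\<close> by (rule set_lebesgue_integral_eq_integral)
  show "integrable lebesgue (\<lambda>x. g x * indicator (box a b) x)"
    using b by (simp add: set_integrable_def mult.commute)
  show "(\<integral>x. g x * indicator (box a b) x \<partial>lebesgue) = integral (cbox a b) g"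
    using set_lebesgue_integral_eq_integral(2)[OF b]
    by (simp add: set_lebesgue_integral_def mult.commute integral_open_interval)
qed

text \<open>The passage from test functions to integrals over boxes.\<close>

lemma bump_integral_tendsto:
  fixes g :: "real^'n \<Rightarrow> real"
  assumes g: "locally_integrable g"
  shows "(\<lambda>k. \<integral>x. g x * bump (1 / real (Suc k)) a b x \<partial>lebesgue) \<longlonglongrightarrow> integral (cbox a b) g"
proof -
  have c: "1 / real (Suc k) > 0" for k by simp
  have "(\<lambda>k. \<integral>x. g x * bump (1 / real (Suc k)) a b x \<partial>lebesgue) \<longlonglongrightarrow>
         (\<integral>x. g x * indicator (box a b) x \<partial>lebesgue)"
  proof (rule integral_dominated_convergence)
    show "integrable lebesgue (\<lambda>x. \<bar>g x * indicator (box a b) x\<bar>)"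
      using locally_integrable_integrable_on(2)[OF g] by (rule integrable_abs)
    show "AE x in lebesgue. (\<lambda>k. g x * bump (1 / real (Suc k)) a b x) \<longlonglongrightarrow> g x * indicator (box a b) x"
      using bump_tendsto_indicator by (intro AE_I2 tendsto_mult_left)
    show "AE x in lebesgue. norm (g x * bump (1 / real (Suc k)) a b x) \<le> \<bar>g x * indicator (box a b) x\<bar>" for k
      using bump_nonneg[OF c, of k a b] bump_le_1[OF c, of k a b] bump_eq_0[of _ a b "1 / real (Suc k)"]
      by (intro AE_I2) (auto simp: abs_mult indicator_def intro!: mult_left_le)
    show "(\<lambda>x. g x * indicator (box a b) x) \<in> borel_measurable lebesgue"
      using locally_integrable_integrable_on(2)[OF g] by (rule borel_measurable_integrable)
    show "(\<lambda>x. g x * bump (1 / real (Suc k)) a b x) \<in> borel_measurable lebesgue" for k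
      using integrable_mult_test[OF g test_function_bump[OF c]] by (rule borel_measurable_integrable)
  qed
  then show ?thesis by (simp add: locally_integrable_integrable_on(3)[OF g])
qed

lemma locally_integrable_diff:
  "locally_integrable f \<Longrightarrow> locally_integrable g \<Longrightarrow> locally_integrable (\<lambda>x. f x - g x)"
  unfolding locally_integrable_def by (auto intro: set_integral_diff)

text \<open>The integrals of \<open>g\<close> over all boxes vanish, and at almost every point \<open>g\<close> is the limit of its
  averages over shrinking boxes.\<close>

lemma fundamental_lemma_variations:
  fixes g :: "real^'n \<Rightarrow> real"
  assumes g: "locally_integrable g"
    and 0: "\<And>\<phi>. test_function \<phi> \<Longrightarrow> (\<integral>x. g x * \<phi> x \<partial>lebesgue) = 0"
  shows "AE x in lebesgue. g x = 0"
proof -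
  have box0: "integral (cbox a b) g = 0" for a b
    using bump_integral_tendsto[OF g, of a b] 0[OF test_function_bump, of _ a b]
    by (simp add: LIMSEQ_const_iff)
  obtain N where N: "negligible N" "\<And>x e. \<lbrakk>x \<notin> N; 0 < e\<rbrakk> \<Longrightarrow>
      \<exists>d>0. \<forall>h. 0 < h \<and> h < d \<longrightarrow>
         norm (integral (cbox x (x + h *\<^sub>R One)) g /\<^sub>R h ^ DIM(real^'n) - g x) < e"
    using integrable_ccontinuous_explicit[OF locally_integrable_integrable_on(1)[OF g]] by blast
  have "g x = 0" if xN: "x \<notin> N" for x
  proof (rule ccontr)
    assume "g x \<noteq> 0"
    then obtain d where "d > 0" "\<forall>h. 0 < h \<and> h < d \<longrightarrow>
         norm (integral (cbox x (x + h *\<^sub>R One)) g /\<^sub>R h ^ DIM(real^'n) - g x) < norm (g x)"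
      using N(2)[OF xN, of "norm (g x)"] by (metis zero_less_norm_iff)
    from this(2)[rule_format, of "d / 2"] \<open>d > 0\<close> show False by (simp add: box0)
  qed
  then show ?thesis using N(1) by (intro AE_I'[of N]) (auto simp: negligible_iff_null_sets)
qed

definition weak_partial :: "'n \<Rightarrow> (real^'n \<Rightarrow> real) \<Rightarrow> (real^'n \<Rightarrow> real) \<Rightarrow> bool" where
  "weak_partial i g g' \<longleftrightarrow> locally_integrable g \<and> locally_integrable g' \<and>
     (\<forall>\<phi>. test_function \<phi> \<longrightarrow>
        (\<integral>x. g x * pd i \<phi> x \<partial>lebesgue) = - (\<integral>x. g' x * \<phi> x \<partial>lebesgue))"

text \<open>Test the weak derivative of order \<open>\<gamma>\<close> with a first derivative of the test function.\<close>

lemma has_weak_deriv_weak_partial: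
  assumes "has_weak_deriv \<gamma> u v" "has_weak_deriv (\<gamma> + mi_unit i) u v'"
  shows "weak_partial i v v'"
  unfolding weak_partial_def
proof (intro conjI allI impI)
  fix \<phi> :: "real^'a \<Rightarrow> real" assume \<phi>: "test_function \<phi>"
  have "(-1) ^ mi_abs \<gamma> * (\<integral>x. v x * pd i \<phi> x \<partial>lebesgue) = (\<integral>x. u x * multi_deriv \<gamma> (pd i \<phi>) x \<partial>lebesgue)"
    using assms(1) test_function_pd[OF \<phi>] by (simp add: has_weak_deriv_def)
  also have "\<dots> = (-1) ^ mi_abs (\<gamma> + mi_unit i) * (\<integral>x. v' x * \<phi> x \<partial>lebesgue)"
    using assms(2) \<phi> by (simp add: has_weak_deriv_def flip: multi_deriv_pd[OF test_function_smooth[OF \<phi>]])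
  finally have "(-1) ^ mi_abs \<gamma> * ((\<integral>x. v x * pd i \<phi> x \<partial>lebesgue) + (\<integral>x. v' x * \<phi> x \<partial>lebesgue)) = 0"
    by (simp add: mi_abs_add mi_abs_unit distrib_left)
  then show "(\<integral>x. v x * pd i \<phi> x \<partial>lebesgue) = - (\<integral>x. v' x * \<phi> x \<partial>lebesgue)"
    by simp
qed (use assms in \<open>auto simp: has_weak_deriv_def\<close>)

text \<open>Moving the box differentiates the bump; the weak derivative then moves the differentiation to
  \<open>g\<close>.\<close>

lemma bump_integral_derivative:
  fixes g g' :: "real^'n \<Rightarrow> real"
  assumes "weak_partial i g g'" and c: "c > 0"
  shows "has_partial i (\<lambda>x. \<integral>y. g y * bump c (a + x) (b + x) y \<partial>lebesgue)
           (\<lambda>x. \<integral>y. g' y * bump c (a + x) (b + x) y \<partial>lebesgue)"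
  unfolding has_partial_def
proof
  fix x
  let ?e = "axis i 1 :: real^'n"
  let ?\<phi> = "bump c (a + x) (b + x)"
  have g: "locally_integrable g" using assms by (simp add: weak_partial_def)
  have \<phi>: "test_function ?\<phi>" by (rule test_function_bump[OF c])
  note part = smooth_has_partial[OF test_function_smooth[OF \<phi>], of i]
  have shift: "bump c (a + (x + t *\<^sub>R ?e)) (b + (x + t *\<^sub>R ?e)) y = ?\<phi> (y - t *\<^sub>R ?e)" for t y
    using bump_translate[of c "a + x" "t *\<^sub>R ?e" "b + x" y] by (simp add: add.assoc)
  obtain B R where B: "\<And>x. \<bar>pd i ?\<phi> x\<bar> \<le> B" "\<And>x. norm x > R \<Longrightarrow> pd i ?\<phi> x = 0" "B > 0"
    using test_function_bound[OF test_function_pd[OF \<phi>], of i] by metis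
  have "((\<lambda>t. \<integral>y. g y * ?\<phi> (y - t *\<^sub>R ?e) \<partial>lebesgue) has_real_derivative
          (\<integral>y. g y * (- pd i ?\<phi> (y - 0 *\<^sub>R ?e)) \<partial>lebesgue)) (at 0)"
  proof (rule has_real_derivative_integral[where r = 1 and w = "\<lambda>y. B * \<bar>indicator (cball 0 (R + 1)) y * g y\<bar>"])
    show "integrable lebesgue (\<lambda>y. g y * ?\<phi> (y - t *\<^sub>R ?e))" for t
      unfolding shift[symmetric] by (intro integrable_mult_test g test_function_bump c)
    show "((\<lambda>s. g y * ?\<phi> (y - s *\<^sub>R ?e)) has_real_derivative g y * (- pd i ?\<phi> (y - t *\<^sub>R ?e))) (at t)" for t y
    proof -
      have "((\<lambda>s. ?\<phi> (y + (- s) *\<^sub>R ?e)) has_real_derivative pd i ?\<phi> (y + (- t) *\<^sub>R ?e) * (- 1)) (at t)"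
        by (rule DERIV_chain2[OF has_partialD[OF part]]) (auto intro!: derivative_eq_intros)
      from DERIV_cmult[OF this, of "g y"] show ?thesis by simp
    qed
    have I: "integrable lebesgue (\<lambda>y. indicator (cball 0 (R + 1)) y * g y)"
      using g by (auto simp: locally_integrable_def set_integrable_def)
    then show "integrable lebesgue (\<lambda>y. B * \<bar>indicator (cball 0 (R + 1)) y * g y\<bar>)"
      by (intro integrable_mult_right integrable_abs)
    show "\<bar>g y * (- pd i ?\<phi> (y - t *\<^sub>R ?e))\<bar> \<le> B * \<bar>indicator (cball 0 (R + 1)) y * g y\<bar>" if "\<bar>t\<bar> < 1" for t y
    proof (cases "norm y \<le> R + 1")
      case True
      then show ?thesis using mult_left_mono[OF B(1)[of "y - t *\<^sub>R ?e"], of "\<bar>g y\<bar>"]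
        by (simp add: abs_mult mult.commute)
    next
      case False
      have "norm y - norm (t *\<^sub>R ?e) \<le> norm (y - t *\<^sub>R ?e)" by (rule norm_triangle_ineq2)
      then have "norm (y - t *\<^sub>R ?e) > R" using False that by simp
      then show ?thesis using B by simp
    qed
  qed simp
  moreover have "(\<integral>y. g y * (- pd i ?\<phi> (y - 0 *\<^sub>R ?e)) \<partial>lebesgue) = (\<integral>y. g' y * ?\<phi> y \<partial>lebesgue)"
    using assms(1) \<phi> by (simp add: weak_partial_def)
  ultimately show "((\<lambda>t. \<integral>y. g y * bump c (a + (x + t *\<^sub>R ?e)) (b + (x + t *\<^sub>R ?e)) y \<partial>lebesgue)
      has_real_derivative (\<integral>y. g' y * ?\<phi> y \<partial>lebesgue)) (at 0)"
    by (simp add: shift)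
qed

lemma bump_integral_translate:
  assumes "c > 0"
  shows "(\<integral>y. bump c (a + v) (b + v) y \<partial>lebesgue) = (\<integral>y. bump c a b y \<partial>lebesgue)"
proof -
  have meas: "bump c a b \<in> borel_measurable borel" for a b :: "real^'n"
    using smooth_continuous[OF test_function_smooth[OF test_function_bump[OF assms]]]
    by (rule borel_measurable_continuous_onI)
  have m: "bump c (a + v) (b + v) \<in> borel_measurable lborel" "bump c a b \<in> borel_measurable lborel"
    using meas by simp_all
  have "(\<integral>y. bump c (a + v) (b + v) y \<partial>lborel) = (\<integral>y. bump c (a + v) (b + v) y \<partial>(distr lborel borel ((+) v)))"
    by (simp add: lborel_distr_plus)
  also have "\<dots> = (\<integral>y. bump c (a + v) (b + v) (v + y) \<partial>lborel)"
    using meas by (intro integral_distr) auto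
  also have "\<dots> = (\<integral>y. bump c a b y \<partial>lborel)" by (simp add: bump_translate)
  finally show ?thesis using integral_completion[OF m(1)] integral_completion[OF m(2)] by simp
qed

lemma locally_integrable_const: "locally_integrable (\<lambda>_. k)"
  by (rule locally_integrable_continuous) simp

text \<open>Smoothed by bumps, the weak derivative becomes a classical one to which the mean value theorem
  applies, and \<open>c \<rightarrow> 0\<close> turns the bump into the box. With \<open>k = 0\<close> this bounds increments of averages by
  the supremum of \<open>g'\<close>; with \<open>k\<close> the value of a continuous \<open>g'\<close> at a point it yields differentiability there.\<close>

lemma box_integral_increment:
  fixes g g' :: "real^'n \<Rightarrow> real"
  assumes wp: "weak_partial i g g'"
    and AE: "AE y in lebesgue. y \<in> U \<longrightarrow> \<bar>g' y - k\<bar> \<le> \<epsilon>"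
    and U: "\<And>s. \<bar>s\<bar> \<le> \<bar>T\<bar> \<Longrightarrow> box (a + s *\<^sub>R axis i 1) (b + s *\<^sub>R axis i 1) \<subseteq> U"
  shows "\<bar>integral (cbox (a + T *\<^sub>R axis i 1) (b + T *\<^sub>R axis i 1)) g - integral (cbox a b) g
            - T * k * measure lborel (cbox a b)\<bar> \<le> \<bar>T\<bar> * \<epsilon> * measure lborel (cbox a b)"
proof -
  let ?e = "axis i 1 :: real^'n"
  define F where "F = (\<lambda>n x. \<integral>y. g y * bump (1 / real (Suc n)) (a + x) (b + x) y \<partial>lebesgue)"
  define Z where "Z = (\<lambda>n. \<integral>y. bump (1 / real (Suc n)) a b y \<partial>lebesgue)"
  have c: "1 / real (Suc n) > 0" for n by simp
  have lg: "locally_integrable g" and lg': "locally_integrable g'"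
    using wp by (auto simp: weak_partial_def)
  have step: "\<bar>F n (T *\<^sub>R ?e) - F n 0 - T * k * Z n\<bar> \<le> \<bar>T\<bar> * \<epsilon> * Z n" for n
  proof -
    obtain \<theta> where \<theta>: "\<theta> \<in> {0..1}" "F n (0 + T *\<^sub>R ?e) - F n 0 = T *
        (\<integral>y. g' y * bump (1 / real (Suc n)) (a + (0 + (\<theta> * T) *\<^sub>R ?e)) (b + (0 + (\<theta> * T) *\<^sub>R ?e)) y \<partial>lebesgue)"
      using has_partial_mvt[OF bump_integral_derivative[OF wp c[of n], of a b], of 0 T] unfolding F_def by blast
    define s where "s = \<theta> * T"
    have s: "\<bar>s\<bar> \<le> \<bar>T\<bar>" using \<theta>(1) by (simp add: s_def abs_mult mult_left_le_one_le)
    let ?\<psi> = "bump (1 / real (Suc n)) (a + s *\<^sub>R ?e) (b + s *\<^sub>R ?e)"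
    have \<psi>: "test_function ?\<psi>" by (rule test_function_bump[OF c])
    have Zs: "(\<integral>y. ?\<psi> y \<partial>lebesgue) = Z n"
      unfolding Z_def by (rule bump_integral_translate[OF c])
    have i1: "integrable lebesgue (\<lambda>y. g' y * ?\<psi> y)" by (rule integrable_mult_test[OF lg' \<psi>])
    have i2: "integrable lebesgue ?\<psi>"
      using integrable_mult_test[OF locally_integrable_const[of 1] \<psi>] by simp
    have "\<bar>(\<integral>y. g' y * ?\<psi> y \<partial>lebesgue) - k * Z n\<bar> = \<bar>\<integral>y. g' y * ?\<psi> y - k * ?\<psi> y \<partial>lebesgue\<bar>"
      using i1 i2 by (simp add: Zs[symmetric])
    also have "\<dots> \<le> (\<integral>y. \<bar>g' y * ?\<psi> y - k * ?\<psi> y\<bar> \<partial>lebesgue)"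
      by (rule integral_abs_bound)
    also have "\<dots> \<le> (\<integral>y. \<epsilon> * ?\<psi> y \<partial>lebesgue)"
    proof (rule integral_mono_AE)
      have "AE y in lebesgue. \<bar>g' y * ?\<psi> y - k * ?\<psi> y\<bar> \<le> \<epsilon> * ?\<psi> y"
        using AE
      proof eventually_elim
        case (elim y)
        show ?case
        proof (cases "y \<in> box (a + s *\<^sub>R ?e) (b + s *\<^sub>R ?e)")
          case True
          then have "\<bar>g' y - k\<bar> \<le> \<epsilon>" using elim U[OF s] by blast
          from mult_right_mono[OF this bump_nonneg[OF c[of n], of "a + s *\<^sub>R ?e" "b + s *\<^sub>R ?e" y]]
          show ?thesis
            using bump_nonneg[OF c[of n], of "a + s *\<^sub>R ?e" "b + s *\<^sub>R ?e" y]
            by (simp add: abs_mult flip: left_diff_distrib)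
        qed (simp add: bump_eq_0)
      qed
      then show "AE y in lebesgue. \<bar>g' y * ?\<psi> y - k * ?\<psi> y\<bar> \<le> \<epsilon> * ?\<psi> y" .
    qed (use i1 i2 in auto)
    also have "\<dots> = \<epsilon> * Z n" unfolding Zs[symmetric] by simp
    finally have "\<bar>(\<integral>y. g' y * ?\<psi> y \<partial>lebesgue) - k * Z n\<bar> \<le> \<epsilon> * Z n" .
    then have "\<bar>T\<bar> * \<bar>(\<integral>y. g' y * ?\<psi> y \<partial>lebesgue) - k * Z n\<bar> \<le> \<bar>T\<bar> * (\<epsilon> * Z n)"
      by (rule mult_left_mono) simp
    moreover have "F n (T *\<^sub>R ?e) - F n 0 - T * k * Z n = T * ((\<integral>y. g' y * ?\<psi> y \<partial>lebesgue) - k * Z n)"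
      using \<theta>(2) by (simp add: s_def right_diff_distrib)
    ultimately show ?thesis by (simp add: abs_mult mult.assoc)
  qed
  have "(\<lambda>n. F n (T *\<^sub>R ?e)) \<longlonglongrightarrow> integral (cbox (a + T *\<^sub>R ?e) (b + T *\<^sub>R ?e)) g"
    "(\<lambda>n. F n 0) \<longlonglongrightarrow> integral (cbox a b) g"
    using bump_integral_tendsto[OF lg] by (simp_all add: F_def)
  moreover have Z: "Z \<longlonglongrightarrow> measure lborel (cbox a b)"
    using bump_integral_tendsto[OF locally_integrable_const[of 1], of a b] by (simp add: Z_def)
  ultimately have L: "(\<lambda>n. \<bar>F n (T *\<^sub>R ?e) - F n 0 - T * k * Z n\<bar>) \<longlonglongrightarrow>
      \<bar>integral (cbox (a + T *\<^sub>R ?e) (b + T *\<^sub>R ?e)) g - integral (cbox a b) g - T * k * measure lborel (cbox a b)\<bar>"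
    by (intro tendsto_intros)
  have "(\<lambda>n. \<bar>T\<bar> * \<epsilon> * Z n) \<longlonglongrightarrow> \<bar>T\<bar> * \<epsilon> * measure lborel (cbox a b)"
    using Z by (rule tendsto_mult_left)
  then show ?thesis using L step by (intro LIMSEQ_le[where X = "\<lambda>n. \<bar>F n (T *\<^sub>R ?e) - F n 0 - T * k * Z n\<bar>"]) auto
qed

lemma sum_Basis_nth [simp]: "(\<Sum>b\<in>(Basis :: (real^'n) set). b $ i) = 1"
  by (simp add: cart_eq_inner_axis inner_sum_left inner_Basis axis_in_Basis_iff)

lemma content_cube:
  fixes x :: "real^'n"
  assumes "h \<ge> 0"
  shows "measure lborel (cbox x (x + h *\<^sub>R One)) = h ^ CARD('n)"
proof -
  have "x \<in> cbox x (x + h *\<^sub>R One)" using assms by (simp add: mem_box_cart)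
  then show ?thesis by (subst content_cbox_cart) auto
qed

lemma closure_Compl_negligible:
  assumes "negligible (N :: (real^'n) set)"
  shows "closure (- N) = UNIV"
proof -
  have "negligible (interior N)" using assms interior_subset by (rule negligible_subset)
  then have "interior N = {}" using open_not_negligible open_interior by blast
  then show ?thesis by (simp add: closure_interior)
qed

text \<open>The averages of \<open>g\<close> over cubes satisfy a Lipschitz condition that is independent of the side
  length. At almost every point they converge to \<open>g\<close>, which therefore satisfies the same condition off a null set;
  the complement of a null set is dense, so \<open>g\<close> extends from there.\<close>

lemma lipschitz_representative:
  fixes g :: "real^'n \<Rightarrow> real"
  assumes wp: "\<And>i. weak_partial i g (g' i)"
    and bd: "\<And>i. AE y in lebesgue. \<bar>g' i y\<bar> \<le> M i"
  obtains w where "(\<Sum>i\<in>UNIV. M i)-lipschitz_on UNIV w" "AE x in lebesgue. w x = g x"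
proof -
  have M: "M i \<ge> 0" for i
  proof -
    have "AE y in (lebesgue :: (real^'n) measure). 0 \<le> M i" using bd[of i] by eventually_elim linarith
    then show ?thesis by (simp add: eventually_const_iff ae_filter_eq_bot_iff emeasure_lborel_UNIV)
  qed
  have lg: "locally_integrable g" using wp by (auto simp: weak_partial_def)
  define B where "B = (\<lambda>h x. integral (cbox x (x + h *\<^sub>R One)) g)"
  have one: "\<bar>B h (x + t *\<^sub>R axis i 1) - B h x\<bar> \<le> h ^ CARD('n) * (M i * \<bar>t\<bar>)" if "h > 0" for h x t i
    using box_integral_increment[OF wp[of i], of UNIV 0 "M i" t x "x + h *\<^sub>R One"] bd[of i] that
    by (simp add: B_def content_cube algebra_simps)
  have B_lip: "\<bar>B h y - B h x\<bar> \<le> h ^ CARD('n) * (\<Sum>i\<in>UNIV. M i) * norm (y - x)" if "h > 0" for h x y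
  proof -
    have "\<bar>B h y - B h x\<bar> \<le> (\<Sum>i\<in>UNIV. h ^ CARD('n) * (M i * norm (y - x)))"
    proof (rule coordinate_path_bound)
      fix S :: "'n set" and i assume i: "i \<notin> S"
      let ?z = "\<chi> j. if j \<in> S then y $ j else x $ j"
      have "(\<chi> j. if j \<in> insert i S then y $ j else x $ j) = ?z + (y $ i - x $ i) *\<^sub>R axis i 1"
        using i by (auto simp: vec_eq_iff axis_def)
      then have "\<bar>B h (\<chi> j. if j \<in> insert i S then y $ j else x $ j) - B h ?z\<bar>
                 \<le> h ^ CARD('n) * (M i * \<bar>y $ i - x $ i\<bar>)" using one[OF that] by simp
      also have "\<dots> \<le> h ^ CARD('n) * (M i * norm (y - x))"
        using component_le_norm_cart[of "y - x" i] M[of i] that by (intro mult_left_mono) auto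
      finally show "\<bar>B h (\<chi> j. if j \<in> insert i S then y $ j else x $ j) - B h ?z\<bar>
                 \<le> h ^ CARD('n) * (M i * norm (y - x))" .
    qed
    then show ?thesis by (simp add: sum_distrib_left sum_distrib_right mult.assoc)
  qed
  obtain N where N: "negligible N" "\<And>x e. \<lbrakk>x \<notin> N; 0 < e\<rbrakk> \<Longrightarrow>
      \<exists>d>0. \<forall>h. 0 < h \<and> h < d \<longrightarrow>
         norm (integral (cbox x (x + h *\<^sub>R One)) g /\<^sub>R h ^ DIM(real^'n) - g x) < e"
    using integrable_ccontinuous_explicit[OF locally_integrable_integrable_on(1)[OF lg]] by blast
  have lim: "\<exists>d>0. \<forall>h. 0 < h \<and> h < d \<longrightarrow> \<bar>B h x / h ^ CARD('n) - g x\<bar> < e" if "x \<notin> N" "e > 0" for x e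
    using N(2)[OF that] by (simp add: B_def divide_inverse mult.commute)
  have "(\<Sum>i\<in>UNIV. M i)-lipschitz_on (- N) g"
  proof (rule lipschitz_onI)
    fix x y assume xy: "x \<in> - N" "y \<in> - N"
    show "dist (g x) (g y) \<le> (\<Sum>i\<in>UNIV. M i) * dist x y"
    proof (rule field_le_epsilon)
      fix e :: real assume "e > 0"
      then obtain d1 d2 where d: "d1 > 0" "d2 > 0"
        "\<And>h. 0 < h \<Longrightarrow> h < d1 \<Longrightarrow> \<bar>B h x / h ^ CARD('n) - g x\<bar> < e / 2"
        "\<And>h. 0 < h \<Longrightarrow> h < d2 \<Longrightarrow> \<bar>B h y / h ^ CARD('n) - g y\<bar> < e / 2"
        using lim[of x "e / 2"] lim[of y "e / 2"] xy by (metis Compl_iff half_gt_zero)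
      define h where "h = min d1 d2 / 2"
      have h: "h > 0" "h < d1" "h < d2" using d by (auto simp: h_def)
      have "\<bar>B h y / h ^ CARD('n) - B h x / h ^ CARD('n)\<bar> \<le> (\<Sum>i\<in>UNIV. M i) * norm (y - x)"
        using B_lip[OF h(1), of y x] h(1) by (simp add: divide_le_eq mult.commute mult.left_commute flip: diff_divide_distrib)
      then show "dist (g x) (g y) \<le> (\<Sum>i\<in>UNIV. M i) * dist x y + e"
        using d(3)[OF h(1,2)] d(4)[OF h(1,3)]
        unfolding dist_real_def dist_norm norm_minus_commute[of x y] by linarith
    qed
  qed (simp add: sum_nonneg M)
  then obtain w where w: "(\<Sum>i\<in>UNIV. M i)-lipschitz_on (closure (- N)) w" "\<And>x. x \<in> - N \<Longrightarrow> w x = g x"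
    using lipschitz_extend_closure by blast
  have "AE x in lebesgue. w x = g x"
    using N(1) w(2) by (intro AE_I'[of N]) (auto simp: negligible_iff_null_sets)
  then show thesis using that w(1) closure_Compl_negligible[OF N(1)] by simp
qed

lemma cube_average_bound:
  fixes w :: "real^'n \<Rightarrow> real"
  assumes w: "continuous_on UNIV w" and h: "h > 0"
    and e: "\<And>y. y \<in> cbox x (x + h *\<^sub>R One) \<Longrightarrow> \<bar>w y - k\<bar> \<le> e"
  shows "\<bar>integral (cbox x (x + h *\<^sub>R One)) w / h ^ CARD('n) - k\<bar> \<le> e"
proof -
  let ?Q = "cbox x (x + h *\<^sub>R One)"
  have e0: "e \<ge> 0" using e[of x] h by (simp add: mem_box_cart)
  have "(w has_integral integral ?Q w) ?Q"
    using w by (intro integrable_integral integrable_continuous) (auto intro: continuous_on_subset)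
  then have "((\<lambda>y. w y - k) has_integral (integral ?Q w - measure lborel ?Q *\<^sub>R k)) ?Q"
    by (intro has_integral_diff has_integral_const)
  then have "norm (integral ?Q w - measure lborel ?Q *\<^sub>R k) \<le> e * measure lborel ?Q"
    by (rule has_integral_bound[OF e0]) (use e in auto)
  then have "\<bar>integral ?Q w - h ^ CARD('n) * k\<bar> \<le> e * h ^ CARD('n)"
    using h by (simp add: content_cube)
  moreover have "integral ?Q w / h ^ CARD('n) - k = (integral ?Q w - h ^ CARD('n) * k) / h ^ CARD('n)"
    using h by (simp add: field_simps)
  ultimately show ?thesis using h by (simp add: divide_le_eq)
qed

lemma cube_small:
  fixes x :: "real^'n"
  assumes "d > 0"
  obtains h0 where "h0 > 0" "\<And>h y. 0 < h \<Longrightarrow> h \<le> h0 \<Longrightarrow> y \<in> cbox x (x + h *\<^sub>R One) \<Longrightarrow> norm (y - x) < d"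
proof
  define h0 where "h0 = d / (2 * real CARD('n))"
  show "h0 > 0" using assms by (simp add: h0_def)
  fix h and y :: "real^'n" assume h: "0 < h" "h \<le> h0" "y \<in> cbox x (x + h *\<^sub>R One)"
  have "\<bar>(y - x) $ i\<bar> \<le> h0" for i
    using h by (auto simp: mem_box_cart dest!: spec[of _ i])
  then have "norm (y - x) \<le> (\<Sum>i\<in>(UNIV::'n set). h0)"
    by (intro order_trans[OF norm_le_l1_cart sum_mono]) auto
  also have "\<dots> < d" using assms by (simp add: h0_def)
  finally show "norm (y - x) < d" .
qed

text \<open>Near \<open>x\<close> the function \<open>g'\<close> is close to \<open>g' x\<close>, so the averages of \<open>w\<close> over cubes have
  nearly the increments \<open>T * g' x\<close>; for cubes shrinking to a point the averages become the values of \<open>w\<close>.\<close>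

lemma continuous_weak_partial_is_partial:
  fixes w g' :: "real^'n \<Rightarrow> real"
  assumes wp: "weak_partial i w g'" and w: "continuous_on UNIV w" and g': "continuous_on UNIV g'"
  shows "has_partial i w g'"
  unfolding has_partial_def
proof
  fix x
  let ?e = "axis i 1 :: real^'n"
  have isC: "\<exists>d>0. \<forall>y. norm (y - z) < d \<longrightarrow> \<bar>f y - f z\<bar> < e" if "continuous_on UNIV f" "e > 0" for f :: "real^'n \<Rightarrow> real" and e z
    using that by (auto simp: continuous_on_iff dist_norm)
  have est: "\<exists>d>0. \<forall>T. \<bar>T\<bar> < d \<longrightarrow> \<bar>w (x + T *\<^sub>R ?e) - w x - T * g' x\<bar> \<le> \<bar>T\<bar> * \<epsilon>" if \<epsilon>: "\<epsilon> > 0" for \<epsilon>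
  proof -
    obtain d where d: "d > 0" "\<And>y. norm (y - x) < d \<Longrightarrow> \<bar>g' y - g' x\<bar> < \<epsilon>" using isC[OF g' \<epsilon>] by blast
    have "\<bar>w (x + T *\<^sub>R ?e) - w x - T * g' x\<bar> \<le> \<bar>T\<bar> * \<epsilon>" if T: "\<bar>T\<bar> < d / 2" for T
    proof (rule field_le_epsilon)
      fix \<eta> :: real assume \<eta>: "\<eta> > 0"
      obtain d1 where d1: "d1 > 0" "\<And>y. norm (y - x) < d1 \<Longrightarrow> \<bar>w y - w x\<bar> < \<eta> / 2"
        using isC[OF w, of "\<eta> / 2"] \<eta> by (metis half_gt_zero)
      obtain d2 where d2: "d2 > 0" "\<And>y. norm (y - (x + T *\<^sub>R ?e)) < d2 \<Longrightarrow> \<bar>w y - w (x + T *\<^sub>R ?e)\<bar> < \<eta> / 2"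
        using isC[OF w, of "\<eta> / 2"] \<eta> by (metis half_gt_zero)
      obtain h1 where h1: "h1 > 0" "\<And>h y. 0 < h \<Longrightarrow> h \<le> h1 \<Longrightarrow> y \<in> cbox x (x + h *\<^sub>R One) \<Longrightarrow> norm (y - x) < min d1 (d / 2)"
        using cube_small[of "min d1 (d / 2)"] d1 d by (metis half_gt_zero min_less_iff_conj)
      obtain h2 where h2: "h2 > 0" "\<And>h y. 0 < h \<Longrightarrow> h \<le> h2 \<Longrightarrow>
          y \<in> cbox (x + T *\<^sub>R ?e) (x + T *\<^sub>R ?e + h *\<^sub>R One) \<Longrightarrow> norm (y - (x + T *\<^sub>R ?e)) < d2"
        using cube_small[OF d2(1)] by metis
      define h where "h = min h1 h2"
      have h: "h > 0" "h \<le> h1" "h \<le> h2" using h1 h2 by (auto simp: h_def)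
      let ?I = "\<lambda>z. integral (cbox z (z + h *\<^sub>R One)) w"
      have A1: "\<bar>?I x / h ^ CARD('n) - w x\<bar> \<le> \<eta> / 2"
        using h1(2)[OF h(1,2)] d1(2) by (intro cube_average_bound[OF w h(1)]) force
      have A2: "\<bar>?I (x + T *\<^sub>R ?e) / h ^ CARD('n) - w (x + T *\<^sub>R ?e)\<bar> \<le> \<eta> / 2"
        using h2(2)[OF h(1,3)] d2(2) by (intro cube_average_bound[OF w h(1)]) force
      have "\<bar>integral (cbox (x + T *\<^sub>R ?e) ((x + h *\<^sub>R One) + T *\<^sub>R ?e)) w - ?I x - T * g' x * measure lborel (cbox x (x + h *\<^sub>R One))\<bar>
          \<le> \<bar>T\<bar> * \<epsilon> * measure lborel (cbox x (x + h *\<^sub>R One))"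
      proof (rule box_integral_increment[OF wp, of "ball x d"])
        show "AE y in lebesgue. y \<in> ball x d \<longrightarrow> \<bar>g' y - g' x\<bar> \<le> \<epsilon>"
          using d(2) by (intro AE_I2) (force simp: dist_norm norm_minus_commute)
        fix s assume s: "\<bar>s\<bar> \<le> \<bar>T\<bar>"
        show "box (x + s *\<^sub>R ?e) (x + h *\<^sub>R One + s *\<^sub>R ?e) \<subseteq> ball x d"
        proof
          fix y assume "y \<in> box (x + s *\<^sub>R ?e) (x + h *\<^sub>R One + s *\<^sub>R ?e)"
          then have "y - s *\<^sub>R ?e \<in> cbox x (x + h *\<^sub>R One)"
            by (auto simp: mem_box inner_diff_left inner_add_left algebra_simps)
          then have 1: "norm (y - s *\<^sub>R ?e - x) < d / 2" using h1(2)[OF h(1,2)] by force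
          have "norm (y - x) \<le> norm (y - s *\<^sub>R ?e - x) + norm (s *\<^sub>R ?e)"
            by (rule order_trans[OF _ norm_triangle_ineq]) (simp add: algebra_simps)
          then show "y \<in> ball x d" using 1 s T by (simp add: dist_norm norm_minus_commute)
        qed
      qed
      then have "\<bar>?I (x + T *\<^sub>R ?e) - ?I x - T * g' x * h ^ CARD('n)\<bar> \<le> \<bar>T\<bar> * \<epsilon> * h ^ CARD('n)"
        using h(1) by (simp add: content_cube algebra_simps)
      moreover have "?I (x + T *\<^sub>R ?e) / h ^ CARD('n) - ?I x / h ^ CARD('n) - T * g' x
          = (?I (x + T *\<^sub>R ?e) - ?I x - T * g' x * h ^ CARD('n)) / h ^ CARD('n)"
        using h(1) by (simp add: field_simps)
      ultimately have "\<bar>?I (x + T *\<^sub>R ?e) / h ^ CARD('n) - ?I x / h ^ CARD('n) - T * g' x\<bar> \<le> \<bar>T\<bar> * \<epsilon>"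
        using h(1) by (simp add: divide_le_eq)
      then show "\<bar>w (x + T *\<^sub>R ?e) - w x - T * g' x\<bar> \<le> \<bar>T\<bar> * \<epsilon> + \<eta>"
        using A1 A2 by linarith
    qed
    then show ?thesis using d(1) by (intro exI[of _ "d / 2"]) auto
  qed
  show "((\<lambda>t. w (x + t *\<^sub>R ?e)) has_real_derivative g' x) (at 0)"
    unfolding has_field_derivative_def has_derivative_within_alt
  proof (intro conjI allI impI)
    fix \<epsilon> :: real assume "\<epsilon> > 0"
    then obtain d where "d > 0" "\<And>T. \<bar>T\<bar> < d \<Longrightarrow> \<bar>w (x + T *\<^sub>R ?e) - w x - T * g' x\<bar> \<le> \<bar>T\<bar> * \<epsilon>"
      using est by blast
    then show "\<exists>d>0. \<forall>y\<in>UNIV. norm (y - 0) < d \<longrightarrow>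
        norm (w (x + y *\<^sub>R ?e) - w (x + 0 *\<^sub>R ?e) - g' x * (y - 0)) \<le> \<epsilon> * norm (y - 0)"
      by (intro exI[of _ d]) (auto simp: mult.commute)
  qed (rule bounded_linear_mult_right)
qed

section \<open>Continuous representatives of weak derivatives\<close>

lemma in_Linf_AE_bound:
  assumes "in_Linf f"
  shows "AE x in lebesgue. \<bar>f x\<bar> \<le> Linf_norm f" and "Linf_norm f \<ge> 0"
proof -
  let ?S = "esssup lebesgue (\<lambda>x. ereal \<bar>f x\<bar>)"
  have m: "(\<lambda>x. ereal \<bar>f x\<bar>) \<in> borel_measurable lebesgue" using assms by (auto simp: in_Linf_def)
  have "esssup (lebesgue :: (real^'a) measure) (\<lambda>x. 0 :: ereal) \<le> ?S" by (rule esssup_mono) (use m in auto)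
  then have S0: "0 \<le> ?S" by (simp add: esssup_const emeasure_lborel_UNIV)
  then have S: "?S = ereal (Linf_norm f)"
    using assms by (auto simp: Linf_norm_def in_Linf_def ereal_real)
  show "AE x in lebesgue. \<bar>f x\<bar> \<le> Linf_norm f"
    using esssup_AE[of "\<lambda>x. ereal \<bar>f x\<bar>" lebesgue] unfolding S by simp
  show "Linf_norm f \<ge> 0" using S0 unfolding S by simp
qed

lemma in_Linf_cong_AE:
  assumes "in_Linf f" "g \<in> borel_measurable lebesgue" "AE x in lebesgue. g x = f x"
  shows "in_Linf g"
proof -
  have "esssup lebesgue (\<lambda>x. ereal \<bar>g x\<bar>) = esssup lebesgue (\<lambda>x. ereal \<bar>f x\<bar>)"
    using assms by (intro esssup_AE_cong) (auto simp: in_Linf_def elim: eventually_mono)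
  then show ?thesis using assms by (simp add: in_Linf_def)
qed

lemma locally_integrable_measurable:
  fixes f :: "real^'n \<Rightarrow> real"
  assumes "locally_integrable f"
  shows "f \<in> borel_measurable lebesgue"
proof (rule borel_measurable_LIMSEQ_real)
  show "(\<lambda>x. indicator (cball 0 (real k)) x * f x) \<in> borel_measurable lebesgue" for k
    using assms borel_measurable_integrable[of lebesgue "\<lambda>x. indicator (cball 0 (real k)) x * f x"]
    by (simp add: locally_integrable_def set_integrable_def)
  fix x :: "real^'n"
  show "(\<lambda>k. indicator (cball 0 (real k)) x * f x) \<longlonglongrightarrow> f x"
  proof (rule tendsto_eventually)
    obtain k0 :: nat where "norm x \<le> real k0" using real_arch_simple by blast
    then show "\<forall>\<^sub>F k in sequentially. indicator (cball 0 (real k)) x * f x = f x"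
      by (intro eventually_sequentiallyI[of k0]) auto
  qed
qed

lemma continuous_AE_eq:
  fixes f g :: "real^'n \<Rightarrow> real"
  assumes "continuous_on UNIV f" "continuous_on UNIV g" "AE x in lebesgue. f x = g x"
  shows "f = g"
proof (rule ccontr)
  assume "f \<noteq> g"
  let ?S = "{x. f x \<noteq> g x}"
  have "open ?S"
    using open_Collect_neq[OF assms(1,2)] .
  moreover have "?S \<in> null_sets lebesgue"
  proof -
    have "{x \<in> space lebesgue. \<not> (f x = g x)} \<in> null_sets lebesgue"
      using assms(3) \<open>open ?S\<close> by (intro AE_iff_null_sets[THEN iffD2]) (auto simp: borel_open)
    then show ?thesis by simp
  qed
  moreover have "?S \<noteq> {}" using \<open>f \<noteq> g\<close> by auto
  ultimately show False using open_not_negligible by (auto simp: negligible_iff_null_sets)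
qed

text \<open>Truncation at \<open>M\<close> changes \<open>f\<close> on a null set only, hence not at all.\<close>

lemma continuous_bound_AE:
  fixes f :: "real^'n \<Rightarrow> real"
  assumes "continuous_on UNIV f" "AE x in lebesgue. \<bar>f x\<bar> \<le> M"
  shows "\<bar>f x\<bar> \<le> M"
proof -
  have "(\<lambda>x. max (- M) (min (f x) M)) = f"
    by (rule continuous_AE_eq) (use assms in \<open>auto intro!: continuous_intros elim: eventually_mono\<close>)
  moreover have "M \<ge> 0"
  proof -
    have "AE x in (lebesgue :: (real^'n) measure). 0 \<le> M" using assms(2) by eventually_elim linarith
    then show ?thesis by (simp add: eventually_const_iff ae_filter_eq_bot_iff emeasure_lborel_UNIV)
  qed
  then have "\<bar>max (- M) (min (f x) M)\<bar> \<le> M" by auto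
  ultimately show ?thesis by metis
qed

lemma has_weak_deriv_AE_unique:
  assumes "has_weak_deriv \<gamma> u v" "has_weak_deriv \<gamma> u v'"
  shows "AE x in lebesgue. v x = v' x"
proof -
  have li: "locally_integrable v" "locally_integrable v'" using assms by (auto simp: has_weak_deriv_def)
  have "AE x in lebesgue. v x - v' x = 0"
  proof (rule fundamental_lemma_variations[OF locally_integrable_diff[OF li]])
    fix \<phi> :: "real^'a \<Rightarrow> real" assume \<phi>: "test_function \<phi>"
    have "(-1) ^ mi_abs \<gamma> * (\<integral>x. v x * \<phi> x \<partial>lebesgue) = (-1) ^ mi_abs \<gamma> * (\<integral>x. v' x * \<phi> x \<partial>lebesgue)"
      using assms[unfolded has_weak_deriv_def, THEN conjunct2, THEN conjunct2, rule_format, OF \<phi>]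
      by (rule trans[OF sym])
    then have "(\<integral>x. v x * \<phi> x \<partial>lebesgue) = (\<integral>x. v' x * \<phi> x \<partial>lebesgue)" by simp
    then show "(\<integral>x. (v x - v' x) * \<phi> x \<partial>lebesgue) = 0"
      using integrable_mult_test[OF li(1) \<phi>] integrable_mult_test[OF li(2) \<phi>]
      by (simp add: left_diff_distrib)
  qed
  then show ?thesis by eventually_elim simp
qed

lemma has_weak_deriv_cong_AE:
  assumes "has_weak_deriv \<gamma> u v" "locally_integrable w" "AE x in lebesgue. w x = v x"
  shows "has_weak_deriv \<gamma> u w"
proof -
  have "(\<integral>x. w x * \<phi> x \<partial>lebesgue) = (\<integral>x. v x * \<phi> x \<partial>lebesgue)" if \<phi>: "test_function \<phi>" for \<phi>
  proof (rule integral_cong_AE)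
    show "AE x in lebesgue. w x * \<phi> x = v x * \<phi> x" using assms(3) by eventually_elim simp
  qed (use integrable_mult_test[OF _ \<phi>] assms in \<open>auto simp: has_weak_deriv_def dest: borel_measurable_integrable\<close>)
  then show ?thesis using assms(1,2) by (auto simp: has_weak_deriv_def)
qed

lemma weak_deriv_exists:
  assumes "has_weak_deriv \<gamma> u v"
  shows "has_weak_deriv \<gamma> u (weak_deriv \<gamma> u)"
  unfolding weak_deriv_def using assms
  by (auto intro: someI2_ex[of "\<lambda>v. has_weak_deriv \<gamma> u v \<and> continuous_on UNIV v"] someI2_ex[of "has_weak_deriv \<gamma> u"])

lemma weak_deriv_continuous:
  assumes "has_weak_deriv \<gamma> u v" "continuous_on UNIV v"
  shows "weak_deriv \<gamma> u = v"
proof -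
  have ex: "\<exists>v. has_weak_deriv \<gamma> u v \<and> continuous_on UNIV v" using assms by blast
  then have "has_weak_deriv \<gamma> u (weak_deriv \<gamma> u) \<and> continuous_on UNIV (weak_deriv \<gamma> u)"
    unfolding weak_deriv_def if_P[OF ex] by (rule someI_ex)
  then show ?thesis using assms by (intro continuous_AE_eq has_weak_deriv_AE_unique) auto
qed

text \<open>What the estimates use of the representatives \<open>w \<gamma>\<close> of \<open>\<partial>\<^sup>\<gamma>u\<close>, where \<open>M \<gamma>\<close> stands for the norm of
  \<open>\<partial>\<^sup>\<gamma>u\<close>. Of the derivatives of order \<open>L\<close> only the norms occur, as Lipschitz constants of the
  derivatives of order \<open>L - 1\<close>.\<close>

definition deriv_family ::
  "nat \<Rightarrow> (nat^'n \<Rightarrow> real^'n \<Rightarrow> real) \<Rightarrow> (nat^'n \<Rightarrow> real) \<Rightarrow> bool" where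
  "deriv_family L w M \<longleftrightarrow>
     (\<forall>\<gamma> i. Suc (mi_abs \<gamma>) < L \<longrightarrow> has_partial i (w \<gamma>) (w (\<gamma> + mi_unit i))) \<and>
     (\<forall>\<gamma>. mi_abs \<gamma> < L \<longrightarrow> (\<Sum>i\<in>UNIV. M (\<gamma> + mi_unit i))-lipschitz_on UNIV (w \<gamma>)) \<and>
     (\<forall>\<gamma> x. mi_abs \<gamma> < L \<longrightarrow> \<bar>w \<gamma> x\<bar> \<le> M \<gamma>) \<and>
     (\<forall>\<gamma>. mi_abs \<gamma> \<le> L \<longrightarrow> 0 \<le> M \<gamma>)"

text \<open>A Lipschitz representative exists because the next weak derivative is bounded. Being continuous,
  it is the one selected by \<open>weak_deriv\<close>, and weak derivatives between continuous functions are classical.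
  For \<open>|\<gamma>| = L\<close> the selected representative is bounded since it agrees almost everywhere with a bounded one.\<close>

lemma sobolev_deriv_family:
  fixes u :: "real^'n \<Rightarrow> real"
  assumes u: "u \<in> sobolev_Linf L"
  shows "deriv_family L (\<lambda>\<gamma>. weak_deriv \<gamma> u) (\<lambda>\<gamma>. Linf_norm (weak_deriv \<gamma> u))"
proof -
  let ?w = "\<lambda>\<gamma>. weak_deriv \<gamma> u"
  have wd: "has_weak_deriv \<gamma> u (?w \<gamma>)" and Li: "in_Linf (?w \<gamma>)" if \<gamma>: "mi_abs \<gamma> \<le> L" for \<gamma>
  proof -
    obtain v where v: "has_weak_deriv \<gamma> u v" "in_Linf v"
      using u \<gamma> by (auto simp: sobolev_Linf_def)
    show wd: "has_weak_deriv \<gamma> u (?w \<gamma>)" using v(1) by (rule weak_deriv_exists)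
    show "in_Linf (?w \<gamma>)"
      using wd by (intro in_Linf_cong_AE[OF v(2)] locally_integrable_measurable has_weak_deriv_AE_unique[OF wd v(1)])
        (simp add: has_weak_deriv_def)
  qed
  have wp: "weak_partial i (?w \<gamma>) (?w (\<gamma> + mi_unit i))" if "mi_abs \<gamma> < L" for i \<gamma>
    by (rule has_weak_deriv_weak_partial[of \<gamma> u]; rule wd) (use that in \<open>auto simp: mi_abs_add mi_abs_unit\<close>)
  have lip: "(\<Sum>i\<in>UNIV. Linf_norm (?w (\<gamma> + mi_unit i)))-lipschitz_on UNIV (?w \<gamma>)" if \<gamma>: "mi_abs \<gamma> < L" for \<gamma>
  proof -
    obtain v where v: "(\<Sum>i\<in>UNIV. Linf_norm (?w (\<gamma> + mi_unit i)))-lipschitz_on UNIV v"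
        "AE x in lebesgue. v x = ?w \<gamma> x"
    proof (rule lipschitz_representative[of "?w \<gamma>" "\<lambda>i. ?w (\<gamma> + mi_unit i)" "\<lambda>i. Linf_norm (?w (\<gamma> + mi_unit i))"])
      show "weak_partial i (?w \<gamma>) (?w (\<gamma> + mi_unit i))" for i using wp[OF \<gamma>] .
      show "AE y in lebesgue. \<bar>?w (\<gamma> + mi_unit i) y\<bar> \<le> Linf_norm (?w (\<gamma> + mi_unit i))" for i
        using \<gamma> by (intro in_Linf_AE_bound Li) (simp add: mi_abs_add mi_abs_unit)
    qed
    have cont: "continuous_on UNIV v" using v(1) by (rule lipschitz_on_continuous_on)
    have "has_weak_deriv \<gamma> u v"
      by (rule has_weak_deriv_cong_AE[OF wd locally_integrable_continuous[OF cont] v(2)]) (use \<gamma> in simp)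
    then have "?w \<gamma> = v" using cont by (rule weak_deriv_continuous)
    then show ?thesis using v(1) by simp
  qed
  then have cont: "continuous_on UNIV (?w \<gamma>)" if "mi_abs \<gamma> < L" for \<gamma>
    using that lipschitz_on_continuous_on by blast
  show ?thesis unfolding deriv_family_def
  proof (intro conjI allI impI)
    show "has_partial i (?w \<gamma>) (?w (\<gamma> + mi_unit i))" if "Suc (mi_abs \<gamma>) < L" for \<gamma> i
      using that by (intro continuous_weak_partial_is_partial wp cont) (auto simp: mi_abs_add mi_abs_unit)
    show "\<bar>?w \<gamma> x\<bar> \<le> Linf_norm (?w \<gamma>)" if "mi_abs \<gamma> < L" for \<gamma> x
      using that by (intro continuous_bound_AE cont in_Linf_AE_bound(1) Li) auto
    show "0 \<le> Linf_norm (?w \<gamma>)" if "mi_abs \<gamma> \<le> L" for \<gamma>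
      using Li[OF that] by (rule in_Linf_AE_bound(2))
  qed (use lip in blast)
qed

section \<open>Taylor's formula\<close>

definition taylor_monom :: "nat^'n \<Rightarrow> real^'n \<Rightarrow> real" where
  "taylor_monom \<alpha> x = mi_monom x \<alpha> / mi_fact \<alpha>"

lemma mi_monom_split: "mi_monom x \<alpha> = x $ i ^ (\<alpha> $ i) * (\<Prod>j\<in>UNIV - {i}. x $ j ^ (\<alpha> $ j))"
  unfolding mi_monom_def by (rule prod.remove) auto

lemma mi_fact_split: "mi_fact \<alpha> = fact (\<alpha> $ i) * (\<Prod>j\<in>UNIV - {i}. fact (\<alpha> $ j))"
  unfolding mi_fact_def by (rule prod.remove) auto

lemma mi_fact_pos: "mi_fact \<alpha> > 0"
  unfolding mi_fact_def by (rule prod_pos) simp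

lemma mi_monom_0: "mi_monom x 0 = 1" and mi_fact_0: "mi_fact 0 = 1"
  by (simp_all add: mi_monom_def mi_fact_def)

lemma mi_fact_unit: "mi_fact (\<alpha> + mi_unit i) = (real (\<alpha> $ i) + 1) * mi_fact \<alpha>"
  unfolding mi_fact_split[of _ i] by (simp add: algebra_simps)

lemma mi_monom_deriv:
  "((\<lambda>t. mi_monom (x + t *\<^sub>R axis i 1) (\<alpha> + mi_unit i)) has_real_derivative
      (real (\<alpha> $ i) + 1) * mi_monom x \<alpha>) (at 0)"
proof -
  have "(\<Prod>j\<in>UNIV - {i}. (x + t *\<^sub>R axis i 1) $ j ^ ((\<alpha> + mi_unit i) $ j)) = (\<Prod>j\<in>UNIV - {i}. x $ j ^ (\<alpha> $ j))" for t
    by (rule prod.cong) (auto simp: axis_def)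
  then have eq: "mi_monom (x + t *\<^sub>R axis i 1) (\<alpha> + mi_unit i)
      = (x $ i + t) ^ Suc (\<alpha> $ i) * (\<Prod>j\<in>UNIV - {i}. x $ j ^ (\<alpha> $ j))" for t
    unfolding mi_monom_split[of _ _ i] by simp
  have "((\<lambda>t. x $ i + t) has_real_derivative 1) (at 0)" by (auto intro!: derivative_eq_intros)
  then show ?thesis unfolding eq mi_monom_split[of x \<alpha> i]
    by (rule DERIV_cong[OF DERIV_cmult_right[OF DERIV_power_Suc]]) simp
qed

lemma mi_monom_deriv_0:
  assumes "\<alpha> $ i = 0"
  shows "mi_monom (x + t *\<^sub>R axis i 1) \<alpha> = mi_monom x \<alpha>"
  unfolding mi_monom_def using assms by (intro prod.cong) (auto simp: axis_def)

lemma has_partial_taylor_monom: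
  "has_partial i (taylor_monom (\<alpha> + mi_unit i)) (taylor_monom \<alpha>)"
  "\<alpha> $ i = 0 \<Longrightarrow> has_partial i (taylor_monom \<alpha>) (\<lambda>_. 0)"
proof -
  have "real (\<alpha> $ i) + 1 \<noteq> 0" by linarith
  then show "has_partial i (taylor_monom (\<alpha> + mi_unit i)) (taylor_monom \<alpha>)"
    unfolding has_partial_def taylor_monom_def mi_fact_unit
    using DERIV_cdivide[OF mi_monom_deriv, of _ i \<alpha> "(real (\<alpha> $ i) + 1) * mi_fact \<alpha>"] by simp
  show "has_partial i (taylor_monom \<alpha>) (\<lambda>_. 0)" if "\<alpha> $ i = 0"
    unfolding has_partial_def taylor_monom_def using mi_monom_deriv_0[OF that] by simp
qed

lemma has_partial_cmult: "has_partial i f f' \<Longrightarrow> has_partial i (\<lambda>x. c * f x) (\<lambda>x. c * f' x)"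
  unfolding has_partial_def by (auto intro: DERIV_cmult)

lemma has_partial_sum:
  "(\<And>k. k \<in> A \<Longrightarrow> has_partial i (f k) (f' k)) \<Longrightarrow> has_partial i (\<lambda>x. \<Sum>k\<in>A. f k x) (\<lambda>x. \<Sum>k\<in>A. f' k x)"
  unfolding has_partial_def by (auto intro: DERIV_sum)

text \<open>The first sum collects the monomials that are constant in direction \<open>i\<close>; in the second the power
  of the \<open>i\<close>-th variable is lowered by one, as differentiation does.\<close>

lemma sum_mi_abs_le_Suc:
  fixes F :: "nat^'n \<Rightarrow> real"
  shows "(\<Sum>\<alpha> | mi_abs \<alpha> \<le> Suc k. F \<alpha>) =
     (\<Sum>\<alpha> | mi_abs \<alpha> \<le> Suc k \<and> \<alpha> $ i = 0. F \<alpha>) + (\<Sum>\<alpha> | mi_abs \<alpha> \<le> k. F (\<alpha> + mi_unit i))"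
proof -
  let ?A = "{\<alpha>::nat^'n. mi_abs \<alpha> \<le> Suc k}"
  have bij: "bij_betw (\<lambda>\<alpha>. \<alpha> + mi_unit i) {\<alpha>::nat^'n. mi_abs \<alpha> \<le> k} {\<alpha>. mi_abs \<alpha> \<le> Suc k \<and> \<alpha> $ i \<noteq> 0}"
  proof (rule bij_betwI')
    fix \<alpha> assume \<alpha>: "\<alpha> \<in> {\<alpha>::nat^'n. mi_abs \<alpha> \<le> Suc k \<and> \<alpha> $ i \<noteq> 0}"
    then have le: "mi_unit i \<le> \<alpha>" by (auto simp: less_eq_vec_def)
    have eq: "\<alpha> = (\<alpha> - mi_unit i) + mi_unit i"
      using mi_add_diff_inverse[OF le] by (simp add: add.commute)
    have "mi_abs (\<alpha> - mi_unit i) + 1 = mi_abs \<alpha>"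
      using mi_abs_add[of "\<alpha> - mi_unit i" "mi_unit i"] by (simp add: mi_abs_unit flip: eq)
    then show "\<exists>\<alpha>'\<in>{\<alpha>::nat^'n. mi_abs \<alpha> \<le> k}. \<alpha> = \<alpha>' + mi_unit i"
      using eq \<alpha> by (intro bexI[of _ "\<alpha> - mi_unit i"]) auto
  qed (auto simp: mi_abs_add mi_abs_unit)
  have "sum F ?A = sum F ({\<alpha>. mi_abs \<alpha> \<le> Suc k \<and> \<alpha> $ i = 0} \<union> {\<alpha>. mi_abs \<alpha> \<le> Suc k \<and> \<alpha> $ i \<noteq> 0})"
    by (rule sum.cong) auto
  also have "\<dots> = sum F {\<alpha>. mi_abs \<alpha> \<le> Suc k \<and> \<alpha> $ i = 0} + sum F {\<alpha>. mi_abs \<alpha> \<le> Suc k \<and> \<alpha> $ i \<noteq> 0}"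
    by (rule sum.union_disjoint) (auto intro: finite_subset[OF _ finite_mi_abs_le[of "Suc k"]])
  finally show ?thesis using sum.reindex_bij_betw[OF bij, of F] by simp
qed

text \<open>On the path that exchanges one coordinate at a time no point is farther from \<open>x\<close> than \<open>y\<close>.\<close>

lemma bounded_partials_lipschitz:
  fixes f :: "real^'n \<Rightarrow> real"
  assumes part: "\<And>i. has_partial i f (f' i)"
    and bd: "\<And>i z. norm (z - x) \<le> norm (y - x) \<Longrightarrow> \<bar>f' i z\<bar> \<le> B"
  shows "\<bar>f y - f x\<bar> \<le> real CARD('n) * B * norm (y - x)"
proof -
  have "\<bar>f y - f x\<bar> \<le> (\<Sum>i\<in>(UNIV::'n set). B * norm (y - x))"
  proof (rule coordinate_path_bound)
    fix S :: "'n set" and i assume i: "i \<notin> S"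
    let ?z = "\<chi> j. if j \<in> S then y $ j else x $ j"
    have eq: "(\<chi> j. if j \<in> insert i S then y $ j else x $ j) = ?z + (y $ i - x $ i) *\<^sub>R axis i 1"
      using i by (auto simp: vec_eq_iff axis_def)
    obtain \<theta> where \<theta>: "\<theta> \<in> {0..1}" "f (?z + (y $ i - x $ i) *\<^sub>R axis i 1) - f ?z
        = (y $ i - x $ i) * f' i (?z + (\<theta> * (y $ i - x $ i)) *\<^sub>R axis i 1)"
      using has_partial_mvt[OF part] by blast
    have "norm (?z + (\<theta> * (y $ i - x $ i)) *\<^sub>R axis i 1 - x) \<le> norm (y - x)"
    proof (rule norm_le_componentwise_cart)
      fix j
      show "norm ((?z + (\<theta> * (y $ i - x $ i)) *\<^sub>R axis i 1 - x) $ j) \<le> norm ((y - x) $ j)"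
        using \<theta>(1) i by (auto simp: axis_def abs_mult mult_left_le_one_le)
    qed
    then have "\<bar>f' i (?z + (\<theta> * (y $ i - x $ i)) *\<^sub>R axis i 1)\<bar> \<le> B" by (rule bd)
    then have "\<bar>y $ i - x $ i\<bar> * \<bar>f' i (?z + (\<theta> * (y $ i - x $ i)) *\<^sub>R axis i 1)\<bar> \<le> norm (y - x) * B"
      using component_le_norm_cart[of "y - x" i] by (intro mult_mono) auto
    then show "\<bar>f (\<chi> j. if j \<in> insert i S then y $ j else x $ j) - f ?z\<bar> \<le> B * norm (y - x)"
      unfolding eq \<theta>(2) by (simp add: abs_mult mult.commute)
  qed
  then show ?thesis by simp
qed

lemma sum_unit_le_sum_level:
  assumes "deriv_family L w M" "Suc (mi_abs \<gamma>) = L"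
  shows "(\<Sum>i\<in>UNIV. M (\<gamma> + mi_unit i)) \<le> real CARD('n) * (\<Sum>\<kappa> | mi_abs \<kappa> = L. M (\<kappa>::nat^'n))"
proof -
  have "M (\<gamma> + mi_unit i) \<le> (\<Sum>\<kappa> | mi_abs \<kappa> = L. M \<kappa>)" for i
    using assms by (intro member_le_sum finite_mi_abs_eq) (auto simp: mi_abs_add mi_abs_unit deriv_family_def)
  then show ?thesis using sum_mono[of UNIV "\<lambda>i. M (\<gamma> + mi_unit i)" "\<lambda>_. \<Sum>\<kappa> | mi_abs \<kappa> = L. M \<kappa>"] by simp
qed

text \<open>The partial derivatives of the remainder of \<open>w \<gamma>\<close> are the remainders of one order less of the
  \<open>w (\<gamma> + mi_unit i)\<close>, and the remainder vanishes at \<open>x\<close>. The induction starts from the Lipschitz bound for the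
  derivatives of order \<open>L - 1\<close>.\<close>

lemma taylor_remainder:
  fixes w :: "nat^'n \<Rightarrow> real^'n \<Rightarrow> real"
  assumes df: "deriv_family L w M" and "mi_abs \<gamma> + Suc k = L"
  shows "\<bar>w \<gamma> y - (\<Sum>\<alpha> | mi_abs \<alpha> \<le> k. w (\<gamma> + \<alpha>) x * taylor_monom \<alpha> (y - x))\<bar>
           \<le> real CARD('n) ^ Suc k * (\<Sum>\<kappa> | mi_abs \<kappa> = L. M \<kappa>) * norm (y - x) ^ Suc k"
  using assms(2)
proof (induction k arbitrary: \<gamma> y)
  case 0
  have "{\<alpha>::nat^'n. mi_abs \<alpha> \<le> 0} = {0}" by (auto simp: mi_abs_eq_0_iff mi_abs_0)
  then have eq: "(\<Sum>\<alpha> | mi_abs \<alpha> \<le> 0. w (\<gamma> + \<alpha>) x * taylor_monom \<alpha> (y - x)) = w \<gamma> x"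
    by (simp add: taylor_monom_def mi_monom_0 mi_fact_0)
  have "(\<Sum>i\<in>UNIV. M (\<gamma> + mi_unit i))-lipschitz_on UNIV (w \<gamma>)" using df 0 by (simp add: deriv_family_def)
  then have "dist (w \<gamma> y) (w \<gamma> x) \<le> (\<Sum>i\<in>UNIV. M (\<gamma> + mi_unit i)) * dist y x"
    by (rule lipschitz_onD) auto
  also have "\<dots> \<le> real CARD('n) * (\<Sum>\<kappa> | mi_abs \<kappa> = L. M \<kappa>) * dist y x"
    using sum_unit_le_sum_level[OF df, of \<gamma>] 0 by (intro mult_right_mono) auto
  finally show ?case unfolding eq by (simp add: dist_norm)
next
  case (Suc k)
  let ?S = "\<Sum>\<kappa> | mi_abs \<kappa> = L. M \<kappa>"
  define P where "P = (\<lambda>z. w \<gamma> z - (\<Sum>\<alpha> | mi_abs \<alpha> \<le> Suc k. w (\<gamma> + \<alpha>) x * taylor_monom \<alpha> (z - x)))"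
  define P' where "P' = (\<lambda>i z. w (\<gamma> + mi_unit i) z -
      (\<Sum>\<alpha> | mi_abs \<alpha> \<le> k. w (\<gamma> + mi_unit i + \<alpha>) x * taylor_monom \<alpha> (z - x)))"
  have part: "has_partial i P (P' i)" for i
  proof -
    have "has_partial i (\<lambda>z. (\<Sum>\<alpha> | mi_abs \<alpha> \<le> Suc k \<and> \<alpha> $ i = 0. w (\<gamma> + \<alpha>) x * taylor_monom \<alpha> (z + (- x)))
            - (\<Sum>\<alpha> | mi_abs \<alpha> \<le> k. (- w (\<gamma> + (\<alpha> + mi_unit i)) x) * taylor_monom (\<alpha> + mi_unit i) (z + (- x))))
         (\<lambda>z. (\<Sum>\<alpha> | mi_abs \<alpha> \<le> Suc k \<and> \<alpha> $ i = 0. w (\<gamma> + \<alpha>) x * 0)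
            - (\<Sum>\<alpha> | mi_abs \<alpha> \<le> k. (- w (\<gamma> + (\<alpha> + mi_unit i)) x) * taylor_monom \<alpha> (z + (- x))))"
      by (intro has_partial_diff has_partial_sum has_partial_cmult
          has_partial_shift[OF has_partial_taylor_monom(1)] has_partial_shift[OF has_partial_taylor_monom(2), where v = "- x"]) auto
    then have "has_partial i (\<lambda>z. \<Sum>\<alpha> | mi_abs \<alpha> \<le> Suc k. w (\<gamma> + \<alpha>) x * taylor_monom \<alpha> (z - x))
       (\<lambda>z. \<Sum>\<alpha> | mi_abs \<alpha> \<le> k. w (\<gamma> + mi_unit i + \<alpha>) x * taylor_monom \<alpha> (z - x))"
      unfolding sum_mi_abs_le_Suc[of _ k i] by (simp add: sum_negf add.assoc add.commute[of "mi_unit i"])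
    moreover have "has_partial i (w \<gamma>) (w (\<gamma> + mi_unit i))" using df Suc.prems by (simp add: deriv_family_def)
    ultimately show ?thesis unfolding P_def P'_def by (rule has_partial_diff[rotated])
  qed
  have S0: "?S \<ge> 0" using df by (intro sum_nonneg) (simp add: deriv_family_def)
  have bd: "\<bar>P' i z\<bar> \<le> real CARD('n) ^ Suc k * ?S * norm (y - x) ^ Suc k" if "norm (z - x) \<le> norm (y - x)" for i z
  proof -
    have "\<bar>P' i z\<bar> \<le> real CARD('n) ^ Suc k * ?S * norm (z - x) ^ Suc k"
      unfolding P'_def by (rule Suc.IH) (use Suc.prems in \<open>simp add: mi_abs_add mi_abs_unit\<close>)
    also have "\<dots> \<le> real CARD('n) ^ Suc k * ?S * norm (y - x) ^ Suc k"
      using that S0 by (intro mult_left_mono power_mono) auto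
    finally show ?thesis .
  qed
  have P0: "P x = 0"
  proof -
    have "taylor_monom \<alpha> 0 = (if \<alpha> = 0 then 1 else 0)" for \<alpha> :: "nat^'n"
    proof (cases "\<alpha> = 0")
      case False
      then obtain i where "\<alpha> $ i \<noteq> 0" by (auto simp: vec_eq_iff)
      then show ?thesis using False by (simp add: taylor_monom_def mi_monom_split[of _ _ i])
    qed (simp add: taylor_monom_def mi_monom_0 mi_fact_0)
    then have "(\<Sum>\<alpha> | mi_abs \<alpha> \<le> Suc k. w (\<gamma> + \<alpha>) x * taylor_monom \<alpha> (x - x)) = w \<gamma> x"
      by (simp add: if_distrib[of "\<lambda>t. _ * t"] sum.delta[OF finite_mi_abs_le] mi_abs_0 cong: if_cong)
    then show ?thesis by (simp add: P_def)
  qed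
  have "\<bar>P y - P x\<bar> \<le> real CARD('n) * (real CARD('n) ^ Suc k * ?S * norm (y - x) ^ Suc k) * norm (y - x)"
    by (rule bounded_partials_lipschitz[OF part bd])
  then show ?case using P0 unfolding P_def by (simp add: algebra_simps)
qed

section \<open>Interpolation between derivatives\<close>

lemma deriv_family_iterated:
  assumes df: "deriv_family L w M" and "mi_list \<nu> js" and "mi_abs \<gamma> + mi_abs \<nu> < L"
  shows "iterated_partial js (w \<gamma>) (w (\<gamma> + \<nu>))"
  using assms(2,3)
proof (induction js arbitrary: \<gamma> \<nu>)
  case Nil
  then have "\<nu> = 0" using mi_list_length[of \<nu> "[]"] by (simp add: mi_abs_eq_0_iff)
  then show ?case by simp
next
  case (Cons i js)
  obtain \<nu>' where \<nu>': "\<nu> = \<nu>' + mi_unit i" "mi_list \<nu>' js" using Cons.prems(1) by (rule mi_list_ConsE)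
  have "iterated_partial js (w (\<gamma> + mi_unit i)) (w (\<gamma> + mi_unit i + \<nu>'))"
    using Cons.IH[OF \<nu>'(2), of "\<gamma> + mi_unit i"] Cons.prems(2) \<nu>'(1) by (simp add: mi_abs_add mi_abs_unit)
  moreover have "\<gamma> + mi_unit i + \<nu>' = \<gamma> + \<nu>" by (simp add: \<nu>'(1) ac_simps)
  moreover have "has_partial i (w \<gamma>) (w (\<gamma> + mi_unit i))"
    using df Cons.prems(2) \<nu>'(1) by (simp add: deriv_family_def mi_abs_add mi_abs_unit)
  ultimately show ?case unfolding iterated_partial_Cons by metis
qed

lemma iterated_diff_bound:
  assumes "\<And>x. \<bar>f x\<bar> \<le> B"
  shows "\<bar>iterated_diff \<tau> is f x\<bar> \<le> 2 ^ length is * B"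
proof (induction "is" arbitrary: x)
  case (Cons i "is")
  show ?case using Cons[of x] Cons[of "x + \<tau> i *\<^sub>R axis i 1"] by simp
qed (use assms in simp)

text \<open>By the mean value theorem for iterated differences, the derivative of order \<open>j\<close> is bounded by a
  lower derivative of order \<open>N\<close> at some point within a distance of order \<open>\<delta>\<close> of \<open>x\<close>; moving to \<open>x\<close> costs \<open>\<delta>\<close>
  times the derivatives of order \<open>j + 1\<close>. The induction therefore descends from the order \<open>L - |\<beta>| - 1\<close>, where the
  Lipschitz bound takes the place of the next derivative.\<close>

lemma intermediate_deriv_bound:
  fixes \<beta> :: "nat^'n"
  assumes "N \<le> j" "mi_abs \<beta> + j < L"
  shows "\<exists>C\<ge>0. \<forall>w M \<delta> x (\<kappa>::nat^'n). deriv_family L w M \<longrightarrow> \<delta> > 0 \<longrightarrow> mi_abs \<kappa> = j \<longrightarrow>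
     \<delta> ^ j * \<bar>w (\<beta> + \<kappa>) x\<bar> \<le> C * (\<delta> ^ N * (\<Sum>\<alpha> | mi_abs \<alpha> = N. M (\<alpha> + \<beta>)) +
                              \<delta> ^ (L - mi_abs \<beta>) * (\<Sum>\<gamma> | mi_abs \<gamma> = L. M \<gamma>))"
  using assms
proof (induction "L - mi_abs \<beta> - j" arbitrary: j)
  case 0
  then show ?case by linarith
next
  case (Suc d)
  let ?n = "real CARD('n)"
  let ?R = "\<lambda>M \<delta>. \<delta> ^ N * (\<Sum>\<alpha> | mi_abs \<alpha> = N. M (\<alpha> + \<beta>)) +
                              \<delta> ^ (L - mi_abs \<beta>) * (\<Sum>\<gamma> | mi_abs \<gamma> = L. M \<gamma>)"
  define m where "m = j - N"
  have next_bound: "\<exists>C\<ge>0. \<forall>w M \<delta> x y (\<kappa>::nat^'n). deriv_family L w M \<longrightarrow> \<delta> > 0 \<longrightarrow> mi_abs \<kappa> = j \<longrightarrow>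
      \<delta> ^ Suc j * \<bar>w (\<beta> + \<kappa>) y - w (\<beta> + \<kappa>) x\<bar> \<le> C * ?R M \<delta> * norm (y - x)"
  proof (cases "mi_abs \<beta> + Suc j < L")
    case True
    have d: "d = L - mi_abs \<beta> - Suc j" using Suc.hyps(2) by simp
    obtain C where C: "C \<ge> 0" "\<And>w M \<delta> x (\<kappa>::nat^'n). deriv_family L w M \<Longrightarrow> \<delta> > 0 \<Longrightarrow> mi_abs \<kappa> = Suc j \<Longrightarrow>
        \<delta> ^ Suc j * \<bar>w (\<beta> + \<kappa>) x\<bar> \<le> C * ?R M \<delta>"
      using Suc.hyps(1)[OF d le_SucI[OF Suc.prems(1)] True] by blast
    have "\<delta> ^ Suc j * \<bar>w (\<beta> + \<kappa>) y - w (\<beta> + \<kappa>) x\<bar> \<le> ?n * C * ?R M \<delta> * norm (y - x)"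
      if df: "deriv_family L w M" and \<delta>: "\<delta> > 0" and \<kappa>: "mi_abs \<kappa> = j" for w M \<delta> x y and \<kappa> :: "nat^'n"
    proof -
      have "\<bar>w (\<beta> + \<kappa>) y - w (\<beta> + \<kappa>) x\<bar> \<le> ?n * (C * ?R M \<delta> / \<delta> ^ Suc j) * norm (y - x)"
      proof (rule bounded_partials_lipschitz)
        show "has_partial i (w (\<beta> + \<kappa>)) (w (\<beta> + (\<kappa> + mi_unit i)))" for i
          using df \<kappa> True by (simp add: deriv_family_def mi_abs_add flip: add.assoc)
        show "\<bar>w (\<beta> + (\<kappa> + mi_unit i)) z\<bar> \<le> C * ?R M \<delta> / \<delta> ^ Suc j" for i z
          using C(2)[OF df \<delta>, of "\<kappa> + mi_unit i" z] \<kappa> \<delta>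
          by (simp add: mi_abs_add mi_abs_unit le_divide_eq mult.commute)
      qed
      then have "\<delta> ^ Suc j * \<bar>w (\<beta> + \<kappa>) y - w (\<beta> + \<kappa>) x\<bar> \<le> \<delta> ^ Suc j * (?n * (C * ?R M \<delta> / \<delta> ^ Suc j) * norm (y - x))"
        using \<delta> by (intro mult_left_mono) auto
      also have "\<dots> = ?n * C * ?R M \<delta> * norm (y - x)" using \<delta> by simp
      finally show ?thesis .
    qed
    then show ?thesis using C(1) by (intro exI[of _ "?n * C"]) auto
  next
    case False
    then have L: "mi_abs \<beta> + Suc j = L" using Suc.prems by simp
    have "\<delta> ^ Suc j * \<bar>w (\<beta> + \<kappa>) y - w (\<beta> + \<kappa>) x\<bar> \<le> ?n * ?R M \<delta> * norm (y - x)"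
      if df: "deriv_family L w M" and \<delta>: "\<delta> > 0" and \<kappa>: "mi_abs \<kappa> = j" for w M \<delta> x y and \<kappa> :: "nat^'n"
    proof -
      have "(\<Sum>i\<in>UNIV. M (\<beta> + \<kappa> + mi_unit i))-lipschitz_on UNIV (w (\<beta> + \<kappa>))"
        using df \<kappa> L by (simp add: deriv_family_def mi_abs_add)
      then have "dist (w (\<beta> + \<kappa>) y) (w (\<beta> + \<kappa>) x) \<le> (\<Sum>i\<in>UNIV. M (\<beta> + \<kappa> + mi_unit i)) * dist y x"
        by (rule lipschitz_onD) auto
      also have "\<dots> \<le> ?n * (\<Sum>\<gamma> | mi_abs \<gamma> = L. M \<gamma>) * dist y x"
        using sum_unit_le_sum_level[OF df, of "\<beta> + \<kappa>"] L \<kappa> by (intro mult_right_mono) (auto simp: mi_abs_add)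
      finally have "\<delta> ^ Suc j * \<bar>w (\<beta> + \<kappa>) y - w (\<beta> + \<kappa>) x\<bar>
          \<le> \<delta> ^ Suc j * (?n * (\<Sum>\<gamma> | mi_abs \<gamma> = L. M \<gamma>) * norm (y - x))"
        using \<delta> by (intro mult_left_mono) (auto simp: dist_norm)
      also have "\<dots> = ?n * (\<delta> ^ Suc j * (\<Sum>\<gamma> | mi_abs \<gamma> = L. M \<gamma>)) * norm (y - x)" by simp
      also have "\<dots> \<le> ?n * ?R M \<delta> * norm (y - x)"
      proof -
        have "Suc j = L - mi_abs \<beta>" using L by simp
        moreover have "(\<Sum>\<alpha> | mi_abs \<alpha> = N. M (\<alpha> + \<beta>)) \<ge> 0"
          using df Suc.prems by (intro sum_nonneg) (auto simp: deriv_family_def mi_abs_add)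
        ultimately show ?thesis using \<delta> by (intro mult_right_mono mult_left_mono) auto
      qed
      finally show ?thesis .
    qed
    then show ?thesis by (intro exI[of _ ?n]) auto
  qed
  then obtain C where C: "C \<ge> 0" "\<And>w M \<delta> x y (\<kappa>::nat^'n). deriv_family L w M \<Longrightarrow> \<delta> > 0 \<Longrightarrow> mi_abs \<kappa> = j \<Longrightarrow>
      \<delta> ^ Suc j * \<bar>w (\<beta> + \<kappa>) y - w (\<beta> + \<kappa>) x\<bar> \<le> C * ?R M \<delta> * norm (y - x)" by metis
  have "\<delta> ^ j * \<bar>w (\<beta> + \<kappa>) x\<bar> \<le> (2 ^ m + C * real m) * ?R M \<delta>"
    if df: "deriv_family L w M" and \<delta>: "\<delta> > 0" and \<kappa>: "mi_abs \<kappa> = j" for w M \<delta> x and \<kappa> :: "nat^'n"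
  proof -
    obtain \<alpha> where \<alpha>: "\<alpha> \<le> \<kappa>" "mi_abs \<alpha> = N" using exists_mi_below[of N \<kappa>] \<kappa> Suc.prems by auto
    define \<nu> where "\<nu> = \<kappa> - \<alpha>"
    have \<kappa>_eq: "\<kappa> = \<alpha> + \<nu>" using mi_add_diff_inverse[OF \<alpha>(1)] by (simp add: \<nu>_def)
    have \<nu>: "mi_abs \<nu> = m" using \<kappa>_eq \<kappa> \<alpha> by (simp add: mi_abs_add m_def)
    obtain js where js: "mi_list \<nu> js" using exists_mi_list by blast
    have len: "length js = m" using mi_list_length[OF js] \<nu> by simp
    have ip: "iterated_partial js (w (\<beta> + \<alpha>)) (w (\<beta> + \<kappa>))"
      using deriv_family_iterated[OF df js, of "\<beta> + \<alpha>"] Suc.prems \<alpha> \<nu> \<kappa>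
      by (simp add: mi_abs_add \<kappa>_eq add.assoc)
    obtain \<xi> where \<xi>: "norm (\<xi> - x) \<le> real m * \<delta>" "iterated_diff (\<lambda>_. \<delta>) js (w (\<beta> + \<alpha>)) x = \<delta> ^ m * w (\<beta> + \<kappa>) \<xi>"
      using iterated_diff_mvt[OF ip, of x "\<lambda>_. \<delta>"] \<delta> len by (auto simp: sum_list_const_mult map_replicate_const sum_list_replicate prod_list_replicate)
    have M_R: "\<delta> ^ N * M (\<alpha> + \<beta>) \<le> ?R M \<delta>"
    proof -
      have "M (\<alpha> + \<beta>) \<le> (\<Sum>\<alpha> | mi_abs \<alpha> = N. M (\<alpha> + \<beta>))"
        using df \<alpha> Suc.prems by (intro member_le_sum[of \<alpha> _ "\<lambda>\<alpha>. M (\<alpha> + \<beta>)"] finite_mi_abs_eq) (auto simp: deriv_family_def mi_abs_add)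
      moreover have "(\<Sum>\<gamma> | mi_abs \<gamma> = L. M \<gamma>) \<ge> 0" using df by (intro sum_nonneg) (simp add: deriv_family_def)
      ultimately show ?thesis using \<delta> by (intro add_increasing2 mult_left_mono mult_nonneg_nonneg) auto
    qed
    have "M (\<alpha> + \<beta>) \<ge> 0" using df \<alpha> Suc.prems by (simp add: deriv_family_def mi_abs_add)
    then have R0: "?R M \<delta> \<ge> 0" using \<delta> by (intro order_trans[OF _ M_R] mult_nonneg_nonneg) auto
    have "\<delta> ^ m * \<bar>w (\<beta> + \<kappa>) \<xi>\<bar> \<le> 2 ^ m * M (\<alpha> + \<beta>)"
    proof -
      have "\<bar>w (\<beta> + \<alpha>) z\<bar> \<le> M (\<alpha> + \<beta>)" for z
        using df \<alpha> Suc.prems by (simp add: deriv_family_def mi_abs_add add.commute[of \<alpha>])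
      from iterated_diff_bound[where f = "w (\<beta> + \<alpha>)", OF this, of "\<lambda>_. \<delta>" js x]
      show ?thesis using \<xi>(2) \<delta> len by (simp add: abs_mult)
    qed
    then have "\<delta> ^ N * (\<delta> ^ m * \<bar>w (\<beta> + \<kappa>) \<xi>\<bar>) \<le> \<delta> ^ N * (2 ^ m * M (\<alpha> + \<beta>))"
      using \<delta> by (intro mult_left_mono) auto
    also have "\<dots> \<le> 2 ^ m * ?R M \<delta>"
      using M_R by (simp add: mult.left_commute)
    finally have 1: "\<delta> ^ j * \<bar>w (\<beta> + \<kappa>) \<xi>\<bar> \<le> 2 ^ m * ?R M \<delta>"
      using Suc.prems by (simp add: m_def mult.assoc[symmetric] power_add[symmetric])
    have "\<delta> ^ Suc j * \<bar>w (\<beta> + \<kappa>) x - w (\<beta> + \<kappa>) \<xi>\<bar> \<le> C * ?R M \<delta> * norm (x - \<xi>)" by (rule C(2)[OF df \<delta> \<kappa>])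
    also have "\<dots> \<le> C * ?R M \<delta> * (real m * \<delta>)"
      using \<xi>(1) C(1) R0 by (intro mult_left_mono) (auto simp: norm_minus_commute)
    finally have "\<delta> * (\<delta> ^ j * \<bar>w (\<beta> + \<kappa>) x - w (\<beta> + \<kappa>) \<xi>\<bar>) \<le> \<delta> * (C * real m * ?R M \<delta>)"
      by (simp add: mult_ac)
    then have 2: "\<delta> ^ j * \<bar>w (\<beta> + \<kappa>) x - w (\<beta> + \<kappa>) \<xi>\<bar> \<le> C * real m * ?R M \<delta>"
      using \<delta> by (simp only: mult_le_cancel_left_pos)
    have "\<delta> ^ j * \<bar>w (\<beta> + \<kappa>) x\<bar> \<le> \<delta> ^ j * (\<bar>w (\<beta> + \<kappa>) \<xi>\<bar> + \<bar>w (\<beta> + \<kappa>) x - w (\<beta> + \<kappa>) \<xi>\<bar>)"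
      using \<delta> by (intro mult_left_mono) auto
    then show ?thesis using 1 2 by (simp add: distrib_left distrib_right)
  qed
  then show ?case using C(1) by (intro exI[of _ "2 ^ m + C * real m"]) auto
qed

section \<open>Integrals and lattice sums of decaying functions\<close>

definition decays :: "real \<Rightarrow> (real^'n \<Rightarrow> real) \<Rightarrow> bool" where
  "decays p f \<longleftrightarrow> (\<exists>C\<ge>0. \<forall>x. \<bar>f x\<bar> \<le> C * (1 + norm x) powr (- p))"

lemma dyadic_exponent:
  assumes "(t::real) \<ge> 1"
  obtains k :: nat where "2 ^ k \<le> t" "t < 2 ^ Suc k"
proof -
  define P where "P = (\<lambda>k::nat. t < 2 ^ k)"
  obtain k0 where k0: "P k0" unfolding P_def using real_arch_pow[of 2 t] by auto
  define k where "k = (LEAST k. P k)"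
  have "P k" unfolding k_def using k0 by (rule LeastI)
  moreover have "k \<noteq> 0" using \<open>P k\<close> assms by (cases k) (auto simp: P_def)
  then obtain m where m: "k = Suc m" by (cases k) auto
  then have "\<not> P m" using not_less_Least[of m P] by (simp add: k_def)
  ultimately show thesis using that[of m] m by (auto simp: P_def)
qed

text \<open>Where \<open>2\<^sup>k \<le> 1 + |x| < 2\<^bsup>k+1\<^esup>\<close> the integrand is at most \<open>2\<^bsup>-kp\<^esup>\<close>, and this region lies in a ball of
  volume proportional to \<open>2\<^bsup>kn\<^esup>\<close>: a convergent geometric series dominates the integral.\<close>

lemma integrable_norm_powr:
  assumes p: "p > real CARD('n)"
  shows "integrable lborel (\<lambda>x::real^'n. (1 + norm x) powr (- p))"
proof -
  let ?g = "\<lambda>x::real^'n. (1 + norm x) powr (- p)"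
  let ?n = "real CARD('n)"
  define V where "V = unit_ball_vol ?n"
  have V: "V \<ge> 0" by (simp add: V_def)
  define a where "a = (\<lambda>k::nat. (2 ^ k) powr (- p) * (V * (2 ^ Suc k) ^ CARD('n)))"
  have a_eq: "a k = V * 2 ^ CARD('n) * (2 powr (?n - p)) ^ k" for k
  proof -
    have 1: "(2 ^ k) powr (- p) = (2 powr (- p)) ^ k"
    proof -
      have "(2 ^ k) powr (- p) = (2 powr real k) powr (- p)" by (simp add: powr_realpow)
      also have "\<dots> = 2 powr (real k * - p)" by (rule powr_powr)
      also have "\<dots> = (2 powr (- p)) ^ k" by (subst powr_power) auto
      finally show ?thesis .
    qed
    have 2: "((2::real) ^ Suc k) ^ CARD('n) = 2 ^ CARD('n) * (2 ^ CARD('n)) ^ k"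
      unfolding power_mult[symmetric] power_add[symmetric] by simp
    have 3: "2 powr (?n - p) = 2 powr (- p) * 2 ^ CARD('n)"
      by (simp add: powr_diff powr_minus powr_realpow divide_inverse)
    show ?thesis unfolding a_def 1 2 3 power_mult_distrib by (simp only: mult_ac)
  qed
  have "2 powr (?n - p) < 1" using p by (simp add: powr_less_one)
  then have sum_a: "summable a" unfolding a_eq[abs_def] by (intro summable_mult summable_geometric) simp
  have pw: "ennreal (?g x) \<le> (\<Sum>k. ennreal ((2 ^ k) powr (- p)) * indicator (ball 0 (2 ^ Suc k)) x)" for x
  proof -
    obtain k :: nat where k: "2 ^ k \<le> 1 + norm x" "1 + norm x < 2 ^ Suc k" by (rule dyadic_exponent[of "1 + norm x"]) auto
    have "ennreal (?g x) \<le> ennreal ((2 ^ k) powr (- p))"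
      using k(1) p by (intro ennreal_leI powr_mono2') auto
    also have "\<dots> = (\<Sum>j\<in>{k}. ennreal ((2 ^ j) powr (- p)) * indicator (ball 0 (2 ^ Suc j)) x)"
      using k(2) by simp
    also have "\<dots> \<le> (\<Sum>j. ennreal ((2 ^ j) powr (- p)) * indicator (ball 0 (2 ^ Suc j)) x)"
      by (rule sum_le_suminf) auto
    finally show ?thesis .
  qed
  have "(\<integral>\<^sup>+x. ennreal (?g x) \<partial>lborel) \<le> (\<integral>\<^sup>+x. (\<Sum>k. ennreal ((2 ^ k) powr (- p)) * indicator (ball 0 (2 ^ Suc k)) (x::real^'n)) \<partial>lborel)"
    by (rule nn_integral_mono) (use pw in auto)
  also have "\<dots> = (\<Sum>k. \<integral>\<^sup>+x. ennreal ((2 ^ k) powr (- p)) * indicator (ball 0 (2 ^ Suc k)) (x::real^'n) \<partial>lborel)"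
  proof (rule nn_integral_suminf)
    show "(\<lambda>x::real^'n. ennreal ((2 ^ k) powr (- p)) * indicator (ball 0 (2 ^ Suc k)) x) \<in> borel_measurable lborel" for k
      by (intro borel_measurable_times_ennreal borel_measurable_const borel_measurable_indicator) auto
  qed
  also have "\<dots> = (\<Sum>k. ennreal (a k))"
  proof (rule suminf_cong)
    fix k
    have "(\<integral>\<^sup>+x. ennreal ((2 ^ k) powr (- p)) * indicator (ball 0 (2 ^ Suc k)) (x::real^'n) \<partial>lborel)
        = ennreal ((2 ^ k) powr (- p)) * emeasure lborel (ball (0::real^'n) (2 ^ Suc k))"
      by (rule nn_integral_cmult_indicator) auto
    also have "emeasure lborel (ball (0::real^'n) (2 ^ Suc k)) = ennreal (V * (2 ^ Suc k) ^ CARD('n))"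
      by (subst emeasure_ball) (auto simp: V_def)
    also have "ennreal ((2 ^ k) powr (- p)) * ennreal (V * (2 ^ Suc k) ^ CARD('n)) = ennreal (a k)"
      unfolding a_def by (rule ennreal_mult[symmetric]) (use V in auto)
    finally show "(\<integral>\<^sup>+x. ennreal ((2 ^ k) powr (- p)) * indicator (ball 0 (2 ^ Suc k)) (x::real^'n) \<partial>lborel) = ennreal (a k)" .
  qed
  also have "\<dots> = ennreal (\<Sum>k. a k)"
    by (rule suminf_ennreal2) (use V sum_a in \<open>auto simp: a_def\<close>)
  finally have "(\<integral>\<^sup>+x. ennreal (?g x) \<partial>lborel) < \<infinity>" by (simp add: order_le_less_trans)
  then show ?thesis by (intro integrableI_nonneg) auto
qed

lemma decays_integrable:
  fixes f :: "real^'n \<Rightarrow> real"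
  assumes "decays p f" "p > real CARD('n)" "f \<in> borel_measurable borel"
  shows "integrable lborel f"
proof -
  obtain C where C: "\<And>x. \<bar>f x\<bar> \<le> C * (1 + norm x) powr (- p)" using assms(1) by (auto simp: decays_def)
  show ?thesis
    by (rule Bochner_Integration.integrable_bound[OF integrable_mult_right[OF integrable_norm_powr[OF assms(2)], of C]])
      (use assms(3) C in \<open>auto intro!: AE_I2 intro: order_trans[OF C abs_ge_self]\<close>)
qed

text \<open>The half-open cube of side \<open>\<eta>\<close> with the node \<open>y - \<eta> m\<close> as its upper corner. Described by floors,
  the cells are seen at once to form a partition.\<close>

definition lattice_cell :: "real \<Rightarrow> real^'n \<Rightarrow> int^'n \<Rightarrow> (real^'n) set" where
  "lattice_cell \<eta> y m = {z. \<forall>i. \<lfloor>(y $ i - z $ i) / \<eta>\<rfloor> = m $ i}"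

lemma lattice_cell_measurable [measurable]: "lattice_cell \<eta> y m \<in> sets borel"
  unfolding lattice_cell_def by measurable

lemma lattice_cell_bounds:
  assumes "\<eta> > 0" "z \<in> lattice_cell \<eta> y m"
  shows "y $ i - \<eta> * m $ i - \<eta> < z $ i" "z $ i \<le> y $ i - \<eta> * m $ i"
proof -
  have "\<lfloor>(y $ i - z $ i) / \<eta>\<rfloor> = m $ i" using assms(2) by (simp add: lattice_cell_def)
  then have "m $ i \<le> (y $ i - z $ i) / \<eta>" "(y $ i - z $ i) / \<eta> < m $ i + 1" by linarith+
  then show "y $ i - \<eta> * m $ i - \<eta> < z $ i" "z $ i \<le> y $ i - \<eta> * m $ i"
    using assms(1) by (auto simp: field_simps)
qed

lemma lattice_cell_emeasure:
  fixes y :: "real^'n"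
  assumes \<eta>: "\<eta> > 0"
  shows "emeasure lborel (lattice_cell \<eta> y m) = ennreal (\<eta> ^ CARD('n))"
proof (rule antisym)
  define b where "b = y - \<eta> *\<^sub>R lattice_pt m"
  define a where "a = b - \<eta> *\<^sub>R One"
  have ab: "b $ i = y $ i - \<eta> * m $ i" "a $ i = y $ i - \<eta> * m $ i - \<eta>" for i
    by (simp_all add: a_def b_def lattice_pt_def)
  have vol: "measure lborel (cbox a b) = \<eta> ^ CARD('n)" using content_cube[of \<eta> a] \<eta> by (simp add: a_def)
  have "emeasure lborel (lattice_cell \<eta> y m) \<le> emeasure lborel (cbox a b)"
    by (intro emeasure_mono subsetI)
      (auto simp: mem_box_cart ab intro: less_imp_le lattice_cell_bounds(1)[OF \<eta>] lattice_cell_bounds(2)[OF \<eta>])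
  also have "\<dots> = ennreal (\<eta> ^ CARD('n))" by (simp add: emeasure_eq_ennreal_measure vol emeasure_lborel_cbox_finite[unfolded infinity_ennreal_def less_top[symmetric]])
  finally show "emeasure lborel (lattice_cell \<eta> y m) \<le> ennreal (\<eta> ^ CARD('n))" .
  have "box a b \<subseteq> lattice_cell \<eta> y m"
  proof
    fix z assume "z \<in> box a b"
    then have "y $ i - \<eta> * m $ i - \<eta> < z $ i" "z $ i < y $ i - \<eta> * m $ i" for i
      by (auto simp: mem_box_cart ab)
    then show "z \<in> lattice_cell \<eta> y m"
      using \<eta> unfolding lattice_cell_def by (simp add: floor_eq_iff field_simps less_imp_le)
  qed
  then have "emeasure lborel (box a b) \<le> emeasure lborel (lattice_cell \<eta> y m)" by (intro emeasure_mono) auto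
  moreover have "emeasure lborel (box a b) = emeasure lborel (cbox a b)" by (simp add: emeasure_lborel_box_eq emeasure_lborel_cbox_eq)
  ultimately show "ennreal (\<eta> ^ CARD('n)) \<le> emeasure lborel (lattice_cell \<eta> y m)"
    using vol by (simp add: emeasure_eq_ennreal_measure emeasure_lborel_cbox_finite[unfolded infinity_ennreal_def less_top[symmetric]])
qed

lemma lattice_cell_integral_const:
  fixes y :: "real^'n"
  assumes "\<eta> > 0"
  shows "(\<integral>z. indicator (lattice_cell \<eta> y m) z * c \<partial>lborel) = \<eta> ^ CARD('n) * c"
    "integrable lborel (\<lambda>z. indicator (lattice_cell \<eta> y m) z * c)"
  using lattice_cell_emeasure[OF assms, of y m] assms by (auto simp: measure_def)

lemma lattice_cell_unique: "z \<in> lattice_cell \<eta> y m \<longleftrightarrow> m = (\<chi> i. \<lfloor>(y $ i - z $ i) / \<eta>\<rfloor>)"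
  by (auto simp: lattice_cell_def vec_eq_iff)

lemma infinite_int_vec: "infinite (UNIV :: (int^'n) set)"
proof -
  have "inj (\<lambda>k::int. (\<chi> i. k) :: int^'n)" by (rule injI) (simp add: vec_eq_iff)
  then show ?thesis using finite_imageD infinite_UNIV_int by (metis finite_subset subset_UNIV)
qed

lemma lattice_cells_has_sum:
  fixes g :: "real^'n \<Rightarrow> real"
  assumes g: "integrable lborel g"
  shows "((\<lambda>m. \<integral>z. indicator (lattice_cell \<eta> y m) z * g z \<partial>lborel) has_sum (\<integral>z. g z \<partial>lborel)) UNIV"
proof -
  obtain e :: "int^'n \<Rightarrow> nat" where "bij_betw e UNIV UNIV"
    using countableE_infinite[OF countableI_type infinite_int_vec] by metis
  then obtain e' :: "nat \<Rightarrow> int^'n" where e': "bij_betw e' UNIV UNIV" using bij_betw_inv by blast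
  define f where "f = (\<lambda>k z. indicator (lattice_cell \<eta> y (e' k)) z * g z)"
  have fi: "integrable lborel (f k)" for k
    unfolding f_def using integrable_mult_indicator[OF _ g, of "lattice_cell \<eta> y (e' k)"] by simp
  have pt: "(\<lambda>k. F k * indicator (lattice_cell \<eta> y (e' k)) z) sums F (inv e' (\<chi> i. \<lfloor>(y $ i - z $ i) / \<eta>\<rfloor>))" for F :: "nat \<Rightarrow> real" and z
  proof -
    define k0 where "k0 = inv e' (\<chi> i. \<lfloor>(y $ i - z $ i) / \<eta>\<rfloor>)"
    have "z \<in> lattice_cell \<eta> y (e' k) \<longleftrightarrow> k = k0" for k
      by (simp add: lattice_cell_unique k0_def bij_inv_eq_iff[OF e'])
    then have "(\<lambda>k. F k * indicator (lattice_cell \<eta> y (e' k)) z) = (\<lambda>k. if k = k0 then F k else 0)"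
      by (auto simp: indicator_def)
    then show ?thesis using sums_single[of k0 F] by (simp add: k0_def)
  qed
  have f_sums: "(\<lambda>k. f k z) sums g z" for z
    using pt[of "\<lambda>_. g z" z] by (simp add: f_def mult.commute)
  have nf_sums: "(\<lambda>k. norm (f k z)) sums \<bar>g z\<bar>" for z
    using pt[of "\<lambda>_. \<bar>g z\<bar>" z] by (simp add: f_def mult.commute abs_mult)
  have "summable (\<lambda>k. \<integral>z. norm (f k z) \<partial>lborel)"
  proof (rule bounded_imp_summable)
    fix k
    have "(\<Sum>i\<le>k. \<integral>z. norm (f i z) \<partial>lborel) = (\<integral>z. (\<Sum>i\<le>k. norm (f i z)) \<partial>lborel)"
      using fi by (intro Bochner_Integration.integral_sum[symmetric] integrable_norm)
    also have "\<dots> \<le> (\<integral>z. \<bar>g z\<bar> \<partial>lborel)"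
    proof (rule integral_mono)
      fix z
      show "(\<Sum>i\<le>k. norm (f i z)) \<le> \<bar>g z\<bar>"
        using sum_le_suminf[OF sums_summable[OF nf_sums[of z]], of "{..k}"] sums_unique[OF nf_sums[of z]] by simp
    qed (use fi g in \<open>auto intro!: Bochner_Integration.integrable_sum integrable_norm\<close>)
    finally show "(\<Sum>i\<le>k. \<integral>z. norm (f i z) \<partial>lborel) \<le> (\<integral>z. \<bar>g z\<bar> \<partial>lborel)" .
  qed auto
  note nsum = this
  have "(\<lambda>k. integral\<^sup>L lborel (f k)) sums (\<integral>z. (\<Sum>k. f k z) \<partial>lborel)"
    by (rule sums_integral[OF fi _ nsum]) (use nf_sums in \<open>auto simp: sums_iff\<close>)
  moreover have "(\<Sum>k. f k z) = g z" for z using sums_unique[OF f_sums[of z]] by simp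
  ultimately have s: "(\<lambda>k. integral\<^sup>L lborel (f k)) sums (\<integral>z. g z \<partial>lborel)" by simp
  have "summable (\<lambda>k. norm (integral\<^sup>L lborel (f k)))"
    by (rule summable_comparison_test'[OF nsum, of 0]) (auto intro: integral_norm_bound)
  from norm_summable_imp_has_sum[OF this s]
  show ?thesis
    using has_sum_reindex_bij_betw[OF e', of "\<lambda>m. \<integral>z. indicator (lattice_cell \<eta> y m) z * g z \<partial>lborel"]
    by (simp add: f_def)
qed

lemma lattice_cell_near:
  fixes y :: "real^'n"
  assumes "\<eta> > 0" "z \<in> lattice_cell \<eta> y m"
  shows "norm ((y - \<eta> *\<^sub>R lattice_pt m) - z) \<le> real CARD('n) * \<eta>"
proof -
  have "norm ((y - \<eta> *\<^sub>R lattice_pt m) - z) \<le> (\<Sum>i\<in>UNIV. \<bar>((y - \<eta> *\<^sub>R lattice_pt m) - z) $ i\<bar>)" by (rule norm_le_l1_cart)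
  also have "\<dots> \<le> (\<Sum>i\<in>(UNIV::'n set). \<eta>)"
    using lattice_cell_bounds[OF assms] assms(1)
    by (intro sum_mono) (simp add: lattice_pt_def abs_le_iff algebra_simps, smt (verit))
  finally show ?thesis by simp
qed

text \<open>Across a cell of side at most \<open>1\<close> the weight varies by a bounded factor, so \<open>\<eta>\<^sup>n\<close> times the sum is
  dominated by the integral of the weight, whatever \<open>y\<close> and \<open>\<eta>\<close> are.\<close>

lemma lattice_sum_bound:
  assumes p: "p > real CARD('n)"
  obtains B where "B \<ge> 0"
    "\<And>\<eta> (y::real^'n). 0 < \<eta> \<Longrightarrow> \<eta> \<le> 1 \<Longrightarrow> (\<lambda>m. (1 + norm (y - \<eta> *\<^sub>R lattice_pt m)) powr (- p)) summable_on UNIV"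
    "\<And>\<eta> (y::real^'n). 0 < \<eta> \<Longrightarrow> \<eta> \<le> 1 \<Longrightarrow> \<eta> ^ CARD('n) * (\<Sum>\<^sub>\<infinity>m. (1 + norm (y - \<eta> *\<^sub>R lattice_pt m)) powr (- p)) \<le> B"
proof -
  let ?n = "real CARD('n)"
  let ?b = "\<lambda>z::real^'n. (1 + ?n) powr p * (1 + norm z) powr (- p)"
  define B where "B = (\<integral>z. ?b z \<partial>lborel)"
  have bi: "integrable lborel ?b" using integrable_norm_powr[OF p] by (rule integrable_mult_right)
  have *: "(\<lambda>m. (1 + norm (y - \<eta> *\<^sub>R lattice_pt m)) powr (- p)) summable_on UNIV \<and>
      \<eta> ^ CARD('n) * (\<Sum>\<^sub>\<infinity>m. (1 + norm (y - \<eta> *\<^sub>R lattice_pt m)) powr (- p)) \<le> B"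
    if \<eta>: "0 < \<eta>" "\<eta> \<le> 1" for \<eta> and y :: "real^'n"
  proof -
    let ?f = "\<lambda>m. \<eta> ^ CARD('n) * (1 + norm (y - \<eta> *\<^sub>R lattice_pt m)) powr (- p)"
    have hs: "((\<lambda>m. \<integral>z. indicator (lattice_cell \<eta> y m) z * ?b z \<partial>lborel) has_sum B) UNIV"
      unfolding B_def by (rule lattice_cells_has_sum[OF bi])
    have le: "?f m \<le> (\<integral>z. indicator (lattice_cell \<eta> y m) z * ?b z \<partial>lborel)" for m
    proof -
      let ?x = "y - \<eta> *\<^sub>R lattice_pt m"
      have "?f m = (\<integral>z. indicator (lattice_cell \<eta> y m) z * (1 + norm ?x) powr (- p) \<partial>lborel)"
        by (rule lattice_cell_integral_const(1)[OF \<eta>(1), symmetric])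
      also have "\<dots> \<le> (\<integral>z. indicator (lattice_cell \<eta> y m) z * ?b z \<partial>lborel)"
      proof (rule integral_mono)
        show "integrable lborel (\<lambda>z. indicator (lattice_cell \<eta> y m) z * ?b z)"
          using integrable_mult_indicator[OF _ bi, of "lattice_cell \<eta> y m"] by simp
        fix z
        show "indicator (lattice_cell \<eta> y m) z * (1 + norm ?x) powr (- p) \<le> indicator (lattice_cell \<eta> y m) z * ?b z"
        proof (cases "z \<in> lattice_cell \<eta> y m")
          case True
          have "norm z \<le> norm ?x + norm (?x - z)" by (metis norm_minus_commute norm_triangle_sub)
          also have "norm (?x - z) \<le> ?n * \<eta>" by (rule lattice_cell_near[OF \<eta>(1) True])
          also have "?n * \<eta> \<le> ?n" using \<eta> by (simp add: mult_left_le)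
          finally have "norm z \<le> norm ?x + ?n" by simp
          moreover have "0 \<le> ?n * norm ?x" by simp
          moreover have "(1 + ?n) * (1 + norm ?x) = 1 + norm ?x + ?n + ?n * norm ?x" by (simp add: algebra_simps)
          ultimately have "1 + norm z \<le> (1 + ?n) * (1 + norm ?x)" by argo
          then have "((1 + ?n) * (1 + norm ?x)) powr (- p) \<le> (1 + norm z) powr (- p)"
            using p by (intro powr_mono2') (auto intro: add_pos_nonneg)
          then have "(1 + ?n) powr p * (((1 + ?n) * (1 + norm ?x)) powr (- p)) \<le> ?b z" by (intro mult_left_mono) auto
          then have "(1 + norm ?x) powr (- p) \<le> ?b z"
            by (simp add: powr_mult powr_add[symmetric] mult.assoc[symmetric])
          then show ?thesis using True by simp
        qed simp
      qed (rule lattice_cell_integral_const(2)[OF \<eta>(1)])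
      finally show ?thesis .
    qed
    have sf: "?f summable_on UNIV"
      by (rule summable_on_comparison_test[OF has_sum_imp_summable[OF hs]]) (use le \<eta> in auto)
    have "(\<Sum>\<^sub>\<infinity>m. ?f m) \<le> B"
      by (rule has_sum_mono[OF has_sum_infsum[OF sf] hs]) (use le in auto)
    moreover have "(\<lambda>m. (1 / \<eta> ^ CARD('n)) * ?f m) summable_on UNIV" using sf by (rule summable_on_cmult_right)
    ultimately show ?thesis using \<eta> by (simp add: infsum_cmult_right')
  qed
  have "B \<ge> 0" unfolding B_def by (intro integral_nonneg_AE AE_I2) simp
  then show thesis using that * by blast
qed

lemma decays_lattice:
  fixes f :: "real^'n \<Rightarrow> real"
  assumes "decays p f" "p > real CARD('n)" "0 < \<eta>" "\<eta> \<le> 1"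
  shows "(\<lambda>m. \<bar>f (y - \<eta> *\<^sub>R lattice_pt m)\<bar>) summable_on UNIV"
proof -
  obtain C where C: "C \<ge> 0" "\<And>x. \<bar>f x\<bar> \<le> C * (1 + norm x) powr (- p)" using assms(1) by (auto simp: decays_def)
  obtain B where "\<And>\<eta> (y::real^'n). 0 < \<eta> \<Longrightarrow> \<eta> \<le> 1 \<Longrightarrow> (\<lambda>m. (1 + norm (y - \<eta> *\<^sub>R lattice_pt m)) powr (- p)) summable_on UNIV"
    using lattice_sum_bound[OF assms(2)] by metis
  then have "(\<lambda>m. C * (1 + norm (y - \<eta> *\<^sub>R lattice_pt m)) powr (- p)) summable_on UNIV"
    using assms by (intro summable_on_cmult_right)
  then show ?thesis by (rule summable_on_comparison_test) (use C in auto)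
qed

text \<open>Far out both values are small, and on a ball \<open>f\<close> is uniformly continuous. Lowering the exponent from
  \<open>p\<close> to \<open>q\<close> leaves room for the small factor \<open>e\<close> at large distances.\<close>

lemma decays_oscillation:
  fixes f :: "real^'n \<Rightarrow> real"
  assumes dec: "decays p f" and cont: "continuous_on UNIV f" and p: "q < p" "0 < q" and e: "e > 0"
  shows "\<exists>d>0. \<forall>w z. norm (w - z) \<le> d \<longrightarrow> \<bar>f w - f z\<bar> \<le> e * (1 + norm z) powr (- q)"
proof -
  obtain C where C: "C \<ge> 0" "\<And>x. \<bar>f x\<bar> \<le> C * (1 + norm x) powr (- p)" using dec by (auto simp: decays_def)
  define K where "K = C * (2 powr p + 1)"
  have K: "K \<ge> 0" using C by (simp add: K_def)
  \<comment> \<open>beyond \<open>R\<close> the spare power \<open>(1 + norm z) powr (p - q)\<close> exceeds \<open>K / e\<close>\<close>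
  define R where "R = (K / e) powr (1 / (p - q))"
  have R: "R \<ge> 0" by (simp add: R_def)
  have far: "\<bar>f w - f z\<bar> \<le> e * (1 + norm z) powr (- q)" if wz: "norm (w - z) \<le> 1 / 2" and z: "norm z \<ge> R" for w z
  proof -
    have "norm z \<le> norm w + norm (w - z)" by (metis norm_minus_commute norm_triangle_sub)
    then have "1 + norm z \<le> 2 * (1 + norm w)" using wz norm_ge_zero[of w] by argo
    then have "(1 + norm z) / 2 \<le> 1 + norm w" by simp
    then have "(1 + norm w) powr (- p) \<le> ((1 + norm z) / 2) powr (- p)"
      using p by (intro powr_mono2') (auto intro: add_pos_nonneg)
    also have "\<dots> = 2 powr p * (1 + norm z) powr (- p)" by (simp add: powr_divide powr_minus_divide)
    finally have "\<bar>f w\<bar> \<le> C * (2 powr p * (1 + norm z) powr (- p))"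
      using C by (meson mult_left_mono order_trans)
    then have "\<bar>f w - f z\<bar> \<le> K * (1 + norm z) powr (- p)"
      using C(2)[of z] by (simp add: K_def algebra_simps)
    also have "\<dots> = K * (1 + norm z) powr (- (p - q)) * (1 + norm z) powr (- q)"
      by (simp add: mult.assoc flip: powr_add)
    also have "K * (1 + norm z) powr (- (p - q)) \<le> e"
    proof -
      have "K / e = R powr (p - q)" using p K e by (simp add: R_def powr_powr)
      also have "\<dots> \<le> (1 + norm z) powr (p - q)" using z p R by (intro powr_mono2) auto
      finally have "K \<le> e * (1 + norm z) powr (p - q)" using e by (simp add: divide_le_eq mult.commute)
      then have "K / (1 + norm z) powr (p - q) \<le> e"
        by (subst divide_le_eq) (auto simp: add_nonneg_eq_0_iff)
      then show ?thesis by (simp only: powr_minus divide_inverse)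
    qed
    finally show ?thesis by (simp add: mult_right_mono)
  qed
  have "uniformly_continuous_on (cball 0 (R + 1)) f"
    using cont by (intro compact_uniformly_continuous) (auto intro: continuous_on_subset)
  moreover have e': "e * (1 + R) powr (- q) > 0" using e R by simp
  ultimately obtain d where d: "d > 0" "\<And>w z. w \<in> cball 0 (R + 1) \<Longrightarrow> z \<in> cball 0 (R + 1) \<Longrightarrow> dist w z < d \<Longrightarrow>
      dist (f w) (f z) < e * (1 + R) powr (- q)"
    unfolding uniformly_continuous_on_def by metis
  have "\<bar>f w - f z\<bar> \<le> e * (1 + norm z) powr (- q)" if wz: "norm (w - z) \<le> min (1 / 2) (d / 2)" for w z
  proof (cases "norm z \<ge> R")
    case False
    have "norm w \<le> norm z + norm (w - z)" by (rule norm_triangle_sub)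
    then have "dist (f w) (f z) < e * (1 + R) powr (- q)"
      using False wz d(1) by (intro d(2)) (auto simp: dist_norm)
    also have "\<dots> \<le> e * (1 + norm z) powr (- q)"
      using False e p by (intro mult_left_mono powr_mono2') (auto intro: add_pos_nonneg)
    finally show ?thesis by (simp add: dist_norm)
  qed (use far wz in auto)
  then show ?thesis using d(1) by (intro exI[of _ "min (1 / 2) (d / 2)"]) auto
qed

lemma has_sum_diff_real:
  fixes f g :: "'a \<Rightarrow> real"
  assumes "(f has_sum a) A" "(g has_sum b) A"
  shows "((\<lambda>x. f x - g x) has_sum (a - b)) A"
  using has_sum_add[OF assms(1), of "\<lambda>x. - g x" "- b"] assms(2) by (simp add: has_sum_uminus)

text \<open>On a small cell the value at the node differs from \<open>f\<close> by at most a small multiple of an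
  integrable weight. Summed over the cells, the error is that multiple of one fixed integral, for all positions \<open>y\<close>
  of the lattice.\<close>

lemma riemann_sum_uniform:
  fixes f :: "real^'n \<Rightarrow> real"
  assumes dec: "decays p f" and cont: "continuous_on UNIV f" and p: "p > real CARD('n)" and e: "e > 0"
  shows "\<exists>\<eta>\<^sub>0>0. \<eta>\<^sub>0 \<le> 1 \<and> (\<forall>\<eta> y. 0 < \<eta> \<longrightarrow> \<eta> \<le> \<eta>\<^sub>0 \<longrightarrow>
     \<bar>\<eta> ^ CARD('n) * (\<Sum>\<^sub>\<infinity>m. f (y - \<eta> *\<^sub>R lattice_pt m)) - (\<integral>z. f z \<partial>lborel)\<bar> \<le> e)"
proof -
  let ?n = "real CARD('n)"
  define q where "q = (p + ?n) / 2"
  have q: "q < p" "q > ?n" "q > 0" using p by (auto simp: q_def field_simps)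
  let ?b = "\<lambda>z::real^'n. (1 + norm z) powr (- q)"
  define I where "I = (\<integral>z. ?b z \<partial>lborel)"
  have bi: "integrable lborel ?b" by (rule integrable_norm_powr[OF q(2)])
  have I: "I \<ge> 0" unfolding I_def by (intro integral_nonneg_AE AE_I2) simp
  \<comment> \<open>the increment by \<open>1\<close> only keeps the denominator positive\<close>
  define e' where "e' = e / (I + 1)"
  have e': "e' > 0" "e' * I \<le> e" using e I by (auto simp: e'_def field_simps)
  obtain d where d: "d > 0" "\<And>w z. norm (w - z) \<le> d \<Longrightarrow> \<bar>f w - f z\<bar> \<le> e' * ?b z"
    using decays_oscillation[OF dec cont q(1,3) e'(1)] by blast
  have fi: "integrable lborel f"
    using decays_integrable[OF dec p borel_measurable_continuous_onI[OF cont]] .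
  \<comment> \<open>a cell of side \<open>\<eta>\<close> has diameter at most \<open>?n * \<eta>\<close>\<close>
  define \<eta>\<^sub>0 where "\<eta>\<^sub>0 = min 1 (d / ?n)"
  have "\<bar>\<eta> ^ CARD('n) * (\<Sum>\<^sub>\<infinity>m. f (y - \<eta> *\<^sub>R lattice_pt m)) - (\<integral>z. f z \<partial>lborel)\<bar> \<le> e" if \<eta>: "0 < \<eta>" "\<eta> \<le> \<eta>\<^sub>0" for \<eta> y
  proof -
    have \<eta>1: "\<eta> \<le> 1" "?n * \<eta> \<le> d" using \<eta>(2) by (auto simp: \<eta>\<^sub>0_def field_simps)
    let ?c = "lattice_cell \<eta> y"
    have sm: "(\<lambda>m. f (y - \<eta> *\<^sub>R lattice_pt m)) summable_on UNIV"
      using decays_lattice[OF dec p \<eta>(1) \<eta>1(1), of y]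
        abs_summable_summable[of "\<lambda>m. f (y - \<eta> *\<^sub>R lattice_pt m)" UNIV] by simp
    have h1: "((\<lambda>m. \<eta> ^ CARD('n) * f (y - \<eta> *\<^sub>R lattice_pt m)) has_sum
        \<eta> ^ CARD('n) * (\<Sum>\<^sub>\<infinity>m. f (y - \<eta> *\<^sub>R lattice_pt m))) UNIV"
      using has_sum_cmult_right[OF has_sum_infsum[OF sm]] .
    have h2: "((\<lambda>m. \<integral>z. indicator (?c m) z * f z \<partial>lborel) has_sum (\<integral>z. f z \<partial>lborel)) UNIV"
      by (rule lattice_cells_has_sum[OF fi])
    have h3: "((\<lambda>m. \<integral>z. indicator (?c m) z * (e' * ?b z) \<partial>lborel) has_sum (e' * I)) UNIV"
      using lattice_cells_has_sum[OF integrable_mult_right[OF bi, of e'], of \<eta> y] by (simp add: I_def)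
    have cellbd: "\<bar>\<eta> ^ CARD('n) * f (y - \<eta> *\<^sub>R lattice_pt m) - (\<integral>z. indicator (?c m) z * f z \<partial>lborel)\<bar>
        \<le> (\<integral>z. indicator (?c m) z * (e' * ?b z) \<partial>lborel)" for m
    proof -
      let ?x = "y - \<eta> *\<^sub>R lattice_pt m"
      have i1: "integrable lborel (\<lambda>z. indicator (?c m) z * f z)"
        using integrable_mult_indicator[OF _ fi, of "?c m"] by simp
      have i2: "integrable lborel (\<lambda>z. indicator (?c m) z * f ?x)" by (rule lattice_cell_integral_const(2)[OF \<eta>(1)])
      have i3: "integrable lborel (\<lambda>z. indicator (?c m) z * (e' * ?b z))"
        using integrable_mult_indicator[OF _ integrable_mult_right[OF bi, of e'], of "?c m"] by simp
      have "\<eta> ^ CARD('n) * f ?x - (\<integral>z. indicator (?c m) z * f z \<partial>lborel)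
          = (\<integral>z. indicator (?c m) z * f ?x - indicator (?c m) z * f z \<partial>lborel)"
        unfolding Bochner_Integration.integral_diff[OF i2 i1] lattice_cell_integral_const(1)[OF \<eta>(1)] ..
      also have "\<bar>\<dots>\<bar> \<le> (\<integral>z. indicator (?c m) z * (e' * ?b z) \<partial>lborel)"
      proof (rule integral_abs_bound_integral[OF _ i3])
        show "integrable lborel (\<lambda>z. indicator (?c m) z * f ?x - indicator (?c m) z * f z)" using i1 i2 by (intro Bochner_Integration.integrable_diff)
        fix z
        show "\<bar>indicator (?c m) z * f ?x - indicator (?c m) z * f z\<bar> \<le> indicator (?c m) z * (e' * ?b z)"
          using d(2)[of ?x z] lattice_cell_near[OF \<eta>(1), of z y m] \<eta>1(2) by (cases "z \<in> ?c m") auto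
      qed
      finally show ?thesis .
    qed
    have "\<eta> ^ CARD('n) * (\<Sum>\<^sub>\<infinity>m. f (y - \<eta> *\<^sub>R lattice_pt m)) - (\<integral>z. f z \<partial>lborel) \<le> e' * I"
      by (rule has_sum_mono[OF has_sum_diff_real[OF h1 h2] h3]) (use abs_le_D1[OF cellbd] in simp)
    moreover have "(\<integral>z. f z \<partial>lborel) - \<eta> ^ CARD('n) * (\<Sum>\<^sub>\<infinity>m. f (y - \<eta> *\<^sub>R lattice_pt m)) \<le> e' * I"
      by (rule has_sum_mono[OF has_sum_diff_real[OF h2 h1] h3]) (use abs_le_D2[OF cellbd] in simp)
    ultimately show ?thesis using e'(2) by linarith
  qed
  moreover have "\<eta>\<^sub>0 > 0" "\<eta>\<^sub>0 \<le> 1" using d(1) by (auto simp: \<eta>\<^sub>0_def)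
  ultimately show ?thesis by blast
qed

section \<open>Decay of intermediate derivatives\<close>

definition sign_vec :: "('n \<Rightarrow> bool) \<Rightarrow> 'n \<Rightarrow> real" where
  "sign_vec b i = (if b i then 1 else -1)"

lemma sign_vec_simps [simp]: "sign_vec b i * sign_vec b i = 1" "\<bar>sign_vec b i\<bar> = 1"
    "sign_vec b i * (sign_vec b i * t) = t"
  by (auto simp: sign_vec_def)

text \<open>The translate by \<open>R\<close> of the closed orthant with sign pattern \<open>b\<close>. A ray in one of its directions
  need not enter the orthant itself, but it stays in every translate that contains its origin.\<close>

definition orthant :: "('n \<Rightarrow> bool) \<Rightarrow> real \<Rightarrow> (real^'n) set" where
  "orthant b R = {x. \<forall>i. sign_vec b i * x $ i \<ge> - R}"

definition orthant_decays :: "('n \<Rightarrow> bool) \<Rightarrow> real \<Rightarrow> (real^'n \<Rightarrow> real) \<Rightarrow> bool" where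
  "orthant_decays b p f \<longleftrightarrow> (\<forall>R\<ge>0. \<exists>C\<ge>0. \<forall>x\<in>orthant b R. \<bar>f x\<bar> \<le> C * (1 + norm x) powr (- p))"

lemma orthant_step: "x \<in> orthant b R \<Longrightarrow> t \<ge> 0 \<Longrightarrow> x + (t * sign_vec b i) *\<^sub>R axis i 1 \<in> orthant b R"
  by (auto simp: orthant_def axis_def distrib_left mult.left_commute intro: add_increasing2 add_nonneg_nonneg)

lemma norm_le_R_orthant: "norm x \<le> R \<Longrightarrow> x \<in> orthant b R"
  using component_le_norm_cart[of x] by (auto simp: orthant_def sign_vec_def) (smt (verit))+

text \<open>Along an outward ray the distance from the origin grows at a linear rate, in all translates of
  the orthant.\<close>

lemma orthant_ray_norm:
  fixes x :: "real^'n"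
  assumes x: "x \<in> orthant b R" and R: "R \<ge> 0" and t: "t \<ge> 0"
  shows "1 + norm x + t \<le> (1 + real CARD('n) + 2 * R) * (1 + norm (x + (t * sign_vec b i) *\<^sub>R axis i 1))"
proof -
  let ?z = "x + (t * sign_vec b i) *\<^sub>R axis i 1"
  let ?n = "real CARD('n)"
  have zi: "sign_vec b i * ?z $ i = sign_vec b i * x $ i + t" by (simp add: distrib_left mult.left_commute)
  have "sign_vec b i * ?z $ i \<le> \<bar>?z $ i\<bar>" by (auto simp: sign_vec_def)
  then have zi': "sign_vec b i * x $ i + t \<le> norm ?z" using component_le_norm_cart[of ?z i] zi by linarith
  have xi: "sign_vec b i * x $ i \<ge> - R" using x by (auto simp: orthant_def)
  then have t_le: "t \<le> norm ?z + R" using zi' by argo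
  have "\<bar>x $ j\<bar> \<le> norm ?z + (if j = i then R else 0)" for j
  proof (cases "j = i")
    case True
    have "\<bar>x $ i\<bar> = \<bar>sign_vec b i * x $ i\<bar>" by (simp add: abs_mult)
    also have "\<dots> \<le> norm ?z + R" using zi' xi t R norm_ge_zero[of ?z] unfolding abs_le_iff by argo
    finally show ?thesis using True by simp
  next
    case False
    then show ?thesis using component_le_norm_cart[of ?z j] by (simp add: axis_def)
  qed
  then have "norm x \<le> (\<Sum>j\<in>UNIV. norm ?z + (if j = i then R else 0))"
    by (intro order_trans[OF norm_le_l1_cart sum_mono]) auto
  also have "\<dots> = ?n * norm ?z + R" by (simp add: sum.distrib)
  finally have "1 + norm x + t \<le> 1 + ?n * norm ?z + norm ?z + 2 * R" using t_le by argo
  also have "\<dots> \<le> (1 + ?n + 2 * R) * (1 + norm ?z)" using R by (simp add: algebra_simps)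
  finally show ?thesis .
qed

lemma ray_powr_integral:
  assumes p: "p > 1" and s: "s > (0::real)"
  shows "integrable lborel (\<lambda>t. indicator {0..} t * (s + t) powr (- p))"
    and "(\<integral>t. indicator {0..} t * (s + t) powr (- p) \<partial>lborel) = s powr (- (p - 1)) / (p - 1)"
proof -
  define F where "F = (\<lambda>t. - ((s + t) powr (1 - p) / (p - 1)))"
  have nn: "(\<integral>\<^sup>+t. ennreal ((s + t) powr (- p)) * indicator {0..} t \<partial>lborel) = ennreal (0 - F 0)"
  proof (rule nn_integral_FTC_atLeast)
    show "(F has_real_derivative (s + t) powr (- p)) (at t)" if "0 \<le> t" for t
    proof -
      have "((\<lambda>z. z powr (1 - p)) has_real_derivative (1 - p) * (s + t) powr (1 - p - 1)) (at (s + t))"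
        using that s by (intro has_real_derivative_powr) auto
      moreover have "((\<lambda>x. s + x) has_real_derivative 1) (at t)" by (auto intro!: derivative_eq_intros)
      ultimately have "((\<lambda>t. (s + t) powr (1 - p)) has_real_derivative (1 - p) * (s + t) powr (1 - p - 1) * 1) (at t)"
        by (rule DERIV_chain2)
      then have "((\<lambda>t. (s + t) powr (1 - p)) has_real_derivative (1 - p) * (s + t) powr (- p)) (at t)" by simp
      from DERIV_minus[OF DERIV_cdivide[OF this, of "p - 1"]]
      have "(F has_real_derivative - ((1 - p) * (s + t) powr (- p) / (p - 1))) (at t)"
        unfolding F_def .
      moreover have "- ((1 - p) * (s + t) powr (- p) / (p - 1)) = (s + t) powr (- p)"
        using p by (simp add: field_simps)
      ultimately show ?thesis by simp
    qed
    have "filterlim (\<lambda>t. s + t) at_top at_top" by (intro filterlim_tendsto_add_at_top[OF tendsto_const] filterlim_ident)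
    then have "((\<lambda>t. (s + t) powr (1 - p)) \<longlongrightarrow> 0) at_top" using p by (intro tendsto_neg_powr) auto
    from tendsto_minus[OF tendsto_divide_zero[OF this, of "p - 1"]]
    show "(F \<longlongrightarrow> 0) at_top" unfolding F_def by simp
  qed auto
  have eq: "(\<integral>\<^sup>+t. ennreal (indicator {0..} t * (s + t) powr (- p)) \<partial>lborel) = ennreal (s powr (- (p - 1)) / (p - 1))"
    using nn by (simp add: F_def mult.commute ennreal_mult'' ennreal_indicator)
  show "integrable lborel (\<lambda>t. indicator {0..} t * (s + t) powr (- p))"
    by (rule integrableI_nonneg) (use eq in auto)
  show "(\<integral>t. indicator {0..} t * (s + t) powr (- p) \<partial>lborel) = s powr (- (p - 1)) / (p - 1)"
    using eq p by (subst integral_eq_nn_integral) auto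
qed

text \<open>The antiderivative in direction \<open>i\<close> that vanishes at infinity on the side selected by \<open>b\<close>.\<close>

definition ray_integral :: "('n \<Rightarrow> bool) \<Rightarrow> 'n \<Rightarrow> (real^'n \<Rightarrow> real) \<Rightarrow> real^'n \<Rightarrow> real" where
  "ray_integral b i f x = - sign_vec b i * (\<integral>t. indicator {0..} t * f (x + (t * sign_vec b i) *\<^sub>R axis i 1) \<partial>lborel)"

context
  fixes b :: "'n::finite \<Rightarrow> bool" and i :: 'n and f :: "real^'n \<Rightarrow> real" and p :: real
  assumes cont: "continuous_on UNIV f" and dec: "orthant_decays b p f" and p: "p > 1"
begin

lemma ray_bound:
  assumes R: "R \<ge> 0"
  obtains C where "C \<ge> 0" "\<And>x t. x \<in> orthant b R \<Longrightarrow>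
      \<bar>indicator {0..} t * f (x + (t * sign_vec b i) *\<^sub>R axis i 1)\<bar> \<le> C * (indicator {0..} t * ((1 + norm x) + t) powr (- p))"
proof -
  let ?K = "1 + real CARD('n) + 2 * R"
  obtain C where C: "C \<ge> 0" "\<And>x. x \<in> orthant b R \<Longrightarrow> \<bar>f x\<bar> \<le> C * (1 + norm x) powr (- p)"
    using dec R by (auto simp: orthant_decays_def)
  have "\<bar>indicator {0..} t * f (x + (t * sign_vec b i) *\<^sub>R axis i 1)\<bar> \<le> (C * ?K powr p) * (indicator {0..} t * ((1 + norm x) + t) powr (- p))"
    if x: "x \<in> orthant b R" for x t
  proof (cases "t \<ge> 0")
    case True
    let ?z = "x + (t * sign_vec b i) *\<^sub>R axis i 1"
    have K: "?K > 0" using R by (simp add: add_pos_nonneg)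
    have "(?K * (1 + norm ?z)) powr (- p) \<le> (1 + norm x + t) powr (- p)"
      using orthant_ray_norm[OF x R True, of i] p True by (intro powr_mono2') (auto intro!: add_pos_nonneg)
    then have "?K powr p * (?K * (1 + norm ?z)) powr (- p) \<le> ?K powr p * (1 + norm x + t) powr (- p)" by (intro mult_left_mono) auto
    then have "(1 + norm ?z) powr (- p) \<le> ?K powr p * (1 + norm x + t) powr (- p)"
      using K by (simp add: powr_mult powr_add[symmetric] mult.assoc[symmetric])
    then have "C * (1 + norm ?z) powr (- p) \<le> C * (?K powr p * (1 + norm x + t) powr (- p))" using C(1) by (rule mult_left_mono)
    then show ?thesis using C(2)[OF orthant_step[OF x True, of i]] True by (simp add: mult.assoc)
  qed simp
  then show thesis using that[of "C * ?K powr p"] C(1) by simp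
qed

lemma ray_measurable: "(\<lambda>t. indicator {0..} t * f (x + (t * sign_vec b i) *\<^sub>R axis i 1)) \<in> borel_measurable lborel"
proof -
  have "continuous_on UNIV (\<lambda>t. f (x + (t * sign_vec b i) *\<^sub>R axis i 1))"
    by (intro continuous_on_compose2[OF cont] continuous_intros) auto
  then have "(\<lambda>t. f (x + (t * sign_vec b i) *\<^sub>R axis i 1)) \<in> borel_measurable borel" by (rule borel_measurable_continuous_onI)
  then show ?thesis by simp
qed

lemma ray_integrable: "integrable lborel (\<lambda>t. indicator {0..} t * f (x + (t * sign_vec b i) *\<^sub>R axis i 1))"
proof -
  obtain C where C: "C \<ge> 0" "\<And>x' t. x' \<in> orthant b (norm x) \<Longrightarrow>
      \<bar>indicator {0..} t * f (x' + (t * sign_vec b i) *\<^sub>R axis i 1)\<bar> \<le> C * (indicator {0..} t * ((1 + norm x') + t) powr (- p))"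
    using ray_bound[of "norm x"] by auto
  have "integrable lborel (\<lambda>t. C * (indicator {0..} t * ((1 + norm x) + t) powr (- p)))"
    by (intro integrable_mult_right ray_powr_integral(1) p) (simp add: add_pos_nonneg)
  then show ?thesis
    by (rule Bochner_Integration.integrable_bound)
      (use ray_measurable C(2)[OF norm_le_R_orthant] in \<open>auto intro!: AE_I2 intro: order_trans[OF _ abs_ge_self]\<close>)
qed

lemma ray_integral_decays: "orthant_decays b (p - 1) (ray_integral b i f)"
  unfolding orthant_decays_def
proof (intro allI impI)
  fix R :: real assume R: "R \<ge> 0"
  obtain C where C: "C \<ge> 0" "\<And>x t. x \<in> orthant b R \<Longrightarrow>
      \<bar>indicator {0..} t * f (x + (t * sign_vec b i) *\<^sub>R axis i 1)\<bar> \<le> C * (indicator {0..} t * ((1 + norm x) + t) powr (- p))"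
    using ray_bound[OF R] by auto
  have "\<bar>ray_integral b i f x\<bar> \<le> (C / (p - 1)) * (1 + norm x) powr (- (p - 1))" if x: "x \<in> orthant b R" for x
  proof -
    have s: "1 + norm x > 0" by (simp add: add_pos_nonneg)
    have "\<bar>ray_integral b i f x\<bar> = \<bar>\<integral>t. indicator {0..} t * f (x + (t * sign_vec b i) *\<^sub>R axis i 1) \<partial>lborel\<bar>"
      by (simp add: ray_integral_def abs_mult)
    also have "\<dots> \<le> (\<integral>t. C * (indicator {0..} t * ((1 + norm x) + t) powr (- p)) \<partial>lborel)"
      by (rule integral_abs_bound_integral[OF ray_integrable integrable_mult_right[OF ray_powr_integral(1)[OF p s]]]) (use C(2)[OF x] in auto)
    also have "\<dots> = C * ((1 + norm x) powr (- (p - 1)) / (p - 1))"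
      by (simp only: integral_mult_right_zero ray_powr_integral(2)[OF p s])
    finally show ?thesis by simp
  qed
  then show "\<exists>C\<ge>0. \<forall>x\<in>orthant b R. \<bar>ray_integral b i f x\<bar> \<le> C * (1 + norm x) powr (- (p - 1))"
    using C(1) p by (intro exI[of _ "C / (p - 1)"]) auto
qed

lemma ray_integral_continuous: "continuous_on UNIV (ray_integral b i f)"
  unfolding continuous_on_sequentially comp_def
proof (intro allI ballI impI)
  fix u :: "nat \<Rightarrow> real^'n" and x assume u: "(\<forall>n. u n \<in> UNIV) \<and> u \<longlonglongrightarrow> x"
  obtain R where R: "R > 0" "\<And>k. norm (u k) \<le> R"
    using convergent_imp_bounded u by (metis bounded_pos rangeI)
  obtain C where C: "C \<ge> 0" "\<And>x t. x \<in> orthant b R \<Longrightarrow>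
      \<bar>indicator {0..} t * f (x + (t * sign_vec b i) *\<^sub>R axis i 1)\<bar> \<le> C * (indicator {0..} t * ((1 + norm x) + t) powr (- p))"
    using ray_bound[of R] R by auto
  have "(\<lambda>k. \<integral>t. indicator {0..} t * f (u k + (t * sign_vec b i) *\<^sub>R axis i 1) \<partial>lborel) \<longlonglongrightarrow>
      (\<integral>t. indicator {0..} t * f (x + (t * sign_vec b i) *\<^sub>R axis i 1) \<partial>lborel)"
  proof (rule integral_dominated_convergence[OF ray_measurable ray_measurable])
    show "integrable lborel (\<lambda>t. C * (indicator {0..} t * (1 + t) powr (- p)))"
      by (intro integrable_mult_right ray_powr_integral(1) p) simp
    show "AE t in lborel. (\<lambda>k. indicator {0..} t * f (u k + (t * sign_vec b i) *\<^sub>R axis i 1)) \<longlonglongrightarrow>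
        indicator {0..} t * f (x + (t * sign_vec b i) *\<^sub>R axis i 1)"
      using u cont by (intro AE_I2 tendsto_mult_left) (auto simp: continuous_on_eq_continuous_at intro!: isCont_tendsto_compose[of _ f] tendsto_intros)
    show "AE t in lborel. norm (indicator {0..} t * f (u k + (t * sign_vec b i) *\<^sub>R axis i 1)) \<le> C * (indicator {0..} t * (1 + t) powr (- p))" for k
    proof (intro AE_I2)
      fix t :: real
      have "indicator {0..} t * ((1 + norm (u k)) + t) powr (- p) \<le> indicator {0..} t * (1 + t) powr (- p)"
        using p by (cases "t \<ge> 0") (auto intro!: powr_mono2')
      then have "C * (indicator {0..} t * ((1 + norm (u k)) + t) powr (- p)) \<le> C * (indicator {0..} t * (1 + t) powr (- p))"
        using C(1) by (rule mult_left_mono)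
      then show "norm (indicator {0..} t * f (u k + (t * sign_vec b i) *\<^sub>R axis i 1)) \<le> C * (indicator {0..} t * (1 + t) powr (- p))"
        using C(2)[OF norm_le_R_orthant[OF R(2)], of t k] by simp
    qed
  qed
  then show "(\<lambda>k. ray_integral b i f (u k)) \<longlonglongrightarrow> ray_integral b i f x"
    unfolding ray_integral_def by (rule tendsto_mult_left)
qed

lemma has_partial_ray_integral: "has_partial i (ray_integral b i f) f"
  unfolding has_partial_def
proof
  fix x
  let ?\<sigma> = "sign_vec b i" and ?e = "axis i 1 :: real^'n"
  define \<psi> where "\<psi> = (\<lambda>r. f (x + (r * ?\<sigma>) *\<^sub>R ?e))"
  \<comment> \<open>moving the origin of the ray is moving the lower limit of a one-dimensional integral\<close>
  define A where "A = (\<lambda>a. \<integral>r. indicator {a..} r * \<psi> r \<partial>lborel)"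
  have shift: "indicator {a..} (a + 1 * t) * \<psi> (a + 1 * t) = indicator {0..} t * f ((x + (a * ?\<sigma>) *\<^sub>R ?e) + (t * ?\<sigma>) *\<^sub>R ?e)" for a t :: real
    by (auto simp: \<psi>_def indicator_def algebra_simps)
  have Aint: "integrable lborel (\<lambda>r. indicator {a..} r * \<psi> r)" for a
    using ray_integrable[of "x + (a * ?\<sigma>) *\<^sub>R ?e"]
      lborel_integrable_real_affine_iff[of 1 "\<lambda>r. indicator {a..} r * \<psi> r" a] unfolding shift by simp
  have A_eq: "A a = (\<integral>t. indicator {0..} t * f ((x + (a * ?\<sigma>) *\<^sub>R ?e) + (t * ?\<sigma>) *\<^sub>R ?e) \<partial>lborel)" for a
    unfolding A_def using lborel_integral_real_affine[of 1 "\<lambda>r. indicator {a..} r * \<psi> r" a] unfolding shift by simp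
  have \<psi>_cont: "continuous_on S \<psi>" for S
    unfolding \<psi>_def by (intro continuous_on_compose2[OF cont] continuous_intros) auto
  have diff: "A a = A (-1) - integral {-1..a} \<psi>" if a: "a \<in> {-1<..<1}" for a
  proof -
    have "A (-1) - A a = (\<integral>r. indicator {-1..<a} r * \<psi> r \<partial>lborel)"
      unfolding A_def Bochner_Integration.integral_diff[OF Aint Aint, symmetric]
      by (rule Bochner_Integration.integral_cong) (use a in \<open>auto simp: indicator_def\<close>)
    also have "\<dots> = (LINT r:{-1..<a}|lborel. \<psi> r)" by (simp add: set_lebesgue_integral_def)
    also have "\<dots> = integral {-1..<a} \<psi>"
    proof (rule set_borel_integral_eq_integral(2))
      have "set_integrable lborel {-1..} \<psi>" using Aint[of "-1"] by (simp add: set_integrable_def)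
      then show "set_integrable lborel {-1..<a} \<psi>" by (rule set_integrable_subset) auto
    qed
    also have "\<dots> = integral {-1..a} \<psi>"
      by (rule integral_spike_set) (auto intro: negligible_subset[of "{a}"])
    finally show ?thesis by simp
  qed
  have "((\<lambda>a. integral {-1..a} \<psi>) has_real_derivative \<psi> 0) (at 0 within {-1..1})"
    by (rule integral_has_real_derivative) (auto intro: \<psi>_cont)
  then have "((\<lambda>a. integral {-1..a} \<psi>) has_real_derivative \<psi> 0) (at 0)"
    by (simp add: at_within_Icc_at)
  then have "((\<lambda>a. A (-1) - integral {-1..a} \<psi>) has_real_derivative - \<psi> 0) (at 0)"
    by (auto intro!: derivative_eq_intros)
  then have A': "(A has_real_derivative - \<psi> 0) (at (0 * ?\<sigma>))"
    unfolding mult_zero_left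
    by (rule has_field_derivative_transform_within_open[where S = "{-1<..<1}"]) (auto simp: diff)
  have "((\<lambda>s. - ?\<sigma> * A (s * ?\<sigma>)) has_real_derivative - ?\<sigma> * (- \<psi> 0 * ?\<sigma>)) (at 0)"
    by (intro DERIV_cmult DERIV_chain2[where f = A and g = "\<lambda>s. s * ?\<sigma>" and x = 0, OF A'])
      (auto intro!: derivative_eq_intros)
  moreover have "- ?\<sigma> * A (s * ?\<sigma>) = ray_integral b i f (x + s *\<^sub>R ?e)" for s
    unfolding A_eq ray_integral_def by (simp add: mult.assoc)
  moreover have "- ?\<sigma> * (- \<psi> 0 * ?\<sigma>) = f x" by (simp add: \<psi>_def mult.commute)
  ultimately show "((\<lambda>s. ray_integral b i f (x + s *\<^sub>R ?e)) has_real_derivative f x) (at 0)" by simp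
qed

end

text \<open>Iterated differentiation in which each function on the way satisfies \<open>Q k\<close>, where \<open>k\<close> counts the
  derivatives still to be taken.\<close>

primrec partial_chain ::
  "(nat \<Rightarrow> (real^'n \<Rightarrow> real) \<Rightarrow> bool) \<Rightarrow> 'n list \<Rightarrow> (real^'n \<Rightarrow> real) \<Rightarrow> (real^'n \<Rightarrow> real) \<Rightarrow> bool" where
  "partial_chain Q [] f g \<longleftrightarrow> g = f \<and> Q 0 f"
| "partial_chain Q (i # is) f g \<longleftrightarrow>
     Q (Suc (length is)) f \<and> (\<exists>f'. has_partial i f f' \<and> partial_chain Q is f' g)"

lemma partial_chain_head: "partial_chain Q is f g \<Longrightarrow> Q (length is) f"
  by (cases "is") auto

lemma partial_chain_iterated: "partial_chain Q is f g \<Longrightarrow> iterated_partial is f g"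
proof (induction "is" arbitrary: f)
  case (Cons i "is")
  then show ?case unfolding iterated_partial_Cons by auto
qed simp

lemma partial_chain_mono:
  "partial_chain Q is f g \<Longrightarrow> (\<And>k f. k \<le> length is \<Longrightarrow> Q k f \<Longrightarrow> Q' k f) \<Longrightarrow> partial_chain Q' is f g"
proof (induction "is" arbitrary: f)
  case (Cons i "is")
  obtain f' where f': "has_partial i f f'" "partial_chain Q is f' g" using Cons.prems(1) by auto
  have "partial_chain Q' is f' g" using Cons.IH[OF f'(2)] Cons.prems(2) by simp
  then show ?case using f' Cons.prems by auto
qed simp

lemma partial_chain_all:
  assumes "\<And>b. partial_chain (Q b) is f g"
  shows "partial_chain (\<lambda>k f. \<forall>b. Q b k f) is f g"
  using assms
proof (induction "is" arbitrary: f)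
  case (Cons i "is")
  obtain f' where f': "has_partial i f f'" using Cons.prems[of undefined] by auto
  have "partial_chain (Q b) is f' g" for b using Cons.prems[of b] has_partial_unique[OF f'] by auto
  then have "partial_chain (\<lambda>k f. \<forall>b. Q b k f) is f' g" by (rule Cons.IH)
  then show ?case using f' Cons.prems by auto
qed simp

lemma iterated_partial_diff:
  "iterated_partial is f g \<Longrightarrow> iterated_partial is F G \<Longrightarrow> iterated_partial is (\<lambda>x. f x - F x) (\<lambda>x. g x - G x)"
proof (induction "is" arbitrary: f F)
  case (Cons i "is")
  obtain f' F' where "has_partial i f f'" "iterated_partial is f' g" "has_partial i F F'" "iterated_partial is F' G"
    using Cons.prems unfolding iterated_partial_Cons by blast
  then show ?case unfolding iterated_partial_Cons using Cons.IH has_partial_diff by blast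
qed simp

text \<open>One integration from infinity for each entry of the list; each costs one power of decay.\<close>

lemma exists_orthant_chain:
  fixes g :: "real^'n \<Rightarrow> real"
  assumes "continuous_on UNIV g" "orthant_decays b p g" "p > real (length is)"
  shows "\<exists>F. partial_chain (\<lambda>k f. continuous_on UNIV f \<and> orthant_decays b (p - real k) f) is F g"
  using assms(3)
proof (induction "is")
  case Nil
  then show ?case using assms by simp
next
  case (Cons i "is")
  then obtain F where F: "partial_chain (\<lambda>k f. continuous_on UNIV f \<and> orthant_decays b (p - real k) f) is F g"
    by auto
  have h: "continuous_on UNIV F" "orthant_decays b (p - real (length is)) F" "p - real (length is) > 1"
    using partial_chain_head[OF F] Cons.prems by auto
  have "orthant_decays b (p - real (length is) - 1) (ray_integral b i F)" by (rule ray_integral_decays[OF h])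
  moreover have "p - real (length is) - 1 = p - real (Suc (length is))" by simp
  ultimately show ?case
    using F has_partial_ray_integral[OF h] ray_integral_continuous[OF h]
    by (intro exI[of _ "ray_integral b i F"]) auto
qed

text \<open>The iterated difference is an alternating sum of values of \<open>W\<close>, and all of them except the one at
  \<open>x\<close> are taken in \<open>S\<close>.\<close>

lemma iterated_diff_expand_bound:
  fixes W :: "real^'n \<Rightarrow> real"
  assumes S: "\<And>y i. y \<in> S \<Longrightarrow> y + \<tau> i *\<^sub>R axis i 1 \<in> S" "\<And>i. x + \<tau> i *\<^sub>R axis i 1 \<in> S"
    and W: "\<And>y. y \<in> S \<Longrightarrow> \<bar>W y\<bar> \<le> \<epsilon>"
  shows "\<bar>iterated_diff \<tau> is W x - (-1) ^ length is * W x\<bar> \<le> 2 ^ length is * \<epsilon>"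
proof -
  have in_S: "\<bar>iterated_diff \<tau> is W y\<bar> \<le> 2 ^ length is * \<epsilon>" if "y \<in> S" for y "is"
    using that
  proof (induction "is" arbitrary: y)
    case (Cons i "is")
    have "\<bar>iterated_diff \<tau> (i # is) W y\<bar> \<le> \<bar>iterated_diff \<tau> is W (y + \<tau> i *\<^sub>R axis i 1)\<bar> + \<bar>iterated_diff \<tau> is W y\<bar>"
      by simp
    then show ?case using Cons.IH[OF Cons.prems] Cons.IH[OF S(1)[OF Cons.prems, of i]] by simp
  qed (use W in simp)
  have "\<epsilon> \<ge> 0" using W[OF S(2)] by (meson abs_ge_zero order_trans)
  then show ?thesis
  proof (induction "is")
    case (Cons i "is")
    then show ?case using in_S[OF S(2)[of i], of "is"] Cons.IH by simp
  qed simp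
qed

text \<open>By the mean value theorem all iterated differences of \<open>W\<close> vanish. When the steps grow in the
  directions of the orthant, each term except \<open>\<plusminus> W x\<close> is evaluated far out, where \<open>W\<close> is small.\<close>

lemma orthant_decays_zero:
  fixes W :: "real^'n \<Rightarrow> real"
  assumes dec: "orthant_decays b q W" and q: "q > 0" and ip: "iterated_partial is W (\<lambda>_. 0)"
  shows "W x = 0"
proof -
  define l where "l = length is"
  have "\<bar>W x\<bar> \<le> 0 + e" if e: "e > 0" for e
  proof -
    define \<epsilon> where "\<epsilon> = e / 2 ^ l"
    have \<epsilon>: "\<epsilon> > 0" using e by (simp add: \<epsilon>_def)
    obtain C where C: "C \<ge> 0" "\<And>z. z \<in> orthant b (norm x) \<Longrightarrow> \<bar>W z\<bar> \<le> C * (1 + norm z) powr (- q)"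
      using dec norm_ge_zero[of x] unfolding orthant_decays_def by blast
    define r where "r = (C / \<epsilon>) powr (1 / q)"
    have r: "r \<ge> 0" "C = \<epsilon> * r powr q" using C(1) \<epsilon> q by (auto simp: r_def powr_powr)
    \<comment> \<open>\<open>r\<close> is the distance beyond which \<open>W\<close> is below \<open>\<epsilon>\<close>; a step of length \<open>s\<close> from \<open>x\<close> leads that far\<close>
    define s where "s = norm x + r"
    have s: "s \<ge> 0" using r by (simp add: s_def)
    \<comment> \<open>far out in the translated orthant; closed under further steps\<close>
    define S where "S = {z \<in> orthant b (norm x). \<exists>j. sign_vec b j * z $ j \<ge> r}"
    let ?\<tau> = "\<lambda>i. s * sign_vec b i"
    have x: "x \<in> orthant b (norm x)" by (rule norm_le_R_orthant) simp
    have "iterated_diff ?\<tau> is W x = 0" using iterated_diff_mvt[OF ip, of x ?\<tau>] by auto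
    moreover have "\<bar>iterated_diff ?\<tau> is W x - (-1) ^ length is * W x\<bar> \<le> 2 ^ length is * \<epsilon>"
    proof (rule iterated_diff_expand_bound[where S = S])
      show "y + ?\<tau> i *\<^sub>R axis i 1 \<in> S" if y: "y \<in> S" for y i
      proof -
        obtain j where j: "sign_vec b j * y $ j \<ge> r" using y by (auto simp: S_def)
        have "sign_vec b j * (y + ?\<tau> i *\<^sub>R axis i 1) $ j \<ge> r"
          using j s by (auto simp: axis_def distrib_left mult.left_commute)
        then show ?thesis using y orthant_step[OF _ s] by (auto simp: S_def)
      qed
      show "x + ?\<tau> i *\<^sub>R axis i 1 \<in> S" for i
      proof -
        have "sign_vec b i * x $ i \<ge> - norm x" using x by (auto simp: orthant_def)
        moreover have "sign_vec b i * (x + ?\<tau> i *\<^sub>R axis i 1) $ i = sign_vec b i * x $ i + s"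
          by (simp add: distrib_left mult.left_commute)
        ultimately have "sign_vec b i * (x + ?\<tau> i *\<^sub>R axis i 1) $ i \<ge> r"
          unfolding s_def by argo
        then show ?thesis unfolding S_def using orthant_step[OF x s] by blast
      qed
      show "\<bar>W y\<bar> \<le> \<epsilon>" if y: "y \<in> S" for y
      proof -
        obtain j where j: "sign_vec b j * y $ j \<ge> r" using y by (auto simp: S_def)
        have "sign_vec b j * y $ j \<le> \<bar>y $ j\<bar>" by (auto simp: sign_vec_def)
        then have ny: "r \<le> norm y" using j component_le_norm_cart[of y j] by linarith
        have "\<bar>W y\<bar> \<le> C * (1 + norm y) powr (- q)" using C(2) y by (auto simp: S_def)
        also have "\<dots> = \<epsilon> * (r powr q / (1 + norm y) powr q)" by (simp add: r(2) powr_minus divide_inverse)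
        also have "\<dots> \<le> \<epsilon> * 1"
        proof (intro mult_left_mono)
          have "r powr q \<le> (1 + norm y) powr q" using ny r q by (intro powr_mono2) auto
          moreover have "0 < (1 + norm y) powr q" using norm_ge_zero[of y] by (simp add: add_nonneg_eq_0_iff)
          ultimately show "r powr q / (1 + norm y) powr q \<le> 1" by simp
        qed (use \<epsilon> in simp)
        finally show ?thesis by simp
      qed
    qed
    ultimately show ?thesis by (simp add: abs_mult \<epsilon>_def l_def)
  qed
  then show ?thesis using field_le_epsilon[of "\<bar>W x\<bar>" 0] by simp
qed

lemma decays_imp_orthant_decays: "decays p f \<Longrightarrow> orthant_decays b p f"
  by (auto simp: decays_def orthant_decays_def)

lemma orthant_decays_mono:
  assumes "orthant_decays b p f" "q \<le> p"
  shows "orthant_decays b q f"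
  unfolding orthant_decays_def
proof (intro allI impI)
  fix R :: real assume "R \<ge> 0"
  then obtain C where C: "C \<ge> 0" "\<And>x. x \<in> orthant b R \<Longrightarrow> \<bar>f x\<bar> \<le> C * (1 + norm x) powr (- p)"
    using assms(1) by (auto simp: orthant_decays_def)
  have "C * (1 + norm x) powr (- p) \<le> C * (1 + norm x) powr (- q)" for x
    using C(1) assms(2) by (intro mult_left_mono powr_mono) auto
  then show "\<exists>C\<ge>0. \<forall>x\<in>orthant b R. \<bar>f x\<bar> \<le> C * (1 + norm x) powr (- q)" using C order_trans by blast
qed

lemma orthant_decays_diff:
  assumes "orthant_decays b p f" "orthant_decays b p g"
  shows "orthant_decays b p (\<lambda>x. f x - g x)"
  unfolding orthant_decays_def
proof (intro allI impI)
  fix R :: real assume R: "R \<ge> 0"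
  obtain C where C: "C \<ge> 0" "\<And>x. x \<in> orthant b R \<Longrightarrow> \<bar>f x\<bar> \<le> C * (1 + norm x) powr (- p)"
    using assms(1) R by (auto simp: orthant_decays_def)
  obtain D where D: "D \<ge> 0" "\<And>x. x \<in> orthant b R \<Longrightarrow> \<bar>g x\<bar> \<le> D * (1 + norm x) powr (- p)"
    using assms(2) R by (auto simp: orthant_decays_def)
  have "\<bar>f x - g x\<bar> \<le> (C + D) * (1 + norm x) powr (- p)" if "x \<in> orthant b R" for x
    using C(2)[OF that] D(2)[OF that] by (simp add: distrib_right)
  then show "\<exists>C\<ge>0. \<forall>x\<in>orthant b R. \<bar>f x - g x\<bar> \<le> C * (1 + norm x) powr (- p)"
    using C(1) D(1) by (intro exI[of _ "C + D"]) auto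
qed

lemma all_orthants_decays:
  fixes f :: "real^'n \<Rightarrow> real"
  assumes "\<And>b. orthant_decays b p f"
  shows "decays p f"
proof -
  have "\<forall>b. \<exists>C\<ge>0. \<forall>x\<in>orthant b 0. \<bar>f x\<bar> \<le> C * (1 + norm x) powr (- p)"
    using assms by (auto simp: orthant_decays_def)
  then obtain C where C: "\<And>b. C b \<ge> 0" "\<And>b x. x \<in> orthant b 0 \<Longrightarrow> \<bar>f x\<bar> \<le> C b * (1 + norm x) powr (- p)" by metis
  have "\<bar>f x\<bar> \<le> (\<Sum>b\<in>UNIV. C b) * (1 + norm x) powr (- p)" for x
  proof -
    define b where "b = (\<lambda>i. x $ i \<ge> 0)"
    have "x \<in> orthant b 0" by (auto simp: orthant_def b_def sign_vec_def)
    then have "\<bar>f x\<bar> \<le> C b * (1 + norm x) powr (- p)" by (rule C(2))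
    also have "\<dots> \<le> (\<Sum>b\<in>UNIV. C b) * (1 + norm x) powr (- p)"
      using C(1) by (intro mult_right_mono member_le_sum) auto
    finally show ?thesis .
  qed
  then show ?thesis using C(1) by (auto simp: decays_def intro!: exI[of _ "\<Sum>b\<in>UNIV. C b"] sum_nonneg)
qed

text \<open>In every orthant \<open>f\<close> coincides with an iterated integral of \<open>g\<close> from infinity, by
  \<open>orthant_decays_zero\<close> applied to the difference. The derivatives of \<open>f\<close> are thus the decaying intermediate
  integrals, and the finitely many orthants cover the space.\<close>

lemma intermediate_partials_decay:
  fixes f g :: "real^'n \<Rightarrow> real"
  assumes f: "decays q f" "q > 0" and g: "continuous_on UNIV g" "decays p g" "p > real (length is)"
    and ip: "iterated_partial is f g"
  shows "partial_chain (\<lambda>k f. continuous_on UNIV f \<and> decays (p - real k) f) is f g"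
proof -
  have "partial_chain (\<lambda>k f. continuous_on UNIV f \<and> orthant_decays b (p - real k) f) is f g" for b
  proof -
    obtain F where F: "partial_chain (\<lambda>k f. continuous_on UNIV f \<and> orthant_decays b (p - real k) f) is F g"
      using exists_orthant_chain[OF g(1) decays_imp_orthant_decays[OF g(2)] g(3)] by blast
    define r where "r = min q (p - real (length is))"
    have r: "r > 0" "r \<le> q" "r \<le> p - real (length is)" using f g by (auto simp: r_def)
    have dW: "orthant_decays b r (\<lambda>x. f x - F x)"
      using partial_chain_head[OF F] decays_imp_orthant_decays[OF f(1), of b] r
      by (intro orthant_decays_diff) (auto intro: orthant_decays_mono)
    have "iterated_partial is (\<lambda>x. f x - F x) (\<lambda>_. 0)"
      using iterated_partial_diff[OF ip partial_chain_iterated[OF F]] by simp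
    then have "f x - F x = 0" for x using orthant_decays_zero[OF dW r(1)] by blast
    then have "f = F" by auto
    then show ?thesis using F by simp
  qed
  then have "partial_chain (\<lambda>k f. \<forall>b. continuous_on UNIV f \<and> orthant_decays b (p - real k) f) is f g"
    by (rule partial_chain_all)
  then show ?thesis by (rule partial_chain_mono) (blast intro: all_orthants_decays)
qed

section \<open>Moments\<close>

lemma decays_mono:
  assumes "decays p f" "q \<le> p"
  shows "decays q f"
proof -
  obtain C where C: "C \<ge> 0" "\<And>x. \<bar>f x\<bar> \<le> C * (1 + norm x) powr (- p)" using assms by (auto simp: decays_def)
  have "C * (1 + norm x) powr (- p) \<le> C * (1 + norm x) powr (- q)" for x
    using C(1) assms(2) by (intro mult_left_mono powr_mono) auto
  then show ?thesis unfolding decays_def using C order_trans by blast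
qed

lemma decays_add:
  assumes "decays p f" "decays p g"
  shows "decays p (\<lambda>x. f x + g x)"
proof -
  obtain C where C: "C \<ge> 0" "\<And>x. \<bar>f x\<bar> \<le> C * (1 + norm x) powr (- p)" using assms by (auto simp: decays_def)
  obtain D where D: "D \<ge> 0" "\<And>x. \<bar>g x\<bar> \<le> D * (1 + norm x) powr (- p)" using assms by (auto simp: decays_def)
  have "\<bar>f x + g x\<bar> \<le> (C + D) * (1 + norm x) powr (- p)" for x
    using C(2)[of x] D(2)[of x] by (simp add: distrib_right)
  then show ?thesis using C(1) D(1) by (auto simp: decays_def intro!: exI[of _ "C + D"])
qed

lemma mi_monom_le: "\<bar>mi_monom x \<alpha>\<bar> \<le> norm x ^ mi_abs \<alpha>"
proof -
  have "\<bar>mi_monom x \<alpha>\<bar> = (\<Prod>i\<in>UNIV. \<bar>x $ i\<bar> ^ (\<alpha> $ i))" by (simp add: mi_monom_def abs_prod power_abs)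
  also have "\<dots> \<le> (\<Prod>i\<in>UNIV. norm x ^ (\<alpha> $ i))"
    by (intro prod_mono conjI power_mono) (auto intro: component_le_norm_cart)
  also have "\<dots> = norm x ^ mi_abs \<alpha>" by (simp add: mi_abs_def power_sum)
  finally show ?thesis .
qed

lemma one_le_mi_fact: "1 \<le> mi_fact \<alpha>"
  unfolding mi_fact_def by (intro prod_ge_1) (simp add: fact_ge_1)

lemma taylor_monom_le: "\<bar>taylor_monom \<alpha> x\<bar> \<le> norm x ^ mi_abs \<alpha>"
proof -
  have "\<bar>taylor_monom \<alpha> x\<bar> \<le> \<bar>mi_monom x \<alpha>\<bar> / 1"
    unfolding taylor_monom_def abs_divide using one_le_mi_fact[of \<alpha>] by (intro divide_left_mono) auto
  then show ?thesis using mi_monom_le[of x \<alpha>] by simp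
qed

lemma continuous_taylor_monom: "continuous_on S (taylor_monom \<alpha>)"
  unfolding taylor_monom_def mi_monom_def using mi_fact_pos[of \<alpha>]
  by (intro continuous_intros) auto

lemma norm_power_decay: "norm x ^ k * (1 + norm x) powr (- p) \<le> (1 + norm x) powr (- (p - real k))"
proof -
  have pos: "1 + norm x > 0" by (simp add: add_pos_nonneg)
  have "norm x ^ k \<le> (1 + norm x) ^ k" by (intro power_mono) auto
  also have "\<dots> = (1 + norm x) powr real k" using pos by (simp add: powr_realpow)
  finally have "norm x ^ k * (1 + norm x) powr (- p) \<le> (1 + norm x) powr real k * (1 + norm x) powr (- p)"
    by (intro mult_right_mono) auto
  also have "\<dots> = (1 + norm x) powr (- (p - real k))" by (simp add: powr_add[symmetric])
  finally show ?thesis .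
qed

lemma decays_taylor_monom:
  assumes "decays p f"
  shows "decays (p - real (mi_abs \<alpha>)) (\<lambda>x. taylor_monom \<alpha> x * f x)"
proof -
  obtain C where C: "C \<ge> 0" "\<And>x. \<bar>f x\<bar> \<le> C * (1 + norm x) powr (- p)" using assms by (auto simp: decays_def)
  have "\<bar>taylor_monom \<alpha> x * f x\<bar> \<le> C * (1 + norm x) powr (- (p - real (mi_abs \<alpha>)))" for x
  proof -
    have "\<bar>taylor_monom \<alpha> x * f x\<bar> \<le> norm x ^ mi_abs \<alpha> * (C * (1 + norm x) powr (- p))"
      unfolding abs_mult by (intro mult_mono taylor_monom_le C(2)) auto
    also have "\<dots> \<le> C * (1 + norm x) powr (- (p - real (mi_abs \<alpha>)))"
      using mult_left_mono[OF norm_power_decay C(1)] by (simp add: mult.left_commute)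
    finally show ?thesis .
  qed
  then show ?thesis using C(1) by (auto simp: decays_def)
qed

text \<open>A dominating function for difference quotients with steps of length at most \<open>1\<close>.\<close>

lemma decays_shift_bound:
  assumes dec: "decays p f" and p: "p \<ge> 0"
  obtains C where "C \<ge> 0" "\<And>x v. norm v \<le> 1 \<Longrightarrow> \<bar>f (x + v)\<bar> \<le> C * (1 + norm x) powr (- p)"
proof -
  obtain C where C: "C \<ge> 0" "\<And>x. \<bar>f x\<bar> \<le> C * (1 + norm x) powr (- p)" using dec by (auto simp: decays_def)
  have "\<bar>f (x + v)\<bar> \<le> (C * 2 powr p) * (1 + norm x) powr (- p)" if v: "norm v \<le> 1" for x v
  proof -
    have "norm x \<le> norm (x + v) + norm v" using norm_triangle_ineq4[of "x + v" v] by simp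
    then have "1 + norm x \<le> 2 * (1 + norm (x + v))" using v norm_ge_zero[of "x + v"] by argo
    then have "(2 * (1 + norm (x + v))) powr (- p) \<le> (1 + norm x) powr (- p)"
      using p by (intro powr_mono2') (auto intro!: add_pos_nonneg)
    then have "2 powr p * (2 * (1 + norm (x + v))) powr (- p) \<le> 2 powr p * (1 + norm x) powr (- p)"
      by (intro mult_left_mono) auto
    moreover have "2 powr p * (2 * (1 + norm (x + v))) powr (- p) = (1 + norm (x + v)) powr (- p)"
      by (subst powr_mult) (simp_all add: powr_minus)
    ultimately have "(1 + norm (x + v)) powr (- p) \<le> 2 powr p * (1 + norm x) powr (- p)" by metis
    then have "C * (1 + norm (x + v)) powr (- p) \<le> C * (2 powr p * (1 + norm x) powr (- p))"
      using C(1) by (rule mult_left_mono)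
    then show ?thesis using C(2)[of "x + v"] by (simp add: mult.assoc)
  qed
  then show thesis using that[of "C * 2 powr p"] C(1) by simp
qed

lemma lborel_translate:
  fixes q :: "real^'n \<Rightarrow> real"
  assumes "q \<in> borel_measurable borel" "integrable lborel q"
  shows "integrable lborel (\<lambda>x. q (x + v))" "(\<integral>x. q (x + v) \<partial>lborel) = (\<integral>x. q x \<partial>lborel)"
proof -
  have "integrable (distr lborel borel ((+) v)) q" using assms(2) by (simp add: lborel_distr_plus)
  then show "integrable lborel (\<lambda>x. q (x + v))"
    using integrable_distr_eq[of "(+) v" lborel borel q] assms(1) by (simp add: add.commute)
  have "(\<integral>x. q x \<partial>lborel) = (\<integral>x. q x \<partial>(distr lborel borel ((+) v)))" by (simp add: lborel_distr_plus)
  also have "\<dots> = (\<integral>x. q (v + x) \<partial>lborel)" using assms(1) by (intro integral_distr) auto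
  finally show "(\<integral>x. q (x + v) \<partial>lborel) = (\<integral>x. q x \<partial>lborel)" by (simp add: add.commute)
qed

text \<open>The integral of a translate of \<open>q\<close> does not depend on the translation; differentiate it under the
  integral sign.\<close>

lemma integral_partial_eq_0:
  fixes q q' :: "real^'n \<Rightarrow> real"
  assumes part: "has_partial i q q'" and cont: "continuous_on UNIV q"
    and dec: "decays r q" "decays r q'" "r > real CARD('n)"
  shows "(\<integral>x. q' x \<partial>lborel) = 0"
proof -
  let ?e = "axis i 1 :: real^'n"
  have qm: "q \<in> borel_measurable borel" using cont by (rule borel_measurable_continuous_onI)
  have qi: "integrable lborel q" by (rule decays_integrable[OF dec(1,3) qm])
  have r: "r \<ge> 0" using dec(3) by (meson less_imp_le of_nat_0_le_iff order_trans)
  obtain C where C: "C \<ge> 0" "\<And>x v. norm v \<le> 1 \<Longrightarrow> \<bar>q' (x + v)\<bar> \<le> C * (1 + norm x) powr (- r)"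
    using decays_shift_bound[OF dec(2) r] by metis
  have "((\<lambda>t. \<integral>x. q (x + t *\<^sub>R ?e) \<partial>lborel) has_real_derivative (\<integral>x. q' (x + 0 *\<^sub>R ?e) \<partial>lborel)) (at 0)"
  proof (rule has_real_derivative_integral[where r = 1 and w = "\<lambda>x. C * (1 + norm x) powr (- r)"])
    show "integrable lborel (\<lambda>x. q (x + t *\<^sub>R ?e))" for t by (rule lborel_translate(1)[OF qm qi])
    show "((\<lambda>s. q (x + s *\<^sub>R ?e)) has_real_derivative q' (x + t *\<^sub>R ?e)) (at t)" for t x
      by (rule has_partialD[OF part])
    show "\<bar>q' (x + t *\<^sub>R ?e)\<bar> \<le> C * (1 + norm x) powr (- r)" if "\<bar>t\<bar> < 1" for t x
      using that by (intro C(2)) simp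
    show "integrable lborel (\<lambda>x::real^'n. C * (1 + norm x) powr (- r))"
      by (intro integrable_mult_right integrable_norm_powr dec(3))
  qed simp
  then have "((\<lambda>t. \<integral>x. q x \<partial>lborel) has_real_derivative (\<integral>x. q' x \<partial>lborel)) (at 0)"
    by (simp add: lborel_translate(2)[OF qm qi])
  then show ?thesis using DERIV_const DERIV_unique by blast
qed

lemma has_partial_mult:
  "has_partial i f f' \<Longrightarrow> has_partial i g g' \<Longrightarrow> has_partial i (\<lambda>x. f x * g x) (\<lambda>x. f x * g' x + f' x * g x)"
  unfolding has_partial_def
proof
  fix x
  assume "\<forall>x. ((\<lambda>t. f (x + t *\<^sub>R axis i 1)) has_real_derivative f' x) (at 0)"
    "\<forall>x. ((\<lambda>t. g (x + t *\<^sub>R axis i 1)) has_real_derivative g' x) (at 0)"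
  then show "((\<lambda>t. f (x + t *\<^sub>R axis i 1) * g (x + t *\<^sub>R axis i 1)) has_real_derivative f x * g' x + f' x * g x) (at 0)"
    using DERIV_mult[of "\<lambda>t. f (x + t *\<^sub>R axis i 1)" "f' x" 0 UNIV "\<lambda>t. g (x + t *\<^sub>R axis i 1)" "g' x"]
    by (simp add: add.commute mult.commute)
qed

lemma moment_by_parts:
  fixes f f' :: "real^'n \<Rightarrow> real"
  assumes part: "has_partial i f f'" and cont: "continuous_on UNIV f" "continuous_on UNIV f'"
    and dec: "decays s f" "decays (s + 1) f'"
  shows "s - real (mi_abs \<gamma>) > real CARD('n) + 1 \<Longrightarrow>
      (\<integral>x. taylor_monom (\<gamma> + mi_unit i) x * f' x \<partial>lborel) = - (\<integral>x. taylor_monom \<gamma> x * f x \<partial>lborel)"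
    and "\<gamma> $ i = 0 \<Longrightarrow> s - real (mi_abs \<gamma>) > real CARD('n) \<Longrightarrow> (\<integral>x. taylor_monom \<gamma> x * f' x \<partial>lborel) = 0"
proof -
  have cm: "continuous_on UNIV (\<lambda>x. taylor_monom \<alpha> x * f x)" "continuous_on UNIV (\<lambda>x. taylor_monom \<alpha> x * f' x)" for \<alpha>
    using cont by (intro continuous_on_mult continuous_taylor_monom; simp)+
  have d1: "decays (s - real (mi_abs \<alpha>)) (\<lambda>x. taylor_monom \<alpha> x * f x)"
    "decays (s + 1 - real (mi_abs \<alpha>)) (\<lambda>x. taylor_monom \<alpha> x * f' x)" for \<alpha>
    using decays_taylor_monom dec by blast+
  have int: "decays r q \<Longrightarrow> r > real CARD('n) \<Longrightarrow> continuous_on UNIV q \<Longrightarrow> integrable lborel q" for r and q :: "real^'n \<Rightarrow> real"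
    using decays_integrable borel_measurable_continuous_onI by blast
  show "(\<integral>x. taylor_monom (\<gamma> + mi_unit i) x * f' x \<partial>lborel) = - (\<integral>x. taylor_monom \<gamma> x * f x \<partial>lborel)"
    if s: "s - real (mi_abs \<gamma>) > real CARD('n) + 1"
  proof -
    let ?\<gamma> = "\<gamma> + mi_unit i"
    let ?r = "s - real (mi_abs ?\<gamma>)"
    have deg: "real (mi_abs ?\<gamma>) = real (mi_abs \<gamma>) + 1" by (simp add: mi_abs_add mi_abs_unit)
    have "(\<integral>x. taylor_monom ?\<gamma> x * f' x + taylor_monom \<gamma> x * f x \<partial>lborel) = 0"
    proof (rule integral_partial_eq_0[OF has_partial_mult[OF has_partial_taylor_monom(1) part] cm(1) d1(1)])
      show "decays ?r (\<lambda>x. taylor_monom ?\<gamma> x * f' x + taylor_monom \<gamma> x * f x)"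
        by (intro decays_add decays_mono[OF d1(2)] decays_mono[OF d1(1)]) (auto simp: deg)
    qed (use s deg in simp)
    moreover have "integrable lborel (\<lambda>x. taylor_monom ?\<gamma> x * f' x)" "integrable lborel (\<lambda>x. taylor_monom \<gamma> x * f x)"
      using s deg by (auto intro!: int[OF d1(2) _ cm(2)] int[OF d1(1) _ cm(1)])
    ultimately show ?thesis by simp
  qed
  show "(\<integral>x. taylor_monom \<gamma> x * f' x \<partial>lborel) = 0" if "\<gamma> $ i = 0" and s: "s - real (mi_abs \<gamma>) > real CARD('n)"
  proof -
    have "(\<integral>x. taylor_monom \<gamma> x * f' x + 0 * f x \<partial>lborel) = 0"
    proof (rule integral_partial_eq_0[OF has_partial_mult[OF has_partial_taylor_monom(2)[OF that(1)] part] cm(1) d1(1)])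
      show "decays (s - real (mi_abs \<gamma>)) (\<lambda>x. taylor_monom \<gamma> x * f' x + 0 * f x)"
        using decays_mono[OF d1(2)] by simp
    qed (use s in simp)
    then show ?thesis by simp
  qed
qed

text \<open>Integration by parts once per entry of the list. Each step trades one power of the monomial for
  one power of decay, so the same inequality for \<open>p\<close> makes all products integrable.\<close>

lemma moments_of_derivative:
  fixes f g :: "real^'n \<Rightarrow> real"
  assumes "partial_chain (\<lambda>k f. continuous_on UNIV f \<and> decays (p - real k) f) is f g"
    and "mi_list \<beta> is" and "p > real CARD('n) + 1 + real (mi_abs \<alpha>)"
  shows "(\<integral>x. taylor_monom \<alpha> x * g x \<partial>lborel) =
    (if \<beta> \<le> \<alpha> then (-1) ^ mi_abs \<beta> * (\<integral>x. taylor_monom (\<alpha> - \<beta>) x * f x \<partial>lborel) else 0)"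
  using assms(1,2)
proof (induction "is" arbitrary: f \<beta>)
  case Nil
  then have "\<beta> = 0" using mi_list_length[of \<beta> "[]"] by (simp add: mi_abs_eq_0_iff)
  then show ?case using Nil by (simp add: mi_abs_0 less_eq_vec_def)
next
  case (Cons i "is")
  obtain \<beta>' where \<beta>': "\<beta> = \<beta>' + mi_unit i" "mi_list \<beta>' is" using Cons.prems(2) by (rule mi_list_ConsE)
  obtain f' where f': "has_partial i f f'"
      "partial_chain (\<lambda>k f. continuous_on UNIV f \<and> decays (p - real k) f) is f' g"
      "continuous_on UNIV f" "decays (p - real (Suc (length is))) f"
    using Cons.prems(1) by auto
  have h: "continuous_on UNIV f'" "decays (p - real (length is)) f'" using partial_chain_head[OF f'(2)] by auto
  let ?s = "p - real (Suc (length is))"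
  have h': "decays (?s + 1) f'" using h(2) by simp
  have len: "length is = mi_abs \<beta>'" using mi_list_length[OF \<beta>'(2)] .
  note IH = Cons.IH[OF f'(2) \<beta>'(2)]
  note parts = moment_by_parts[OF f'(1) f'(3) h(1) f'(4) h']
  show ?case
  proof (cases "\<beta>' \<le> \<alpha>")
    case False
    then have "\<not> \<beta> \<le> \<alpha>" using \<beta>'(1) mi_le_add order_trans by blast
    then show ?thesis using IH False by simp
  next
    case True
    have \<alpha>: "\<alpha> = \<beta>' + (\<alpha> - \<beta>')" using mi_add_diff_inverse[OF True] by simp
    have deg: "real (mi_abs \<alpha>) = real (mi_abs \<beta>') + real (mi_abs (\<alpha> - \<beta>'))"
      using arg_cong[OF \<alpha>, of mi_abs] by (simp add: mi_abs_add)
    have rate: "?s - real (mi_abs (\<alpha> - \<beta>')) > real CARD('n)" using assms(3) deg len by simp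
    show ?thesis
    proof (cases "(\<alpha> - \<beta>') $ i = 0")
      case True
      then have "\<not> \<beta> \<le> \<alpha>" by (auto simp: \<beta>'(1) less_eq_vec_def intro!: exI[of _ i])
      then show ?thesis using IH parts(2)[OF True rate] by simp
    next
      case False
      then have le: "mi_unit i \<le> \<alpha> - \<beta>'" by (auto simp: less_eq_vec_def)
      have eq: "\<alpha> - \<beta>' = (\<alpha> - \<beta>) + mi_unit i"
        using False by (auto simp: \<beta>'(1) vec_eq_iff)
      have "\<beta> \<le> \<alpha>" using True le by (auto simp: \<beta>'(1) less_eq_vec_def split: if_splits)
      moreover have "(\<integral>x. taylor_monom (\<alpha> - \<beta>') x * f' x \<partial>lborel) = - (\<integral>x. taylor_monom (\<alpha> - \<beta>) x * f x \<partial>lborel)"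
        unfolding eq
      proof (rule parts(1))
        have "mi_abs (\<alpha> - \<beta>') = mi_abs (\<alpha> - \<beta>) + 1" by (simp add: eq mi_abs_add mi_abs_unit)
        then show "?s - real (mi_abs (\<alpha> - \<beta>)) > real CARD('n) + 1" using rate by simp
      qed
      ultimately show ?thesis using IH True by (simp add: \<beta>'(1) mi_abs_add mi_abs_unit)
    qed
  qed
qed

section \<open>Termwise differentiation of lattice sums\<close>

lemma count_space_infsum:
  fixes f :: "'a \<Rightarrow> real"
  assumes "(\<lambda>m. \<bar>f m\<bar>) summable_on UNIV"
  shows "integrable (count_space UNIV) f" "(\<integral>m. f m \<partial>count_space UNIV) = infsum f UNIV"
proof -
  have "Infinite_Set_Sum.abs_summable_on f UNIV"
    using assms abs_summable_equivalent[of f UNIV] by simp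
  then show "integrable (count_space UNIV) f" "(\<integral>m. f m \<partial>count_space UNIV) = infsum f UNIV"
    using infsetsum_infsum[of f UNIV] by (auto simp: abs_summable_on_def infsetsum_def)
qed

text \<open>In the theorem \<open>\<eta> = 1 / sqrt \<D>\<close>, \<open>\<delta> = h * sqrt \<D>\<close>, and \<open>c m\<close> is the combination of the values of
  the derivatives of \<open>u\<close> at the node \<open>h m\<close>.\<close>

definition lattice_sum :: "real \<Rightarrow> real \<Rightarrow> (int^'n \<Rightarrow> real) \<Rightarrow> (real^'n \<Rightarrow> real) \<Rightarrow> real^'n \<Rightarrow> real" where
  "lattice_sum \<eta> \<delta> c f x = (\<Sum>\<^sub>\<infinity>m. c m * f (x /\<^sub>R \<delta> - \<eta> *\<^sub>R lattice_pt m))"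

lemma weighted_lattice_summable:
  fixes f :: "real^'n \<Rightarrow> real"
  assumes "decays p f" "p > real CARD('n)" "0 < \<eta>" "\<eta> \<le> 1" and c: "\<And>m. \<bar>c m\<bar> \<le> B"
  shows "(\<lambda>m. \<bar>c m * f (y - \<eta> *\<^sub>R lattice_pt m)\<bar>) summable_on UNIV"
proof (rule summable_on_comparison_test)
  show "(\<lambda>m. B * \<bar>f (y - \<eta> *\<^sub>R lattice_pt m)\<bar>) summable_on UNIV"
    by (intro summable_on_cmult_right decays_lattice[OF assms(1-4)])
  show "\<bar>c m * f (y - \<eta> *\<^sub>R lattice_pt m)\<bar> \<le> B * \<bar>f (y - \<eta> *\<^sub>R lattice_pt m)\<bar>" for m
    unfolding abs_mult using c[of m] by (rule mult_right_mono) simp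
qed auto

lemma has_partial_lattice_sum:
  fixes f f' :: "real^'n \<Rightarrow> real"
  assumes part: "has_partial i f f'" and dec: "decays p f" "decays p f'" "p > real CARD('n)"
    and \<eta>: "0 < \<eta>" "\<eta> \<le> 1" and \<delta>: "\<delta> > 0" and c: "\<And>m. \<bar>c m\<bar> \<le> B"
  shows "has_partial i (lattice_sum \<eta> \<delta> c f) (\<lambda>x. lattice_sum \<eta> \<delta> c f' x / \<delta>)"
  unfolding has_partial_def
proof
  fix x :: "real^'n"
  let ?e = "axis i 1 :: real^'n"
  let ?z = "\<lambda>m. x /\<^sub>R \<delta> - \<eta> *\<^sub>R lattice_pt m"
  have p: "p \<ge> 0" using dec(3) by (meson less_imp_le of_nat_0_le_iff order_trans)
  obtain C where C: "C \<ge> 0" "\<And>x v. norm v \<le> 1 \<Longrightarrow> \<bar>f' (x + v)\<bar> \<le> C * (1 + norm x) powr (- p)"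
    using decays_shift_bound[OF dec(2) p] by metis
  have B: "B \<ge> 0" using c[of undefined] by (meson abs_ge_zero order_trans)
  have pt: "(x + t *\<^sub>R ?e) /\<^sub>R \<delta> - \<eta> *\<^sub>R lattice_pt m = ?z m + (t / \<delta>) *\<^sub>R ?e" for t m
    by (simp add: algebra_simps divide_inverse)
  have sum: "(\<lambda>m. \<bar>c m * f (?z m + (t / \<delta>) *\<^sub>R ?e)\<bar>) summable_on UNIV" for t
    using weighted_lattice_summable[where y = "(x + t *\<^sub>R ?e) /\<^sub>R \<delta>", OF dec(1,3) \<eta> c] unfolding pt .
  have sum': "(\<lambda>m. \<bar>c m * f' (?z m)\<bar>) summable_on UNIV"
    using weighted_lattice_summable[where y = "x /\<^sub>R \<delta>", OF dec(2,3) \<eta> c] .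
  have "((\<lambda>t. \<integral>m. c m * f (?z m + (t / \<delta>) *\<^sub>R ?e) \<partial>count_space UNIV) has_real_derivative
      (\<integral>m. c m * (f' (?z m + (0 / \<delta>) *\<^sub>R ?e) / \<delta>) \<partial>count_space UNIV)) (at 0)"
  proof (rule has_real_derivative_integral[where r = \<delta> and w = "\<lambda>m. (B * C / \<delta>) * (1 + norm (?z m)) powr (- p)"])
    show "integrable (count_space UNIV) (\<lambda>m. c m * f (?z m + (t / \<delta>) *\<^sub>R ?e))" for t
      by (rule count_space_infsum(1)[OF sum])
    show "((\<lambda>s. c m * f (?z m + (s / \<delta>) *\<^sub>R ?e)) has_real_derivative c m * (f' (?z m + (t / \<delta>) *\<^sub>R ?e) / \<delta>)) (at t)" for t m
    proof -
      have "((\<lambda>s. s / \<delta>) has_real_derivative 1 / \<delta>) (at t)" using \<delta> by (auto intro!: derivative_eq_intros)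
      from DERIV_chain2[OF has_partialD[OF part] this]
      have "((\<lambda>s. f (?z m + (s / \<delta>) *\<^sub>R ?e)) has_real_derivative f' (?z m + (t / \<delta>) *\<^sub>R ?e) / \<delta>) (at t)" by simp
      then show ?thesis by (rule DERIV_cmult)
    qed
    show "\<bar>c m * (f' (?z m + (t / \<delta>) *\<^sub>R ?e) / \<delta>)\<bar> \<le> (B * C / \<delta>) * (1 + norm (?z m)) powr (- p)" if "\<bar>t\<bar> < \<delta>" for t m
    proof -
      have "\<bar>f' (?z m + (t / \<delta>) *\<^sub>R ?e)\<bar> \<le> C * (1 + norm (?z m)) powr (- p)"
        using that \<delta> by (intro C(2)) simp
      then have "\<bar>c m\<bar> * \<bar>f' (?z m + (t / \<delta>) *\<^sub>R ?e)\<bar> \<le> B * (C * (1 + norm (?z m)) powr (- p))"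
        using c[of m] B by (intro mult_mono) auto
      then have "\<bar>c m\<bar> * \<bar>f' (?z m + (t / \<delta>) *\<^sub>R ?e)\<bar> / \<delta> \<le> B * (C * (1 + norm (?z m)) powr (- p)) / \<delta>"
        using \<delta> by (intro divide_right_mono) auto
      then show ?thesis using \<delta> by (simp add: abs_mult)
    qed
    have "(\<lambda>m. (1 + norm (?z m)) powr (- p)) summable_on UNIV"
      using lattice_sum_bound[OF dec(3)] \<eta> by metis
    then have "(\<lambda>m. \<bar>(B * C / \<delta>) * (1 + norm (?z m)) powr (- p)\<bar>) summable_on UNIV"
      using summable_on_cmult_right[of "\<lambda>m. (1 + norm (?z m)) powr (- p)" UNIV "B * C / \<delta>"] B C(1) \<delta> by simp
    then show "integrable (count_space UNIV) (\<lambda>m. (B * C / \<delta>) * (1 + norm (?z m)) powr (- p))"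
      by (rule count_space_infsum(1))
  qed (use \<delta> in simp)
  moreover have "(\<integral>m. c m * f (?z m + (t / \<delta>) *\<^sub>R ?e) \<partial>count_space UNIV) = lattice_sum \<eta> \<delta> c f (x + t *\<^sub>R ?e)" for t
    unfolding lattice_sum_def pt by (rule count_space_infsum(2)[OF sum])
  moreover have "(\<integral>m. c m * (f' (?z m + (0 / \<delta>) *\<^sub>R ?e) / \<delta>) \<partial>count_space UNIV) = lattice_sum \<eta> \<delta> c f' x / \<delta>"
    unfolding lattice_sum_def using count_space_infsum(2)[OF sum'] by simp
  ultimately show "((\<lambda>t. lattice_sum \<eta> \<delta> c f (x + t *\<^sub>R ?e)) has_real_derivative lattice_sum \<eta> \<delta> c f' x / \<delta>) (at 0)"
    by (simp only:)
qed

text \<open>Termwise differentiation is possible in every step because all functions in the chain decay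
  fast enough for their sums over the lattice to converge.\<close>

lemma iterated_partial_lattice_sum:
  fixes f g :: "real^'n \<Rightarrow> real"
  assumes chain: "partial_chain (\<lambda>k f. continuous_on UNIV f \<and> decays (p - real k) f) is f g"
    and p: "p - real (length is) > real CARD('n)"
    and \<eta>: "0 < \<eta>" "\<eta> \<le> 1" and \<delta>: "\<delta> > 0" and c: "\<And>m. \<bar>c m\<bar> \<le> B"
  shows "iterated_partial is (\<lambda>x. r * lattice_sum \<eta> \<delta> c f x) (\<lambda>x. r / \<delta> ^ length is * lattice_sum \<eta> \<delta> c g x)"
  using chain p
proof (induction "is" arbitrary: f r)
  case (Cons i "is")
  obtain f' where f': "has_partial i f f'"
      "partial_chain (\<lambda>k f. continuous_on UNIV f \<and> decays (p - real k) f) is f' g"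
      "decays (p - real (Suc (length is))) f"
    using Cons.prems(1) by auto
  have h: "decays (p - real (Suc (length is))) f'"
    using partial_chain_head[OF f'(2)] by (auto intro: decays_mono)
  have "has_partial i (lattice_sum \<eta> \<delta> c f) (\<lambda>x. lattice_sum \<eta> \<delta> c f' x / \<delta>)"
    using Cons.prems(2) by (intro has_partial_lattice_sum[OF f'(1,3) h _ \<eta> \<delta> c]) simp
  then have "has_partial i (\<lambda>x. r * lattice_sum \<eta> \<delta> c f x) (\<lambda>x. r * (lattice_sum \<eta> \<delta> c f' x / \<delta>))"
    by (rule has_partial_cmult)
  then have "has_partial i (\<lambda>x. r * lattice_sum \<eta> \<delta> c f x) (\<lambda>x. r / \<delta> * lattice_sum \<eta> \<delta> c f' x)" by simp
  moreover have "iterated_partial is (\<lambda>x. r / \<delta> * lattice_sum \<eta> \<delta> c f' x) (\<lambda>x. (r / \<delta>) / \<delta> ^ length is * lattice_sum \<eta> \<delta> c g x)"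
    using Cons.prems(2) by (intro Cons.IH[OF f'(2)]) simp
  ultimately show ?case unfolding iterated_partial_Cons by auto
qed simp

section \<open>The discrete error expansion\<close>

text \<open>The Riemann sum for the integral of \<open>F\<close> over a lattice of mesh \<open>\<eta>\<close> that contains \<open>y\<close>.\<close>

definition lattice_mean :: "real \<Rightarrow> real^'n \<Rightarrow> (real^'n \<Rightarrow> real) \<Rightarrow> real" where
  "lattice_mean \<eta> y F = \<eta> ^ CARD('n) * (\<Sum>\<^sub>\<infinity>m. F (y - \<eta> *\<^sub>R lattice_pt m))"

lemma has_sum_finite_sum:
  fixes f :: "'i \<Rightarrow> 'a \<Rightarrow> real"
  assumes "finite I" "\<And>i. i \<in> I \<Longrightarrow> (f i has_sum s i) A"
  shows "((\<lambda>x. \<Sum>i\<in>I. f i x) has_sum (\<Sum>i\<in>I. s i)) A"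
  using assms
proof (induction I rule: finite_induct)
  case (insert i I)
  then show ?case using has_sum_add[where f = "f i"] by simp
qed simp

lemma lattice_mean_has_sum:
  assumes "(\<lambda>m. \<bar>F (y - \<eta> *\<^sub>R lattice_pt m)\<bar>) summable_on UNIV"
  shows "((\<lambda>m. \<eta> ^ CARD('n) * F (y - \<eta> *\<^sub>R lattice_pt m)) has_sum lattice_mean \<eta> (y :: real^'n) F) UNIV"
  unfolding lattice_mean_def
  using assms abs_summable_summable[of "\<lambda>m. F (y - \<eta> *\<^sub>R lattice_pt m)" UNIV]
  by (intro has_sum_cmult_right has_sum_infsum) simp

lemma taylor_monom_scale: "taylor_monom \<alpha> (c *\<^sub>R z) = c ^ mi_abs \<alpha> * taylor_monom \<alpha> z"
  by (simp add: taylor_monom_def mi_monom_def power_mult_distrib prod.distrib mi_abs_def power_sum)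

text \<open>The Taylor remainder at \<open>x - \<delta> z\<close> is of size \<open>(\<delta> |z|)\<^bsup>L-|\<gamma>|\<^esup>\<close>. The power of \<open>|z|\<close> is absorbed by the
  decay of \<open>G\<close>, and the power of \<open>\<delta>\<close> comes out of the sum.\<close>

lemma lattice_mean_taylor:
  fixes w :: "nat^'n \<Rightarrow> real^'n \<Rightarrow> real"
  assumes df: "deriv_family L w M" and \<gamma>: "mi_abs \<gamma> < L"
    and CG: "CG \<ge> 0" "\<And>z. \<bar>G z\<bar> \<le> CG * (1 + norm z) powr (- p)" and p: "p > real L + real CARD('n)"
    and \<eta>: "0 < \<eta>" "\<eta> \<le> 1" and \<delta>: "\<delta> > 0"
    and B: "lattice_mean \<eta> y (\<lambda>z. (1 + norm z) powr (- (p - real L))) \<le> B"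
  shows "\<bar>lattice_mean \<eta> y (\<lambda>z. w \<gamma> (x - \<delta> *\<^sub>R z) * G z) -
      (\<Sum>\<alpha> | mi_abs \<alpha> \<le> L - 1 - mi_abs \<gamma>. (- \<delta>) ^ mi_abs \<alpha> * w (\<gamma> + \<alpha>) x * lattice_mean \<eta> y (\<lambda>z. taylor_monom \<alpha> z * G z))\<bar>
    \<le> real CARD('n) ^ (L - mi_abs \<gamma>) * (\<Sum>\<kappa> | mi_abs \<kappa> = L. M \<kappa>) * \<delta> ^ (L - mi_abs \<gamma>) * CG * B"
proof -
  let ?n = "real CARD('n)"
  let ?S = "\<Sum>\<kappa> | mi_abs \<kappa> = L. M \<kappa>"
  define k where "k = L - 1 - mi_abs \<gamma>"
  have k: "Suc k = L - mi_abs \<gamma>" "mi_abs \<gamma> + Suc k = L" using \<gamma> by (auto simp: k_def)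
  have S0: "?S \<ge> 0" using df by (intro sum_nonneg) (simp add: deriv_family_def)
  define z where "z = (\<lambda>m. y - \<eta> *\<^sub>R lattice_pt m)"
  have dG: "decays p G" using CG by (auto simp: decays_def)
  have h1: "((\<lambda>m. \<eta> ^ CARD('n) * (w \<gamma> (x - \<delta> *\<^sub>R z m) * G (z m))) has_sum
      lattice_mean \<eta> y (\<lambda>z. w \<gamma> (x - \<delta> *\<^sub>R z) * G z)) UNIV"
    unfolding z_def
  proof (rule lattice_mean_has_sum)
    show "(\<lambda>m. \<bar>w \<gamma> (x - \<delta> *\<^sub>R (y - \<eta> *\<^sub>R lattice_pt m)) * G (y - \<eta> *\<^sub>R lattice_pt m)\<bar>) summable_on UNIV"
      by (rule weighted_lattice_summable[OF dG _ \<eta>, of _ "M \<gamma>"]) (use p df \<gamma> in \<open>auto simp: deriv_family_def\<close>)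
  qed
  have h2: "((\<lambda>m. \<Sum>\<alpha> | mi_abs \<alpha> \<le> k. (- \<delta>) ^ mi_abs \<alpha> * w (\<gamma> + \<alpha>) x * (\<eta> ^ CARD('n) * (taylor_monom \<alpha> (z m) * G (z m)))) has_sum
      (\<Sum>\<alpha> | mi_abs \<alpha> \<le> k. (- \<delta>) ^ mi_abs \<alpha> * w (\<gamma> + \<alpha>) x * lattice_mean \<eta> y (\<lambda>z. taylor_monom \<alpha> z * G z))) UNIV"
  proof (intro has_sum_finite_sum finite_mi_abs_le has_sum_cmult_right)
    fix \<alpha> :: "nat^'n" assume "\<alpha> \<in> {\<alpha>. mi_abs \<alpha> \<le> k}"
    then have "mi_abs \<alpha> \<le> L" using k by simp
    then have "p - real (mi_abs \<alpha>) > ?n" using p by simp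
    then show "((\<lambda>m. \<eta> ^ CARD('n) * (taylor_monom \<alpha> (z m) * G (z m))) has_sum lattice_mean \<eta> y (\<lambda>z. taylor_monom \<alpha> z * G z)) UNIV"
      unfolding z_def by (intro lattice_mean_has_sum decays_lattice[OF decays_taylor_monom[OF dG] _ \<eta>])
  qed
  have b_dec: "decays (p - real L) (\<lambda>z::real^'n. (1 + norm z) powr (- (p - real L)))"
    unfolding decays_def by (intro exI[of _ 1]) auto
  define c where "c = ?n ^ Suc k * ?S * \<delta> ^ Suc k * CG"
  have c0: "c \<ge> 0" using S0 \<delta> CG(1) by (simp add: c_def)
  have h3: "((\<lambda>m. c * (\<eta> ^ CARD('n) * (1 + norm (z m)) powr (- (p - real L)))) has_sum
      c * lattice_mean \<eta> y (\<lambda>z. (1 + norm z) powr (- (p - real L)))) UNIV"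
    unfolding z_def using p by (intro has_sum_cmult_right lattice_mean_has_sum decays_lattice[OF b_dec _ \<eta>]) simp
  define D where "D = (\<lambda>m. \<eta> ^ CARD('n) * (w \<gamma> (x - \<delta> *\<^sub>R z m) * G (z m)) -
      (\<Sum>\<alpha> | mi_abs \<alpha> \<le> k. (- \<delta>) ^ mi_abs \<alpha> * w (\<gamma> + \<alpha>) x * (\<eta> ^ CARD('n) * (taylor_monom \<alpha> (z m) * G (z m)))))"
  define d where "d = lattice_mean \<eta> y (\<lambda>z. w \<gamma> (x - \<delta> *\<^sub>R z) * G z) -
      (\<Sum>\<alpha> | mi_abs \<alpha> \<le> k. (- \<delta>) ^ mi_abs \<alpha> * w (\<gamma> + \<alpha>) x * lattice_mean \<eta> y (\<lambda>z. taylor_monom \<alpha> z * G z))"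
  have hD: "(D has_sum d) UNIV" unfolding D_def d_def by (rule has_sum_diff_real[OF h1 h2])
  have Dbd: "\<bar>D m\<bar> \<le> c * (\<eta> ^ CARD('n) * (1 + norm (z m)) powr (- (p - real L)))" for m
  proof -
    let ?T = "\<Sum>\<alpha> | mi_abs \<alpha> \<le> k. w (\<gamma> + \<alpha>) x * taylor_monom \<alpha> ((x - \<delta> *\<^sub>R z m) - x)"
    have Teq: "?T = (\<Sum>\<alpha> | mi_abs \<alpha> \<le> k. (- \<delta>) ^ mi_abs \<alpha> * w (\<gamma> + \<alpha>) x * taylor_monom \<alpha> (z m))"
      using taylor_monom_scale[of _ "- \<delta>" "z m"] by (intro sum.cong) auto
    have "D m = \<eta> ^ CARD('n) * G (z m) * (w \<gamma> (x - \<delta> *\<^sub>R z m) - ?T)"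
      unfolding D_def Teq right_diff_distrib sum_distrib_left by (intro arg_cong2[where f = "(-)"] sum.cong) (auto simp: mult_ac)
    then have "\<bar>D m\<bar> = \<eta> ^ CARD('n) * (\<bar>G (z m)\<bar> * \<bar>w \<gamma> (x - \<delta> *\<^sub>R z m) - ?T\<bar>)"
      using \<eta> by (simp add: abs_mult)
    also have "\<dots> \<le> \<eta> ^ CARD('n) * ((CG * (1 + norm (z m)) powr (- p)) * (?n ^ Suc k * ?S * norm ((x - \<delta> *\<^sub>R z m) - x) ^ Suc k))"
      using \<eta> CG by (intro mult_left_mono mult_mono taylor_remainder[OF df k(2)]) auto
    also have "norm ((x - \<delta> *\<^sub>R z m) - x) = \<delta> * norm (z m)" using \<delta> by simp
    also have "\<eta> ^ CARD('n) * ((CG * (1 + norm (z m)) powr (- p)) * (?n ^ Suc k * ?S * (\<delta> * norm (z m)) ^ Suc k))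
        = c * (\<eta> ^ CARD('n) * (norm (z m) ^ Suc k * (1 + norm (z m)) powr (- p)))"
      by (simp only: c_def power_mult_distrib mult_ac)
    also have "\<dots> \<le> c * (\<eta> ^ CARD('n) * (1 + norm (z m)) powr (- (p - real L)))"
    proof -
      have "norm (z m) ^ Suc k * (1 + norm (z m)) powr (- p) \<le> (1 + norm (z m)) powr (- (p - real (Suc k)))"
        by (rule norm_power_decay)
      also have "\<dots> \<le> (1 + norm (z m)) powr (- (p - real L))" using k by (intro powr_mono) auto
      finally show ?thesis using c0 \<eta> by (intro mult_left_mono) auto
    qed
    finally show ?thesis .
  qed
  have "d \<le> c * lattice_mean \<eta> y (\<lambda>z. (1 + norm z) powr (- (p - real L)))"
    by (rule has_sum_mono[OF hD h3]) (use abs_le_D1[OF Dbd] in simp)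
  moreover have "- d \<le> c * lattice_mean \<eta> y (\<lambda>z. (1 + norm z) powr (- (p - real L)))"
    using hD by (intro has_sum_mono[OF _ h3, of "\<lambda>m. - D m"]) (use abs_le_D2[OF Dbd] in \<open>auto simp: has_sum_uminus\<close>)
  moreover have "c * lattice_mean \<eta> y (\<lambda>z. (1 + norm z) powr (- (p - real L))) \<le> c * B"
    using B c0 by (rule mult_left_mono)
  ultimately have "\<bar>d\<bar> \<le> c * B" by linarith
  then show ?thesis unfolding d_def c_def k(1) unfolding k_def .
qed

lemma sum_convolution_mi:
  fixes F :: "nat^'n \<Rightarrow> nat^'n \<Rightarrow> real"
  shows "(\<Sum>\<gamma> | mi_abs \<gamma> \<le> k. \<Sum>\<nu> | mi_abs \<gamma> + mi_abs \<nu> \<le> k. F \<gamma> \<nu>) =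
    (\<Sum>\<kappa> | mi_abs \<kappa> \<le> k. \<Sum>\<nu> | \<nu> \<le> \<kappa>. F (\<kappa> - \<nu>) \<nu>)"
proof -
  have fin1: "finite {\<nu>::nat^'n. mi_abs \<gamma> + mi_abs \<nu> \<le> k}" for \<gamma> :: "nat^'n"
    by (rule finite_subset[OF _ finite_mi_abs_le[of k]]) auto
  have fin2: "finite {\<nu>::nat^'n. \<nu> \<le> \<kappa>}" for \<kappa>
    by (rule finite_subset[OF _ finite_mi_abs_le[of "mi_abs \<kappa>"]]) (auto intro: mi_abs_mono)
  have "(\<Sum>\<gamma> | mi_abs \<gamma> \<le> k. \<Sum>\<nu> | mi_abs \<gamma> + mi_abs \<nu> \<le> k. F \<gamma> \<nu>) =
      (\<Sum>(\<gamma>, \<nu>)\<in>(SIGMA \<gamma>:{\<gamma>. mi_abs \<gamma> \<le> k}. {\<nu>. mi_abs \<gamma> + mi_abs \<nu> \<le> k}). F \<gamma> \<nu>)"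
    by (rule sum.Sigma) (use fin1 finite_mi_abs_le in auto)
  also have "\<dots> = (\<Sum>(\<kappa>, \<nu>)\<in>(SIGMA \<kappa>:{\<kappa>. mi_abs \<kappa> \<le> k}. {\<nu>. \<nu> \<le> \<kappa>}). F (\<kappa> - \<nu>) \<nu>)"
  proof (rule sum.reindex_bij_witness[where i = "\<lambda>(\<kappa>, \<nu>). (\<kappa> - \<nu>, \<nu>)" and j = "\<lambda>(\<gamma>, \<nu>). (\<gamma> + \<nu>, \<nu>)"])
    fix a assume "a \<in> (SIGMA \<kappa>:{\<kappa>::nat^'n. mi_abs \<kappa> \<le> k}. {\<nu>. \<nu> \<le> \<kappa>})"
    then obtain \<kappa> \<nu> where a: "a = (\<kappa>, \<nu>)" "mi_abs \<kappa> \<le> k" "\<nu> \<le> \<kappa>" by auto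
    have eq: "\<kappa> - \<nu> + \<nu> = \<kappa>" using mi_add_diff_inverse[OF a(3)] by (simp add: add.commute)
    have "mi_abs (\<kappa> - \<nu>) + mi_abs \<nu> \<le> k" using a(2) arg_cong[OF eq, of mi_abs] by (simp add: mi_abs_add)
    then show "(case a of (\<kappa>, \<nu>) \<Rightarrow> (\<kappa> - \<nu>, \<nu>)) \<in> (SIGMA \<gamma>:{\<gamma>. mi_abs \<gamma> \<le> k}. {\<nu>. mi_abs \<gamma> + mi_abs \<nu> \<le> k})"
      using a(1) by auto
    show "(case case a of (\<kappa>, \<nu>) \<Rightarrow> (\<kappa> - \<nu>, \<nu>) of (\<gamma>, \<nu>) \<Rightarrow> (\<gamma> + \<nu>, \<nu>)) = a"
      using a(1) eq by simp
  qed (auto simp: mi_abs_add less_eq_vec_def)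
  also have "\<dots> = (\<Sum>\<kappa> | mi_abs \<kappa> \<le> k. \<Sum>\<nu> | \<nu> \<le> \<kappa>. F (\<kappa> - \<nu>) \<nu>)"
    by (rule sum.Sigma[symmetric]) (use fin2 finite_mi_abs_le in auto)
  finally show ?thesis .
qed

text \<open>With \<open>\<alpha> = \<beta> + \<nu>\<close> and \<open>\<kappa> = \<gamma> + \<nu>\<close> the double sum is \<open>\<delta>\<^bsup>|\<beta>|\<^esup>\<close> times a sum over \<open>\<kappa>\<close>. For \<open>|\<kappa>| < N\<close> the
  coefficient of \<open>v (\<beta> + \<kappa>)\<close> is the convolution in \<open>cond\<close>, which leaves \<open>\<kappa> = 0\<close> only; the other terms
  are bounded by means of \<open>E\<close>.\<close>

lemma moment_cancellation:
  fixes v J I a :: "nat^'n \<Rightarrow> real"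
  assumes N: "N \<ge> 1" and L: "L \<ge> N + mi_abs \<beta>"
    and a0: "a 0 = 1" and J0: "J 0 = 1"
    and cond: "\<And>\<kappa>. 1 \<le> mi_abs \<kappa> \<Longrightarrow> mi_abs \<kappa> \<le> N - 1 \<Longrightarrow> (\<Sum>\<nu> | \<nu> \<le> \<kappa>. a (\<kappa> - \<nu>) * J \<nu>) = 0"
    and I: "\<And>\<alpha>. mi_abs \<alpha> \<le> L - 1 \<Longrightarrow> I \<alpha> = (if \<beta> \<le> \<alpha> then (-1) ^ mi_abs \<beta> * J (\<alpha> - \<beta>) else 0)"
    and \<delta>: "\<delta> > 0" and E: "E \<ge> 0"
    and v: "\<And>\<kappa>. N \<le> mi_abs \<kappa> \<Longrightarrow> mi_abs \<beta> + mi_abs \<kappa> < L \<Longrightarrow> \<delta> ^ mi_abs \<kappa> * \<bar>v (\<beta> + \<kappa>)\<bar> \<le> E"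
  shows "\<bar>(\<Sum>\<gamma> | mi_abs \<gamma> \<le> N - 1. \<Sum>\<alpha> | mi_abs \<alpha> \<le> L - 1 - mi_abs \<gamma>.
           (- \<delta>) ^ (mi_abs \<gamma> + mi_abs \<alpha>) * a \<gamma> * v (\<gamma> + \<alpha>) * I \<alpha>) - \<delta> ^ mi_abs \<beta> * v \<beta>\<bar>
    \<le> \<delta> ^ mi_abs \<beta> * ((\<Sum>\<gamma> | mi_abs \<gamma> \<le> N - 1. \<Sum>\<nu> | mi_abs \<nu> \<le> L - 1. \<bar>a \<gamma>\<bar> * \<bar>J \<nu>\<bar>) * E)"
proof -
  define F where "F = (\<lambda>\<gamma> \<nu>. (- \<delta>) ^ (mi_abs \<gamma> + mi_abs \<nu>) * a \<gamma> * J \<nu> * v (\<beta> + (\<gamma> + \<nu>)))"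
  \<comment> \<open>\<open>IB \<gamma>\<close> contains the \<open>\<nu>\<close> that occur after \<open>\<alpha> = \<beta> + \<nu>\<close>, and \<open>IC \<gamma>\<close> those among them with \<open>|\<gamma> + \<nu>| < N\<close>, which the moment conditions govern\<close>
  define IB where "IB = (\<lambda>\<gamma>::nat^'n. {\<nu>::nat^'n. mi_abs \<gamma> + mi_abs \<beta> + mi_abs \<nu> \<le> L - 1})"
  define IC where "IC = (\<lambda>\<gamma>::nat^'n. {\<nu>::nat^'n. mi_abs \<gamma> + mi_abs \<nu> \<le> N - 1})"
  have finB: "finite (IB \<gamma>)" for \<gamma> unfolding IB_def by (rule finite_subset[OF _ finite_mi_abs_le[of "L - 1"]]) auto
  have CB: "IC \<gamma> \<subseteq> IB \<gamma>" for \<gamma> using N L by (auto simp: IB_def IC_def)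
  have inner: "(\<Sum>\<alpha> | mi_abs \<alpha> \<le> L - 1 - mi_abs \<gamma>. (- \<delta>) ^ (mi_abs \<gamma> + mi_abs \<alpha>) * a \<gamma> * v (\<gamma> + \<alpha>) * I \<alpha>)
      = \<delta> ^ mi_abs \<beta> * (\<Sum>\<nu>\<in>IB \<gamma>. F \<gamma> \<nu>)" if \<gamma>: "mi_abs \<gamma> \<le> N - 1" for \<gamma>
  proof -
    let ?f = "\<lambda>\<alpha>. (- \<delta>) ^ (mi_abs \<gamma> + mi_abs \<alpha>) * a \<gamma> * v (\<gamma> + \<alpha>) * I \<alpha>"
    have "(\<Sum>\<alpha> | mi_abs \<alpha> \<le> L - 1 - mi_abs \<gamma>. ?f \<alpha>) = (\<Sum>\<alpha>\<in>(+) \<beta> ` IB \<gamma>. ?f \<alpha>)"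
    proof (rule sum.mono_neutral_right[OF finite_mi_abs_le])
      show "(+) \<beta> ` IB \<gamma> \<subseteq> {\<alpha>. mi_abs \<alpha> \<le> L - 1 - mi_abs \<gamma>}" by (auto simp: IB_def mi_abs_add)
      show "\<forall>\<alpha>\<in>{\<alpha>. mi_abs \<alpha> \<le> L - 1 - mi_abs \<gamma>} - (+) \<beta> ` IB \<gamma>. ?f \<alpha> = 0"
      proof
        fix \<alpha> assume \<alpha>: "\<alpha> \<in> {\<alpha>. mi_abs \<alpha> \<le> L - 1 - mi_abs \<gamma>} - (+) \<beta> ` IB \<gamma>"
        have "\<not> \<beta> \<le> \<alpha>"
        proof
          assume "\<beta> \<le> \<alpha>"
          then have eq: "\<alpha> = \<beta> + (\<alpha> - \<beta>)" using mi_add_diff_inverse by metis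
          have "mi_abs \<alpha> = mi_abs \<beta> + mi_abs (\<alpha> - \<beta>)" using arg_cong[OF eq, of mi_abs] by (simp add: mi_abs_add)
          then have "\<alpha> - \<beta> \<in> IB \<gamma>" using \<alpha> \<gamma> N L by (auto simp: IB_def)
          then show False using \<alpha> eq by blast
        qed
        moreover have "mi_abs \<alpha> \<le> L - 1" using \<alpha> by auto
        ultimately show "?f \<alpha> = 0" using I[of \<alpha>] by simp
      qed
    qed
    also have "\<dots> = (\<Sum>\<nu>\<in>IB \<gamma>. ?f (\<beta> + \<nu>))" by (subst sum.reindex) (auto simp: inj_on_def)
    also have "\<dots> = (\<Sum>\<nu>\<in>IB \<gamma>. \<delta> ^ mi_abs \<beta> * F \<gamma> \<nu>)"
    proof (rule sum.cong[OF refl])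
      fix \<nu> assume \<nu>: "\<nu> \<in> IB \<gamma>"
      have "I (\<beta> + \<nu>) = (-1) ^ mi_abs \<beta> * J \<nu>"
        using I[of "\<beta> + \<nu>"] \<nu> by (simp add: IB_def mi_abs_add mi_le_add)
      moreover have "(- \<delta>) ^ mi_abs \<beta> * (-1) ^ mi_abs \<beta> = \<delta> ^ mi_abs \<beta>" by (simp flip: power_mult_distrib)
      moreover have "\<gamma> + (\<beta> + \<nu>) = \<beta> + (\<gamma> + \<nu>)" by (simp add: ac_simps)
      ultimately show "?f (\<beta> + \<nu>) = \<delta> ^ mi_abs \<beta> * F \<gamma> \<nu>"
        by (simp add: F_def mi_abs_add power_add)
    qed
    finally show ?thesis by (simp add: sum_distrib_left)
  qed
  have low: "(\<Sum>\<gamma> | mi_abs \<gamma> \<le> N - 1. \<Sum>\<nu>\<in>IC \<gamma>. F \<gamma> \<nu>) = v \<beta>"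
  proof -
    have "(\<Sum>\<gamma> | mi_abs \<gamma> \<le> N - 1. \<Sum>\<nu>\<in>IC \<gamma>. F \<gamma> \<nu>) = (\<Sum>\<kappa> | mi_abs \<kappa> \<le> N - 1. \<Sum>\<nu> | \<nu> \<le> \<kappa>. F (\<kappa> - \<nu>) \<nu>)"
      unfolding IC_def by (rule sum_convolution_mi)
    also have "\<dots> = (\<Sum>\<kappa> | mi_abs (\<kappa>::nat^'n) \<le> N - 1. if \<kappa> = 0 then v \<beta> else 0)"
    proof (rule sum.cong[OF refl])
      fix \<kappa> :: "nat^'n" assume \<kappa>: "\<kappa> \<in> {\<kappa>. mi_abs \<kappa> \<le> N - 1}"
      have "(\<Sum>\<nu> | \<nu> \<le> \<kappa>. F (\<kappa> - \<nu>) \<nu>) = (\<Sum>\<nu> | \<nu> \<le> \<kappa>. (- \<delta>) ^ mi_abs \<kappa> * v (\<beta> + \<kappa>) * (a (\<kappa> - \<nu>) * J \<nu>))"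
      proof (rule sum.cong[OF refl])
        fix \<nu> assume "\<nu> \<in> {\<nu>. \<nu> \<le> \<kappa>}"
        then have eq: "\<kappa> - \<nu> + \<nu> = \<kappa>" using mi_add_diff_inverse[of \<nu> \<kappa>] by (simp add: add.commute)
        have deg: "mi_abs (\<kappa> - \<nu>) + mi_abs \<nu> = mi_abs \<kappa>" using arg_cong[OF eq, of mi_abs] by (simp add: mi_abs_add)
        show "F (\<kappa> - \<nu>) \<nu> = (- \<delta>) ^ mi_abs \<kappa> * v (\<beta> + \<kappa>) * (a (\<kappa> - \<nu>) * J \<nu>)"
          unfolding F_def eq deg by simp
      qed
      also have "\<dots> = (- \<delta>) ^ mi_abs \<kappa> * v (\<beta> + \<kappa>) * (\<Sum>\<nu> | \<nu> \<le> \<kappa>. a (\<kappa> - \<nu>) * J \<nu>)"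
        by (rule sum_distrib_left[symmetric])
      also have "\<dots> = (if \<kappa> = 0 then v \<beta> else 0)"
      proof (cases "\<kappa> = 0")
        case True
        have "{\<nu>::nat^'n. \<nu> \<le> 0} = {0}" by (auto simp: less_eq_vec_def vec_eq_iff)
        then show ?thesis using True a0 J0 by (simp add: mi_abs_0)
      next
        case False
        then have "1 \<le> mi_abs \<kappa>" using mi_abs_eq_0_iff[of \<kappa>] by simp
        then show ?thesis using cond[of \<kappa>] \<kappa> False by simp
      qed
      finally show "(\<Sum>\<nu> | \<nu> \<le> \<kappa>. F (\<kappa> - \<nu>) \<nu>) = (if \<kappa> = 0 then v \<beta> else 0)" .
    qed
    also have "\<dots> = v \<beta>" by (subst sum.delta[OF finite_mi_abs_le]) (simp add: mi_abs_0)
    finally show ?thesis .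
  qed
  have high: "\<bar>\<Sum>\<nu>\<in>IB \<gamma> - IC \<gamma>. F \<gamma> \<nu>\<bar> \<le> (\<Sum>\<nu> | mi_abs \<nu> \<le> L - 1. \<bar>a \<gamma>\<bar> * \<bar>J \<nu>\<bar>) * E" for \<gamma>
  proof -
    have "\<bar>\<Sum>\<nu>\<in>IB \<gamma> - IC \<gamma>. F \<gamma> \<nu>\<bar> \<le> (\<Sum>\<nu>\<in>IB \<gamma> - IC \<gamma>. \<bar>a \<gamma>\<bar> * \<bar>J \<nu>\<bar> * E)"
    proof (rule order_trans[OF sum_abs sum_mono])
      fix \<nu> assume \<nu>: "\<nu> \<in> IB \<gamma> - IC \<gamma>"
      have "\<delta> ^ mi_abs (\<gamma> + \<nu>) * \<bar>v (\<beta> + (\<gamma> + \<nu>))\<bar> \<le> E"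
        using \<nu> N L by (intro v) (auto simp: IB_def IC_def mi_abs_add)
      then have "\<bar>a \<gamma>\<bar> * \<bar>J \<nu>\<bar> * (\<delta> ^ mi_abs (\<gamma> + \<nu>) * \<bar>v (\<beta> + (\<gamma> + \<nu>))\<bar>) \<le> \<bar>a \<gamma>\<bar> * \<bar>J \<nu>\<bar> * E"
        by (intro mult_left_mono) auto
      then show "\<bar>F \<gamma> \<nu>\<bar> \<le> \<bar>a \<gamma>\<bar> * \<bar>J \<nu>\<bar> * E"
        using \<delta> by (simp add: F_def abs_mult power_abs mi_abs_add mult_ac)
    qed
    also have "\<dots> \<le> (\<Sum>\<nu> | mi_abs \<nu> \<le> L - 1. \<bar>a \<gamma>\<bar> * \<bar>J \<nu>\<bar> * E)"
      using E by (intro sum_mono2 finite_mi_abs_le) (auto simp: IB_def)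
    finally show ?thesis by (simp add: sum_distrib_right)
  qed
  have "(\<Sum>\<gamma> | mi_abs \<gamma> \<le> N - 1. \<Sum>\<alpha> | mi_abs \<alpha> \<le> L - 1 - mi_abs \<gamma>.
           (- \<delta>) ^ (mi_abs \<gamma> + mi_abs \<alpha>) * a \<gamma> * v (\<gamma> + \<alpha>) * I \<alpha>)
     = (\<Sum>\<gamma> | mi_abs \<gamma> \<le> N - 1. \<delta> ^ mi_abs \<beta> * (\<Sum>\<nu>\<in>IB \<gamma>. F \<gamma> \<nu>))"
    using inner by (intro sum.cong) auto
  also have "\<dots> = \<delta> ^ mi_abs \<beta> * (\<Sum>\<gamma> | mi_abs \<gamma> \<le> N - 1. (\<Sum>\<nu>\<in>IB \<gamma> - IC \<gamma>. F \<gamma> \<nu>) + (\<Sum>\<nu>\<in>IC \<gamma>. F \<gamma> \<nu>))"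
    unfolding sum.subset_diff[OF CB finB] by (rule sum_distrib_left[symmetric])
  also have "\<dots> = \<delta> ^ mi_abs \<beta> * ((\<Sum>\<gamma> | mi_abs \<gamma> \<le> N - 1. \<Sum>\<nu>\<in>IB \<gamma> - IC \<gamma>. F \<gamma> \<nu>) + v \<beta>)"
    unfolding sum.distrib low ..
  finally have eq: "(\<Sum>\<gamma> | mi_abs \<gamma> \<le> N - 1. \<Sum>\<alpha> | mi_abs \<alpha> \<le> L - 1 - mi_abs \<gamma>.
           (- \<delta>) ^ (mi_abs \<gamma> + mi_abs \<alpha>) * a \<gamma> * v (\<gamma> + \<alpha>) * I \<alpha>) - \<delta> ^ mi_abs \<beta> * v \<beta>
     = \<delta> ^ mi_abs \<beta> * (\<Sum>\<gamma> | mi_abs \<gamma> \<le> N - 1. \<Sum>\<nu>\<in>IB \<gamma> - IC \<gamma>. F \<gamma> \<nu>)"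
    by (simp add: distrib_left)
  have "\<bar>\<Sum>\<gamma> | mi_abs \<gamma> \<le> N - 1. \<Sum>\<nu>\<in>IB \<gamma> - IC \<gamma>. F \<gamma> \<nu>\<bar>
      \<le> (\<Sum>\<gamma> | mi_abs \<gamma> \<le> N - 1. (\<Sum>\<nu> | mi_abs \<nu> \<le> L - 1. \<bar>a \<gamma>\<bar> * \<bar>J \<nu>\<bar>) * E)"
    by (intro order_trans[OF sum_abs sum_mono] high)
  then show ?thesis unfolding eq using \<delta> by (simp add: abs_mult sum_distrib_right)
qed

section \<open>The approximation theorem\<close>

lemma lattice_mean_moments_uniform:
  fixes G :: "real^'n \<Rightarrow> real"
  assumes G: "continuous_on UNIV G" "decays p G" and p: "p > real L + real CARD('n)" and e: "e > 0"
  shows "\<exists>\<eta>>0. \<eta> \<le> 1 \<and> (\<forall>\<alpha>::nat^'n. mi_abs \<alpha> \<le> L \<longrightarrow> (\<forall>y.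
     \<bar>lattice_mean \<eta> y (\<lambda>z. taylor_monom \<alpha> z * G z) - (\<integral>z. taylor_monom \<alpha> z * G z \<partial>lborel)\<bar> \<le> e))"
proof -
  have "\<exists>\<eta>\<^sub>0>0. \<eta>\<^sub>0 \<le> 1 \<and> (\<forall>\<eta> y. 0 < \<eta> \<longrightarrow> \<eta> \<le> \<eta>\<^sub>0 \<longrightarrow>
     \<bar>lattice_mean \<eta> y (\<lambda>z. taylor_monom \<alpha> z * G z) - (\<integral>z. taylor_monom \<alpha> z * G z \<partial>lborel)\<bar> \<le> e)"
    if "mi_abs \<alpha> \<le> L" for \<alpha> :: "nat^'n"
    unfolding lattice_mean_def
  proof (rule riemann_sum_uniform[OF decays_taylor_monom[OF G(2)] _ _ e])
    show "continuous_on UNIV (\<lambda>z. taylor_monom \<alpha> z * G z)"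
      by (intro continuous_on_mult continuous_taylor_monom G)
    show "p - real (mi_abs \<alpha>) > real CARD('n)" using that p by simp
  qed
  then obtain \<eta>\<^sub>0 where \<eta>\<^sub>0: "\<And>\<alpha>::nat^'n. mi_abs \<alpha> \<le> L \<Longrightarrow> \<eta>\<^sub>0 \<alpha> > 0" "\<And>\<alpha>. mi_abs \<alpha> \<le> L \<Longrightarrow> \<eta>\<^sub>0 \<alpha> \<le> 1"
    "\<And>\<alpha> \<eta> y. mi_abs \<alpha> \<le> L \<Longrightarrow> 0 < \<eta> \<Longrightarrow> \<eta> \<le> \<eta>\<^sub>0 \<alpha> \<Longrightarrow>
     \<bar>lattice_mean \<eta> y (\<lambda>z. taylor_monom \<alpha> z * G z) - (\<integral>z. taylor_monom \<alpha> z * G z \<partial>lborel)\<bar> \<le> e"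
    by metis
  let ?A = "{\<alpha>::nat^'n. mi_abs \<alpha> \<le> L}"
  define \<eta> where "\<eta> = Min (\<eta>\<^sub>0 ` ?A)"
  have ne: "0 \<in> ?A" by (simp add: mi_abs_0)
  have "\<eta> \<in> \<eta>\<^sub>0 ` ?A" unfolding \<eta>_def using ne by (intro Min_in finite_imageI finite_mi_abs_le) auto
  then have "\<eta> > 0" "\<eta> \<le> 1" using \<eta>\<^sub>0(1,2) by auto
  moreover have "\<eta> \<le> \<eta>\<^sub>0 \<alpha>" if "mi_abs \<alpha> \<le> L" for \<alpha>
    unfolding \<eta>_def using that by (intro Min_le finite_imageI finite_mi_abs_le) auto
  ultimately show ?thesis using \<eta>\<^sub>0(3) by blast
qed

text \<open>The sum is modified in three steps: \<open>w \<gamma>\<close> is replaced by its Taylor polynomial, the discrete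
  moments by the integrals, and the resulting polynomial by its only uncancelled term. The summands of the bound are
  the costs of the second, the first and the third step.\<close>

lemma discrete_error_estimate:
  fixes w :: "nat^'n \<Rightarrow> real^'n \<Rightarrow> real" and G :: "real^'n \<Rightarrow> real" and a J :: "nat^'n \<Rightarrow> real"
  assumes df: "deriv_family L w M" and N: "N \<ge> 1" and L: "L \<ge> N + mi_abs \<beta>"
    and a0: "a 0 = 1" and J0: "J 0 = 1"
    and cond: "\<And>\<kappa>. 1 \<le> mi_abs \<kappa> \<Longrightarrow> mi_abs \<kappa> \<le> N - 1 \<Longrightarrow> (\<Sum>\<nu> | \<nu> \<le> \<kappa>. a (\<kappa> - \<nu>) * J \<nu>) = 0"
    and I: "\<And>\<alpha>. mi_abs \<alpha> \<le> L - 1 \<Longrightarrow> (\<integral>z. taylor_monom \<alpha> z * G z \<partial>lborel) =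
              (if \<beta> \<le> \<alpha> then (-1) ^ mi_abs \<beta> * J (\<alpha> - \<beta>) else 0)"
    and CG: "CG \<ge> 0" "\<And>z. \<bar>G z\<bar> \<le> CG * (1 + norm z) powr (- p)" and p: "p > real L + real CARD('n)"
    and \<eta>: "0 < \<eta>" "\<eta> \<le> 1" and \<delta>: "\<delta> > 0"
    and B: "lattice_mean \<eta> y (\<lambda>z. (1 + norm z) powr (- (p - real L))) \<le> B"
    and e: "e \<ge> 0" "\<And>\<alpha>. mi_abs \<alpha> \<le> L \<Longrightarrow>
       \<bar>lattice_mean \<eta> y (\<lambda>z. taylor_monom \<alpha> z * G z) - (\<integral>z. taylor_monom \<alpha> z * G z \<partial>lborel)\<bar> \<le> e"
    and E: "E \<ge> 0" "\<And>\<kappa>. N \<le> mi_abs \<kappa> \<Longrightarrow> mi_abs \<beta> + mi_abs \<kappa> < L \<Longrightarrow> \<delta> ^ mi_abs \<kappa> * \<bar>w (\<beta> + \<kappa>) x\<bar> \<le> E"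
  shows "\<bar>(\<Sum>\<gamma> | mi_abs \<gamma> \<le> N - 1. (- \<delta>) ^ mi_abs \<gamma> * a \<gamma> * lattice_mean \<eta> y (\<lambda>z. w \<gamma> (x - \<delta> *\<^sub>R z) * G z))
           - \<delta> ^ mi_abs \<beta> * w \<beta> x\<bar>
     \<le> e * (\<Sum>\<gamma> | mi_abs \<gamma> \<le> N - 1. \<Sum>\<alpha> | mi_abs (\<alpha>::nat^'n) \<le> L - 1. \<bar>a \<gamma>\<bar>) * (\<Sum>\<kappa> | mi_abs \<kappa> \<le> L - 1. \<delta> ^ mi_abs \<kappa> * \<bar>w \<kappa> x\<bar>)
       + CG * B * (\<Sum>\<gamma> | mi_abs \<gamma> \<le> N - 1. \<bar>a \<gamma>\<bar> * real CARD('n) ^ (L - mi_abs \<gamma>)) * (\<delta> ^ L * (\<Sum>\<kappa> | mi_abs \<kappa> = L. M \<kappa>))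
       + \<delta> ^ mi_abs \<beta> * ((\<Sum>\<gamma> | mi_abs \<gamma> \<le> N - 1. \<Sum>\<nu> | mi_abs \<nu> \<le> L - 1. \<bar>a \<gamma>\<bar> * \<bar>J \<nu>\<bar>) * E)"
proof -
  let ?IN = "{\<gamma>::nat^'n. mi_abs \<gamma> \<le> N - 1}"
  let ?S = "\<Sum>\<kappa> | mi_abs \<kappa> = L. M \<kappa>"
  let ?W = "\<Sum>\<kappa> | mi_abs \<kappa> \<le> L - 1. \<delta> ^ mi_abs \<kappa> * \<bar>w \<kappa> x\<bar>"
  define X where "X = (\<lambda>\<gamma>. lattice_mean \<eta> y (\<lambda>z. w \<gamma> (x - \<delta> *\<^sub>R z) * G z))"
  define \<sigma> where "\<sigma> = (\<lambda>\<alpha>. lattice_mean \<eta> y (\<lambda>z. taylor_monom \<alpha> z * G z))"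
  define m where "m = (\<lambda>\<alpha>. \<integral>z. taylor_monom \<alpha> z * G z \<partial>lborel)"
  define Y where "Y = (\<lambda>s \<gamma>. \<Sum>\<alpha> | mi_abs \<alpha> \<le> L - 1 - mi_abs \<gamma>. (- \<delta>) ^ mi_abs \<alpha> * w (\<gamma> + \<alpha>) x * s \<alpha>)"
  have lt: "mi_abs \<gamma> < L" if "\<gamma> \<in> ?IN" for \<gamma> using that N L by auto
  have abs_pow: "\<bar>(- \<delta>) ^ k\<bar> = \<delta> ^ k" for k using \<delta> by (simp add: power_abs)
  have t1: "\<bar>(- \<delta>) ^ mi_abs \<gamma> * a \<gamma> * X \<gamma> - (- \<delta>) ^ mi_abs \<gamma> * a \<gamma> * Y \<sigma> \<gamma>\<bar>
      \<le> CG * B * (\<bar>a \<gamma>\<bar> * real CARD('n) ^ (L - mi_abs \<gamma>)) * (\<delta> ^ L * ?S)" if \<gamma>: "\<gamma> \<in> ?IN" for \<gamma>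
  proof -
    have "\<bar>X \<gamma> - Y \<sigma> \<gamma>\<bar> \<le> real CARD('n) ^ (L - mi_abs \<gamma>) * ?S * \<delta> ^ (L - mi_abs \<gamma>) * CG * B"
      unfolding X_def Y_def \<sigma>_def by (rule lattice_mean_taylor[OF df lt[OF \<gamma>] CG p \<eta> \<delta> B])
    then have "\<delta> ^ mi_abs \<gamma> * \<bar>a \<gamma>\<bar> * \<bar>X \<gamma> - Y \<sigma> \<gamma>\<bar>
        \<le> \<delta> ^ mi_abs \<gamma> * \<bar>a \<gamma>\<bar> * (real CARD('n) ^ (L - mi_abs \<gamma>) * ?S * \<delta> ^ (L - mi_abs \<gamma>) * CG * B)"
      using \<delta> by (intro mult_left_mono) auto
    also have "\<dots> = CG * B * (\<bar>a \<gamma>\<bar> * real CARD('n) ^ (L - mi_abs \<gamma>)) * ((\<delta> ^ mi_abs \<gamma> * \<delta> ^ (L - mi_abs \<gamma>)) * ?S)"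
      by (simp only: mult_ac)
    also have "\<delta> ^ mi_abs \<gamma> * \<delta> ^ (L - mi_abs \<gamma>) = \<delta> ^ L" using lt[OF \<gamma>] by (simp flip: power_add)
    finally show ?thesis by (simp only: abs_mult abs_pow right_diff_distrib[symmetric])
  qed
  have t2: "\<bar>(- \<delta>) ^ mi_abs \<gamma> * a \<gamma> * Y \<sigma> \<gamma> - (- \<delta>) ^ mi_abs \<gamma> * a \<gamma> * Y m \<gamma>\<bar>
      \<le> (\<Sum>\<alpha> | mi_abs (\<alpha>::nat^'n) \<le> L - 1. \<bar>a \<gamma>\<bar> * (e * ?W))" if \<gamma>: "\<gamma> \<in> ?IN" for \<gamma>
  proof -
    have W0: "?W \<ge> 0" using \<delta> by (intro sum_nonneg) auto
    have "Y \<sigma> \<gamma> - Y m \<gamma> = (\<Sum>\<alpha> | mi_abs \<alpha> \<le> L - 1 - mi_abs \<gamma>. (- \<delta>) ^ mi_abs \<alpha> * w (\<gamma> + \<alpha>) x * (\<sigma> \<alpha> - m \<alpha>))"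
      unfolding Y_def by (simp add: sum_subtractf right_diff_distrib)
    then have "\<bar>(- \<delta>) ^ mi_abs \<gamma> * a \<gamma> * (Y \<sigma> \<gamma> - Y m \<gamma>)\<bar>
        = \<bar>\<Sum>\<alpha> | mi_abs \<alpha> \<le> L - 1 - mi_abs \<gamma>. (- \<delta>) ^ mi_abs \<gamma> * a \<gamma> * ((- \<delta>) ^ mi_abs \<alpha> * w (\<gamma> + \<alpha>) x * (\<sigma> \<alpha> - m \<alpha>))\<bar>"
      by (simp only: sum_distrib_left)
    also have "\<dots> \<le> (\<Sum>\<alpha> | mi_abs (\<alpha>::nat^'n) \<le> L - 1 - mi_abs \<gamma>. \<bar>a \<gamma>\<bar> * (e * ?W))"
    proof (rule order_trans[OF sum_abs sum_mono])
      fix \<alpha> :: "nat^'n" assume \<alpha>: "\<alpha> \<in> {\<alpha>. mi_abs \<alpha> \<le> L - 1 - mi_abs \<gamma>}"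
      have in_L: "mi_abs (\<gamma> + \<alpha>) \<le> L - 1" using \<alpha> lt[OF \<gamma>] by (auto simp: mi_abs_add)
      have "\<delta> ^ mi_abs (\<gamma> + \<alpha>) * \<bar>w (\<gamma> + \<alpha>) x\<bar> \<le> ?W"
        using in_L \<delta> by (intro member_le_sum[where f = "\<lambda>\<kappa>. \<delta> ^ mi_abs \<kappa> * \<bar>w \<kappa> x\<bar>"] finite_mi_abs_le) auto
      moreover have "\<bar>\<sigma> \<alpha> - m \<alpha>\<bar> \<le> e" unfolding \<sigma>_def m_def using \<alpha> by (intro e(2)) auto
      ultimately have "\<bar>\<sigma> \<alpha> - m \<alpha>\<bar> * (\<delta> ^ mi_abs (\<gamma> + \<alpha>) * \<bar>w (\<gamma> + \<alpha>) x\<bar>) \<le> e * ?W"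
        using \<delta> e(1) by (intro mult_mono) auto
      then have "\<bar>a \<gamma>\<bar> * (\<bar>\<sigma> \<alpha> - m \<alpha>\<bar> * (\<delta> ^ mi_abs (\<gamma> + \<alpha>) * \<bar>w (\<gamma> + \<alpha>) x\<bar>)) \<le> \<bar>a \<gamma>\<bar> * (e * ?W)"
        by (intro mult_left_mono) auto
      moreover have "\<bar>(- \<delta>) ^ mi_abs \<gamma> * a \<gamma> * ((- \<delta>) ^ mi_abs \<alpha> * w (\<gamma> + \<alpha>) x * (\<sigma> \<alpha> - m \<alpha>))\<bar>
          = \<bar>a \<gamma>\<bar> * (\<bar>\<sigma> \<alpha> - m \<alpha>\<bar> * (\<delta> ^ mi_abs (\<gamma> + \<alpha>) * \<bar>w (\<gamma> + \<alpha>) x\<bar>))"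
        by (simp only: abs_mult abs_pow mi_abs_add power_add mult_ac)
      ultimately show "\<bar>(- \<delta>) ^ mi_abs \<gamma> * a \<gamma> * ((- \<delta>) ^ mi_abs \<alpha> * w (\<gamma> + \<alpha>) x * (\<sigma> \<alpha> - m \<alpha>))\<bar> \<le> \<bar>a \<gamma>\<bar> * (e * ?W)"
        by simp
    qed
    also have "\<dots> \<le> (\<Sum>\<alpha> | mi_abs (\<alpha>::nat^'n) \<le> L - 1. \<bar>a \<gamma>\<bar> * (e * ?W))"
      using e(1) W0 by (intro sum_mono2 finite_mi_abs_le) auto
    finally show ?thesis by (simp only: right_diff_distrib)
  qed
  have t3: "\<bar>(\<Sum>\<gamma>\<in>?IN. (- \<delta>) ^ mi_abs \<gamma> * a \<gamma> * Y m \<gamma>) - \<delta> ^ mi_abs \<beta> * w \<beta> x\<bar>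
      \<le> \<delta> ^ mi_abs \<beta> * ((\<Sum>\<gamma>\<in>?IN. \<Sum>\<nu> | mi_abs \<nu> \<le> L - 1. \<bar>a \<gamma>\<bar> * \<bar>J \<nu>\<bar>) * E)"
  proof -
    have "(\<Sum>\<gamma>\<in>?IN. (- \<delta>) ^ mi_abs \<gamma> * a \<gamma> * Y m \<gamma>) = (\<Sum>\<gamma>\<in>?IN. \<Sum>\<alpha> | mi_abs \<alpha> \<le> L - 1 - mi_abs \<gamma>.
           (- \<delta>) ^ (mi_abs \<gamma> + mi_abs \<alpha>) * a \<gamma> * w (\<gamma> + \<alpha>) x * m \<alpha>)"
      unfolding Y_def sum_distrib_left by (intro sum.cong refl) (simp add: power_add mult_ac)
    moreover have "m \<alpha> = (if \<beta> \<le> \<alpha> then (-1) ^ mi_abs \<beta> * J (\<alpha> - \<beta>) else 0)" if "mi_abs \<alpha> \<le> L - 1" for \<alpha>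
      using I[OF that] by (simp only: m_def)
    ultimately show ?thesis
      using moment_cancellation[where v = "\<lambda>\<kappa>. w \<kappa> x" and I = m, OF N L a0 J0 cond _ \<delta> E] by simp
  qed
  have s1: "\<bar>(\<Sum>\<gamma>\<in>?IN. (- \<delta>) ^ mi_abs \<gamma> * a \<gamma> * X \<gamma>) - (\<Sum>\<gamma>\<in>?IN. (- \<delta>) ^ mi_abs \<gamma> * a \<gamma> * Y \<sigma> \<gamma>)\<bar>
      \<le> CG * B * (\<Sum>\<gamma>\<in>?IN. \<bar>a \<gamma>\<bar> * real CARD('n) ^ (L - mi_abs \<gamma>)) * (\<delta> ^ L * ?S)"
  proof -
    have "\<bar>(\<Sum>\<gamma>\<in>?IN. (- \<delta>) ^ mi_abs \<gamma> * a \<gamma> * X \<gamma>) - (\<Sum>\<gamma>\<in>?IN. (- \<delta>) ^ mi_abs \<gamma> * a \<gamma> * Y \<sigma> \<gamma>)\<bar>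
      \<le> (\<Sum>\<gamma>\<in>?IN. CG * B * (\<bar>a \<gamma>\<bar> * real CARD('n) ^ (L - mi_abs \<gamma>)) * (\<delta> ^ L * ?S))"
      unfolding sum_subtractf[symmetric] by (intro order_trans[OF sum_abs sum_mono] t1)
    also have "\<dots> = CG * B * (\<Sum>\<gamma>\<in>?IN. \<bar>a \<gamma>\<bar> * real CARD('n) ^ (L - mi_abs \<gamma>)) * (\<delta> ^ L * ?S)"
      by (simp only: sum_distrib_right[symmetric] sum_distrib_left[symmetric])
    finally show ?thesis .
  qed
  have s2: "\<bar>(\<Sum>\<gamma>\<in>?IN. (- \<delta>) ^ mi_abs \<gamma> * a \<gamma> * Y \<sigma> \<gamma>) - (\<Sum>\<gamma>\<in>?IN. (- \<delta>) ^ mi_abs \<gamma> * a \<gamma> * Y m \<gamma>)\<bar>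
      \<le> e * (\<Sum>\<gamma>\<in>?IN. \<Sum>\<alpha> | mi_abs (\<alpha>::nat^'n) \<le> L - 1. \<bar>a \<gamma>\<bar>) * ?W"
  proof -
    have "\<bar>(\<Sum>\<gamma>\<in>?IN. (- \<delta>) ^ mi_abs \<gamma> * a \<gamma> * Y \<sigma> \<gamma>) - (\<Sum>\<gamma>\<in>?IN. (- \<delta>) ^ mi_abs \<gamma> * a \<gamma> * Y m \<gamma>)\<bar>
      \<le> (\<Sum>\<gamma>\<in>?IN. \<Sum>\<alpha> | mi_abs (\<alpha>::nat^'n) \<le> L - 1. \<bar>a \<gamma>\<bar> * (e * ?W))"
      unfolding sum_subtractf[symmetric] by (intro order_trans[OF sum_abs sum_mono] t2)
    also have "\<dots> = (\<Sum>\<gamma>\<in>?IN. \<Sum>\<alpha> | mi_abs (\<alpha>::nat^'n) \<le> L - 1. \<bar>a \<gamma>\<bar>) * (e * ?W)"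
      by (simp only: sum_distrib_right[symmetric])
    finally show ?thesis by (simp only: mult_ac)
  qed
  show ?thesis using s1 s2 t3 unfolding X_def by linarith
qed

theorem theorem6p3:
  fixes N L n\<^sub>0 :: nat
    and \<beta> :: "nat^'n"
    and a :: "nat^'n \<Rightarrow> real"
    and H :: "real^'n \<Rightarrow> real"
  assumes "N \<ge> 1" and "L \<ge> 1"
    and "L \<ge> N + mi_abs \<beta>"
    and "a 0 = 1"
    and "n\<^sub>0 = (LEAST k::nat. real k > real CARD('n) / 2)"
    and "differentiable_upto n\<^sub>0 H"
    and "\<exists>K C. K > real (N + CARD('n)) \<and> (\<forall>\<kappa>. mi_abs \<kappa> \<le> n\<^sub>0 \<longrightarrow>
           C \<kappa> > 0 \<and> (\<forall>x. \<bar>multi_deriv \<kappa> H x\<bar> \<le> C \<kappa> * (1 + norm x) powr (- K)))"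
    and "(\<integral>x. H x \<partial>lborel) = 1"
    and "\<forall>\<kappa>. 1 \<le> mi_abs \<kappa> \<and> mi_abs \<kappa> \<le> N - 1 \<longrightarrow>
           (\<Sum>\<alpha> | \<alpha> \<le> \<kappa>. a (\<kappa> - \<alpha>) / mi_fact \<alpha> * (\<integral>x. mi_monom x \<alpha> * H x \<partial>lborel)) = 0"
    and "\<exists>G. has_multi_deriv \<beta> H G"
    and "differentiable_upto n\<^sub>0 (multi_deriv \<beta> H)"
    and "\<exists>K' C'. K' > real (L + CARD('n)) \<and> (\<forall>\<kappa>. mi_abs \<kappa> \<le> n\<^sub>0 \<longrightarrow>
           C' \<kappa> > 0 \<and>
           (\<forall>x. \<bar>multi_deriv \<kappa> (multi_deriv \<beta> H) x\<bar> \<le> C' \<kappa> * (1 + norm x) powr (- K')))"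
  shows "\<exists>c\<^sub>1 c\<^sub>2 :: real. \<forall>\<epsilon>>0. \<exists>\<D>>0. \<forall>h>0. \<forall>u\<in>sobolev_Linf L.
           (\<forall>x. (\<lambda>m. hermite_qi_term N a H \<D> h u x m) summable_on UNIV) \<and>
           (\<exists>G. has_multi_deriv \<beta> (hermite_qi N a H \<D> h u) G) \<and>
           (\<forall>x. \<bar>multi_deriv \<beta> (hermite_qi N a H \<D> h u) x - weak_deriv \<beta> u x\<bar> \<le>
              \<epsilon> * (\<Sum>\<gamma> | mi_abs \<gamma> \<le> L - 1.
                    (h * sqrt \<D>) powi (int (mi_abs \<gamma>) - int (mi_abs \<beta>)) * \<bar>weak_deriv \<gamma> u x\<bar>)
              + c\<^sub>1 * (h * sqrt \<D>) ^ (L - mi_abs \<beta>) *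
                  (\<Sum>\<gamma> | mi_abs \<gamma> = L. Linf_norm (weak_deriv \<gamma> u))
              + c\<^sub>2 * (h * sqrt \<D>) ^ N *
                  (\<Sum>\<alpha> | mi_abs \<alpha> = N. Linf_norm (weak_deriv (\<alpha> + \<beta>) u)))"
proof -
  let ?n = "real CARD('n)"
  define G where "G = multi_deriv \<beta> H"
  define J where "J = (\<lambda>\<nu>. \<integral>z. taylor_monom \<nu> z * H z \<partial>lborel)"
  let ?IN = "{\<gamma>::nat^'n. mi_abs \<gamma> \<le> N - 1}"
  have HG: "has_multi_deriv \<beta> H G" using assms(10) multi_deriv_eq unfolding G_def by metis
  obtain K C where K: "K > real (N + CARD('n))" "\<forall>\<kappa>. mi_abs \<kappa> \<le> n\<^sub>0 \<longrightarrow>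
      C \<kappa> > 0 \<and> (\<forall>x. \<bar>multi_deriv \<kappa> H x\<bar> \<le> C \<kappa> * (1 + norm x) powr (- K))"
    using assms(7) by blast
  have dH: "decays K H" unfolding decays_def
    using K(2)[rule_format, of 0] by (intro exI[of _ "C 0"]) (auto simp: mi_abs_0 multi_deriv_0)
  obtain p C' where p: "p > real (L + CARD('n))" "\<forall>\<kappa>. mi_abs \<kappa> \<le> n\<^sub>0 \<longrightarrow>
      C' \<kappa> > 0 \<and> (\<forall>x. \<bar>multi_deriv \<kappa> (multi_deriv \<beta> H) x\<bar> \<le> C' \<kappa> * (1 + norm x) powr (- p))"
    using assms(12) by blast
  define CG where "CG = C' 0"
  have CG: "CG \<ge> 0" "\<And>z. \<bar>G z\<bar> \<le> CG * (1 + norm z) powr (- p)"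
    using p(2)[rule_format, of 0] by (auto simp: mi_abs_0 multi_deriv_0 CG_def G_def)
  have dG: "decays p G" using CG by (auto simp: decays_def)
  have p': "p > real L + ?n" using p(1) by simp
  \<comment> \<open>hence \<open>G\<close> is differentiable, and in particular continuous\<close>
  have "n\<^sub>0 \<noteq> 0"
  proof
    assume "n\<^sub>0 = 0"
    moreover have "real n\<^sub>0 > ?n / 2" unfolding assms(5) using reals_Archimedean2[of "?n / 2"] by (rule LeastI_ex)
    ultimately show False by simp
  qed
  then obtain n1 where "n\<^sub>0 = Suc n1" by (cases n\<^sub>0) auto
  then have "G differentiable (at z)" for z using assms(11) by (simp add: G_def)
  then have cG: "continuous_on UNIV G"
    using differentiable_imp_continuous_within continuous_at_imp_continuous_on by blast
  have chain: "partial_chain (\<lambda>k f. continuous_on UNIV f \<and> decays (p - real k) f) is H G"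
    if "mi_list \<beta> is" for "is"
  proof (rule intermediate_partials_decay[OF dH _ cG dG])
    show "K > 0" using K(1) by simp
    show "p > real (length is)" using p(1) assms(3) mi_list_length[OF that] by simp
    show "iterated_partial is H G" using HG that by (simp add: has_multi_deriv_iff)
  qed
  obtain js where js: "mi_list \<beta> js" using exists_mi_list by blast
  have I: "(\<integral>z. taylor_monom \<alpha> z * G z \<partial>lborel) = (if \<beta> \<le> \<alpha> then (-1) ^ mi_abs \<beta> * J (\<alpha> - \<beta>) else 0)"
    if "mi_abs \<alpha> \<le> L - 1" for \<alpha>
    unfolding J_def using that p(1) assms(2) by (intro moments_of_derivative[OF chain[OF js] js]) simp
  have J_eq: "J \<nu> = (\<integral>x. mi_monom x \<nu> * H x \<partial>lborel) / mi_fact \<nu>" for \<nu>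
    by (simp add: J_def taylor_monom_def)
  have J0: "J 0 = 1" using assms(8) by (simp add: J_eq mi_monom_0 mi_fact_0)
  have cond: "(\<Sum>\<nu> | \<nu> \<le> \<kappa>. a (\<kappa> - \<nu>) * J \<nu>) = 0" if "1 \<le> mi_abs \<kappa>" "mi_abs \<kappa> \<le> N - 1" for \<kappa>
    using assms(9)[rule_format, of \<kappa>] that by (simp add: J_eq)
  obtain B where B: "B \<ge> 0"
    "\<And>\<eta> (y::real^'n). 0 < \<eta> \<Longrightarrow> \<eta> \<le> 1 \<Longrightarrow> \<eta> ^ CARD('n) * (\<Sum>\<^sub>\<infinity>m. (1 + norm (y - \<eta> *\<^sub>R lattice_pt m)) powr (- (p - real L))) \<le> B"
  proof -
    have "p - real L > ?n" using p' by simp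
    then show thesis
    proof (rule lattice_sum_bound)
      fix B :: real
      assume "B \<ge> 0" "\<And>\<eta> (y::real^'n). 0 < \<eta> \<Longrightarrow> \<eta> \<le> 1 \<Longrightarrow>
        \<eta> ^ CARD('n) * (\<Sum>\<^sub>\<infinity>m. (1 + norm (y - \<eta> *\<^sub>R lattice_pt m)) powr (- (p - real L))) \<le> B"
      then show thesis by (rule that)
    qed
  qed
  define interp where "interp = (\<lambda>j \<Lambda>. \<forall>w M \<delta> x (\<kappa>::nat^'n). deriv_family L w M \<longrightarrow> \<delta> > 0 \<longrightarrow> mi_abs \<kappa> = j \<longrightarrow>
     \<delta> ^ j * \<bar>w (\<beta> + \<kappa>) x\<bar> \<le> \<Lambda> * (\<delta> ^ N * (\<Sum>\<alpha> | mi_abs \<alpha> = N. M (\<alpha> + \<beta>)) +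
                              \<delta> ^ (L - mi_abs \<beta>) * (\<Sum>\<gamma> | mi_abs \<gamma> = L. M \<gamma>)))"
  have "\<exists>\<Lambda>\<ge>0. N \<le> j \<and> mi_abs \<beta> + j < L \<longrightarrow> interp j \<Lambda>" for j
  proof (cases "N \<le> j \<and> mi_abs \<beta> + j < L")
    case True
    then show ?thesis using intermediate_deriv_bound[of N j \<beta> L] unfolding interp_def by auto
  qed auto
  then obtain \<Lambda> where \<Lambda>: "\<And>j. \<Lambda> j \<ge> 0" "\<And>j. N \<le> j \<Longrightarrow> mi_abs \<beta> + j < L \<Longrightarrow> interp j (\<Lambda> j)" by metis
  \<comment> \<open>one interpolation constant for all orders\<close>
  define \<Lambda>' where "\<Lambda>' = (\<Sum>j<L. \<Lambda> j)"
  have \<Lambda>_le: "\<Lambda> j \<le> \<Lambda>'" if "j < L" for j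
    unfolding \<Lambda>'_def using that \<Lambda>(1) by (intro member_le_sum) auto
  define c2 where "c2 = (\<Sum>\<gamma>\<in>?IN. \<Sum>\<nu> | mi_abs \<nu> \<le> L - 1. \<bar>a \<gamma>\<bar> * \<bar>J \<nu>\<bar>) * \<Lambda>'"
  define c1 where "c1 = CG * B * (\<Sum>\<gamma>\<in>?IN. \<bar>a \<gamma>\<bar> * ?n ^ (L - mi_abs \<gamma>)) + c2"
  define A where "A = (\<Sum>\<gamma>\<in>?IN. \<Sum>\<alpha> | mi_abs (\<alpha>::nat^'n) \<le> L - 1. \<bar>a \<gamma>\<bar>)"
  have A0: "A \<ge> 0" unfolding A_def by (intro sum_nonneg) simp
  show ?thesis
  proof (rule exI[of _ c1], rule exI[of _ c2], intro allI impI)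
    fix \<epsilon> :: real assume \<epsilon>: "\<epsilon> > 0"
    define e where "e = \<epsilon> / (A + 1)"
    have e: "e > 0" "e * A \<le> \<epsilon>" using \<epsilon> A0 by (auto simp: e_def field_simps)
    obtain \<eta> where \<eta>: "0 < \<eta>" "\<eta> \<le> 1" and mean: "\<And>(\<alpha>::nat^'n) y. mi_abs \<alpha> \<le> L \<Longrightarrow>
        \<bar>lattice_mean \<eta> y (\<lambda>z. taylor_monom \<alpha> z * G z) - (\<integral>z. taylor_monom \<alpha> z * G z \<partial>lborel)\<bar> \<le> e"
      using lattice_mean_moments_uniform[OF cG dG p' e(1)] by blast
    \<comment> \<open>the nodes divided by \<open>h * sqrt \<D>\<close> form a lattice of mesh \<open>1 / sqrt \<D> = \<eta>\<close>\<close>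
    define \<D> where "\<D> = (1 / \<eta>)\<^sup>2"
    have \<D>: "\<D> > 0" using \<eta> by (simp add: \<D>_def)
    have sqrt\<D>: "sqrt \<D> = 1 / \<eta>" using \<eta> by (simp add: \<D>_def)
    have \<D>_pow: "\<D> powr (- ?n / 2) = \<eta> ^ CARD('n)"
    proof -
      have "\<D> = (1 / \<eta>) powr 2" using \<eta> by (simp add: \<D>_def)
      then have "\<D> powr (- ?n / 2) = (1 / \<eta>) powr (- ?n)" by (simp add: powr_powr)
      also have "\<dots> = \<eta> powr ?n" using \<eta> by (simp add: powr_minus powr_divide)
      finally show ?thesis using \<eta> by (simp add: powr_realpow)
    qed
    show "\<exists>\<D>>0. \<forall>h>0. \<forall>u\<in>sobolev_Linf L.
           (\<forall>x. (\<lambda>m. hermite_qi_term N a H \<D> h u x m) summable_on UNIV) \<and>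
           (\<exists>G. has_multi_deriv \<beta> (hermite_qi N a H \<D> h u) G) \<and>
           (\<forall>x. \<bar>multi_deriv \<beta> (hermite_qi N a H \<D> h u) x - weak_deriv \<beta> u x\<bar> \<le>
              \<epsilon> * (\<Sum>\<gamma> | mi_abs \<gamma> \<le> L - 1.
                    (h * sqrt \<D>) powi (int (mi_abs \<gamma>) - int (mi_abs \<beta>)) * \<bar>weak_deriv \<gamma> u x\<bar>)
              + c1 * (h * sqrt \<D>) ^ (L - mi_abs \<beta>) *
                  (\<Sum>\<gamma> | mi_abs \<gamma> = L. Linf_norm (weak_deriv \<gamma> u))
              + c2 * (h * sqrt \<D>) ^ N *
                  (\<Sum>\<alpha> | mi_abs \<alpha> = N. Linf_norm (weak_deriv (\<alpha> + \<beta>) u)))"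
    proof (rule exI[of _ \<D>], intro conjI allI impI ballI)
      show "\<D> > 0" by (rule \<D>)
    next
      fix h :: real and u :: "real^'n \<Rightarrow> real" assume h: "h > 0" and u: "u \<in> sobolev_Linf L"
      define \<delta> where "\<delta> = h * sqrt \<D>"
      have \<delta>: "\<delta> > 0" and h_eq: "h = \<delta> * \<eta>" using h \<D> \<eta> by (auto simp: \<delta>_def sqrt\<D>)
      define w where "w = (\<lambda>\<gamma>. weak_deriv \<gamma> u)"
      define M where "M = (\<lambda>\<gamma>. Linf_norm (w \<gamma>))"
      have df: "deriv_family L w M" unfolding w_def M_def by (rule sobolev_deriv_family[OF u])
      define c where "c = (\<lambda>m. \<Sum>\<gamma>\<in>?IN. (- \<delta>) ^ mi_abs \<gamma> * a \<gamma> * w \<gamma> (h *\<^sub>R lattice_pt m))"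
      define Bc where "Bc = (\<Sum>\<gamma>\<in>?IN. \<delta> ^ mi_abs \<gamma> * \<bar>a \<gamma>\<bar> * M \<gamma>)"
      have c_bd: "\<bar>c m\<bar> \<le> Bc" for m
        unfolding c_def Bc_def
      proof (rule order_trans[OF sum_abs sum_mono])
        fix \<gamma> assume "\<gamma> \<in> ?IN"
        then have "\<bar>w \<gamma> (h *\<^sub>R lattice_pt m)\<bar> \<le> M \<gamma>" using df assms(1,3) by (auto simp: deriv_family_def)
        then show "\<bar>(- \<delta>) ^ mi_abs \<gamma> * a \<gamma> * w \<gamma> (h *\<^sub>R lattice_pt m)\<bar> \<le> \<delta> ^ mi_abs \<gamma> * \<bar>a \<gamma>\<bar> * M \<gamma>"
          using \<delta> by (simp add: abs_mult power_abs mult_left_mono)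
      qed
      have arg: "(x - h *\<^sub>R lattice_pt m) /\<^sub>R \<delta> = x /\<^sub>R \<delta> - \<eta> *\<^sub>R lattice_pt m" for x :: "real^'n" and m
        using \<delta> by (simp add: h_eq scaleR_diff_right)
      have term_eq: "hermite_qi_term N a H \<D> h u x m = c m * H (x /\<^sub>R \<delta> - \<eta> *\<^sub>R lattice_pt m)" for x m
        unfolding hermite_qi_term_def \<delta>_def[symmetric] arg c_def w_def by simp
      have qi_eq: "hermite_qi N a H \<D> h u = (\<lambda>x. \<eta> ^ CARD('n) * lattice_sum \<eta> \<delta> c H x)"
        unfolding hermite_qi_def term_eq \<D>_pow lattice_sum_def ..
      show "(\<lambda>m. hermite_qi_term N a H \<D> h u x m) summable_on UNIV" for x
      proof -
        have "K > ?n" using K(1) by simp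
        from weighted_lattice_summable[where y = "x /\<^sub>R \<delta>", OF dH this \<eta> c_bd]
        have "(\<lambda>m. norm (c m * H (x /\<^sub>R \<delta> - \<eta> *\<^sub>R lattice_pt m))) summable_on UNIV" by simp
        then show ?thesis unfolding term_eq by (rule abs_summable_summable)
      qed
      have deriv: "has_multi_deriv \<beta> (hermite_qi N a H \<D> h u)
          (\<lambda>x. \<eta> ^ CARD('n) / \<delta> ^ mi_abs \<beta> * lattice_sum \<eta> \<delta> c G x)"
        unfolding has_multi_deriv_iff qi_eq
      proof (intro allI impI)
        fix "is" assume il: "mi_list \<beta> is"
        have "p - real (length is) > ?n" using p(1) assms(3) mi_list_length[OF il] by simp
        from iterated_partial_lattice_sum[where r = "\<eta> ^ CARD('n)", OF chain[OF il] this \<eta> \<delta> c_bd]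
        show "iterated_partial is (\<lambda>x. \<eta> ^ CARD('n) * lattice_sum \<eta> \<delta> c H x)
            (\<lambda>x. \<eta> ^ CARD('n) / \<delta> ^ mi_abs \<beta> * lattice_sum \<eta> \<delta> c G x)"
          by (simp add: mi_list_length[OF il])
      qed
      then show "\<exists>G. has_multi_deriv \<beta> (hermite_qi N a H \<D> h u) G" by blast
      fix x :: "real^'n"
      let ?y = "x /\<^sub>R \<delta>"
      let ?R = "\<delta> ^ N * (\<Sum>\<alpha> | mi_abs \<alpha> = N. M (\<alpha> + \<beta>)) + \<delta> ^ (L - mi_abs \<beta>) * (\<Sum>\<gamma> | mi_abs \<gamma> = L. M \<gamma>)"
      let ?W = "\<Sum>\<kappa> | mi_abs \<kappa> \<le> L - 1. \<delta> ^ mi_abs \<kappa> * \<bar>w \<kappa> x\<bar>"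
      define T where "T = (\<Sum>\<gamma>\<in>?IN. (- \<delta>) ^ mi_abs \<gamma> * a \<gamma> * lattice_mean \<eta> ?y (\<lambda>z. w \<gamma> (x - \<delta> *\<^sub>R z) * G z))"
      have node: "x - \<delta> *\<^sub>R (?y - \<eta> *\<^sub>R lattice_pt m) = h *\<^sub>R lattice_pt m" for m
        using \<delta> by (simp add: h_eq scaleR_diff_right)
      have T_eq: "\<eta> ^ CARD('n) * lattice_sum \<eta> \<delta> c G x = T"
      proof -
        have "((\<lambda>m. \<Sum>\<gamma>\<in>?IN. (- \<delta>) ^ mi_abs \<gamma> * a \<gamma> * (\<eta> ^ CARD('n) * (w \<gamma> (h *\<^sub>R lattice_pt m) * G (?y - \<eta> *\<^sub>R lattice_pt m)))) has_sum T) UNIV"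
          unfolding T_def
        proof (intro has_sum_finite_sum finite_mi_abs_le has_sum_cmult_right)
          fix \<gamma> assume \<gamma>: "\<gamma> \<in> ?IN"
          have "(\<lambda>m. \<bar>w \<gamma> (x - \<delta> *\<^sub>R (?y - \<eta> *\<^sub>R lattice_pt m)) * G (?y - \<eta> *\<^sub>R lattice_pt m)\<bar>) summable_on UNIV"
            by (rule weighted_lattice_summable[OF dG _ \<eta>, of _ "M \<gamma>"])
              (use p df \<gamma> assms(1,3) in \<open>auto simp: deriv_family_def\<close>)
          from lattice_mean_has_sum[OF this]
          show "((\<lambda>m. \<eta> ^ CARD('n) * (w \<gamma> (h *\<^sub>R lattice_pt m) * G (?y - \<eta> *\<^sub>R lattice_pt m))) has_sum
              lattice_mean \<eta> ?y (\<lambda>z. w \<gamma> (x - \<delta> *\<^sub>R z) * G z)) UNIV"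
            unfolding node .
        qed
        moreover have "(\<Sum>\<gamma>\<in>?IN. (- \<delta>) ^ mi_abs \<gamma> * a \<gamma> * (\<eta> ^ CARD('n) * (w \<gamma> (h *\<^sub>R lattice_pt m) * G (?y - \<eta> *\<^sub>R lattice_pt m))))
            = \<eta> ^ CARD('n) * (c m * G (?y - \<eta> *\<^sub>R lattice_pt m))" for m
          unfolding c_def sum_distrib_left sum_distrib_right by (intro sum.cong refl) (simp only: mult_ac)
        ultimately have "((\<lambda>m. \<eta> ^ CARD('n) * (c m * G (?y - \<eta> *\<^sub>R lattice_pt m))) has_sum T) UNIV" by simp
        from infsumI[OF this] show ?thesis unfolding lattice_sum_def infsum_cmult_right' .
      qed
      have S_N: "(\<Sum>\<alpha> | mi_abs \<alpha> = N. M (\<alpha> + \<beta>)) \<ge> 0" and S_L: "(\<Sum>\<gamma> | mi_abs \<gamma> = L. M \<gamma>) \<ge> 0"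
        using df assms(3) by (auto intro!: sum_nonneg simp: deriv_family_def mi_abs_add)
      then have R0: "?R \<ge> 0" using \<delta> by simp
      have \<Lambda>'0: "\<Lambda>' \<ge> 0" unfolding \<Lambda>'_def using \<Lambda>(1) by (simp add: sum_nonneg)
      have E: "\<delta> ^ mi_abs \<kappa> * \<bar>w (\<beta> + \<kappa>) x\<bar> \<le> \<Lambda>' * ?R" if "N \<le> mi_abs \<kappa>" "mi_abs \<beta> + mi_abs \<kappa> < L" for \<kappa>
      proof -
        have "\<delta> ^ mi_abs \<kappa> * \<bar>w (\<beta> + \<kappa>) x\<bar> \<le> \<Lambda> (mi_abs \<kappa>) * ?R" using \<Lambda>(2)[OF that] df \<delta> unfolding interp_def by blast
        also have "\<dots> \<le> \<Lambda>' * ?R" using that(2) R0 by (intro mult_right_mono \<Lambda>_le) auto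
        finally show ?thesis .
      qed
      have lm_B: "lattice_mean \<eta> ?y (\<lambda>z. (1 + norm z) powr (- (p - real L))) \<le> B"
        unfolding lattice_mean_def by (rule B(2)[OF \<eta>])
      have "\<bar>T - \<delta> ^ mi_abs \<beta> * w \<beta> x\<bar> \<le> e * A * ?W
          + CG * B * (\<Sum>\<gamma>\<in>?IN. \<bar>a \<gamma>\<bar> * ?n ^ (L - mi_abs \<gamma>)) * (\<delta> ^ L * (\<Sum>\<kappa> | mi_abs \<kappa> = L. M \<kappa>))
          + \<delta> ^ mi_abs \<beta> * ((\<Sum>\<gamma>\<in>?IN. \<Sum>\<nu> | mi_abs \<nu> \<le> L - 1. \<bar>a \<gamma>\<bar> * \<bar>J \<nu>\<bar>) * (\<Lambda>' * ?R))"
        unfolding T_def A_def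
        by (rule discrete_error_estimate[OF df assms(1,3,4) J0 cond I CG p' \<eta> \<delta> lm_B less_imp_le[OF e(1)] mean _ E])
          (use \<Lambda>'0 R0 in simp_all)
      also have "\<dots> \<le> \<epsilon> * ?W
          + CG * B * (\<Sum>\<gamma>\<in>?IN. \<bar>a \<gamma>\<bar> * ?n ^ (L - mi_abs \<gamma>)) * (\<delta> ^ L * (\<Sum>\<kappa> | mi_abs \<kappa> = L. M \<kappa>))
          + \<delta> ^ mi_abs \<beta> * (c2 * ?R)"
      proof -
        have "?W \<ge> 0" using \<delta> by (intro sum_nonneg) auto
        then have "e * A * ?W \<le> \<epsilon> * ?W" by (rule mult_right_mono[OF e(2)])
        then show ?thesis unfolding c2_def mult.assoc[of _ \<Lambda>'] by linarith
      qed
      also have "\<dots> = \<delta> ^ mi_abs \<beta> * (\<epsilon> * (?W / \<delta> ^ mi_abs \<beta>)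
          + c1 * \<delta> ^ (L - mi_abs \<beta>) * (\<Sum>\<gamma> | mi_abs \<gamma> = L. M \<gamma>) + c2 * \<delta> ^ N * (\<Sum>\<alpha> | mi_abs \<alpha> = N. M (\<alpha> + \<beta>)))"
      proof -
        have "\<delta> ^ L = \<delta> ^ mi_abs \<beta> * \<delta> ^ (L - mi_abs \<beta>)" using assms(3) by (simp flip: power_add)
        moreover have "\<epsilon> * ?W = \<delta> ^ mi_abs \<beta> * (\<epsilon> * (?W / \<delta> ^ mi_abs \<beta>))" using \<delta> by simp
        ultimately show ?thesis unfolding c1_def distrib_left distrib_right by (simp only: mult_ac add_ac)
      qed
      finally have main: "\<bar>T - \<delta> ^ mi_abs \<beta> * w \<beta> x\<bar> / \<delta> ^ mi_abs \<beta> \<le> \<epsilon> * (?W / \<delta> ^ mi_abs \<beta>)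
          + c1 * \<delta> ^ (L - mi_abs \<beta>) * (\<Sum>\<gamma> | mi_abs \<gamma> = L. M \<gamma>) + c2 * \<delta> ^ N * (\<Sum>\<alpha> | mi_abs \<alpha> = N. M (\<alpha> + \<beta>))"
        using \<delta> by (simp add: divide_le_eq mult.commute)
      have lhs: "multi_deriv \<beta> (hermite_qi N a H \<D> h u) x - w \<beta> x = (T - \<delta> ^ mi_abs \<beta> * w \<beta> x) / \<delta> ^ mi_abs \<beta>"
        unfolding multi_deriv_eq[OF deriv] T_eq[symmetric] using \<delta> by (simp add: field_simps)
      have W_eq: "?W / \<delta> ^ mi_abs \<beta> = (\<Sum>\<gamma> | mi_abs \<gamma> \<le> L - 1. \<delta> powi (int (mi_abs \<gamma>) - int (mi_abs \<beta>)) * \<bar>w \<gamma> x\<bar>)"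
        using \<delta> by (simp add: sum_divide_distrib power_int_diff)
      show "\<bar>multi_deriv \<beta> (hermite_qi N a H \<D> h u) x - weak_deriv \<beta> u x\<bar> \<le>
              \<epsilon> * (\<Sum>\<gamma> | mi_abs \<gamma> \<le> L - 1.
                    (h * sqrt \<D>) powi (int (mi_abs \<gamma>) - int (mi_abs \<beta>)) * \<bar>weak_deriv \<gamma> u x\<bar>)
              + c1 * (h * sqrt \<D>) ^ (L - mi_abs \<beta>) *
                  (\<Sum>\<gamma> | mi_abs \<gamma> = L. Linf_norm (weak_deriv \<gamma> u))
              + c2 * (h * sqrt \<D>) ^ N *
                  (\<Sum>\<alpha> | mi_abs \<alpha> = N. Linf_norm (weak_deriv (\<alpha> + \<beta>) u))"
        using main \<delta> unfolding \<delta>_def[symmetric] W_eq[symmetric, unfolded w_def] lhs[unfolded w_def] M_def w_def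
        by (simp add: abs_divide)
    qed
  qed
qed

end
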